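(* Let $k\ge 2$ be an integer and let $J=\{0,1,\dots,k\}\times\mathbb Z$. For $(a,m),(b,n)\in J$ put $h((a,m),(b,n))=\min(a,k-b)-m+n$, and let $$O=\{((a,m),(b,n))\in J\times J:\ h((a,m),(b,n))\ge k\}.$$ Call a pair in $J\times J$ normal-ordered if it belongs to $O$, and call a product $\varphi_{a_1,j_1}\cdots\varphi_{a_s,j_s}$ normal-ordered if each pair $((a_l,j_l),(a_{l+1},j_{l+1}))$, $1\le l\le s-1$, is normal-ordered. Then the set of normal-ordered pairs $O$ is good, i.e. in the algebra $R_k$ defined in the context the following are valid: (a) any product $\varphi_{a_1,j_1}\cdots\varphi_{a_s,j_s}$ can be rewritten as a linear combination of normal-ordered products by using the normal-ordering rules; (b) normal-ordered products are linearly independent.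
   Context: $B_k$ is the algebra over $\mathbb C$ with generators $\varphi_{a,n}$ ($0\le a\le k$, $n\in\mathbb Z$) subject only to (skew-)commutativity: the generators commute if $k$ is even and anticommute if $k$ is odd. $B_k^{(s)}$ is the span of products of $s$ generators. For $N\in\mathbb Z$, $B_{k,N}$ is the ideal of $B_k$ generated by $\{\varphi_{a,m}: m>N\}$, $B^{(s)}_{k,N}=B_k^{(s)}\cap B_{k,N}$, and the completion is $\bar B_k=\bigoplus_{s\ge0}\bar B_k^{(s)}$ with $\bar B_k^{(s)}=\varprojlim_N B_k^{(s)}/B_{k,N}^{(s)}$. Put $\varphi_a(z)=\sum_{n\in\mathbb Z}\varphi_{a,n}z^{-n}$ (with $\varphi_{-1}(z)=\varphi_{k+1}(z)=0$) and let $\varphi_a^{(m)}(z)$ be its $m$-th derivative in $z$. The affine Lie algebra $\widehat{sl}_2$, with Chevalley generators $e_i,h_i,f_i$ ($i=0,1$), acts on $B_k$ (by derivations) and on $\bar B_k$ by $e_0\varphi_a(z)=(a+1)z\varphi_{a+1}(z)$, $e_1\varphi_a(z)=(k-a+1)\varphi_{a-1}(z)$, $f_0\varphi_a(z)=(k-a+1)z^{-1}\varphi_{a-1}(z)$, $f_1\varphi_a(z)=(a+1)\varphi_{a+1}(z)$, $h_0\varphi_a(z)=-(k-2a)\varphi_a(z)$, $h_1\varphi_a(z)=(k-2a)\varphi_a(z)$. $Q_k^{(2)}\subset\bar B_k^{(2)}$ is the $\widehat{sl}_2$-invariant subspace generated by (the Fourier coefficients of) $\varphi_0(z)\varphi_0^{(k-2)}(z)$.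 $R_k$ is the quotient of $\bar B_k$ by the ideal generated by $Q_k^{(2)}$. Normal-ordering rules are the quadratic relations of $R_k$ (those given by $Q_k^{(2)}$ and by (skew-)commutativity) rewritten so as to express products of two generators that are not normal-ordered through normal-ordered ones. For example, for $k=2$ the relation $\varphi_0(z)^2=0$ is rewritten as the rules $\varphi_{0,l}\varphi_{0,l}=-2\sum_{n\ge1}\varphi_{0,l-n}\varphi_{0,l+n}$ and $\varphi_{0,l}\varphi_{0,l+1}=-\sum_{n\ge1}\varphi_{0,l-n}\varphi_{0,l+1+n}$, whose right-hand sides are infinite sums in the completion.
   Formalization: The ideal generated by Q_k^(2) is taken to be closed in the completion; with the purely algebraic ideal (a) fails, e.g. for φ_{0,0}^3 when k=2. Linear combinations may be convergent infinite sums, and rewriting means a limit of rule applications. *)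

theory Defs
  imports
    Complex_Main
    "HOL-Library.Multiset"
    "HOL-Library.Product_Lexorder"
    "HOL-Algebra.QuotRing"
begin

section \<open>The completed algebra\<close>

text \<open>
  The pair (a, n) stands for the generator \<open>\<phi>\<^bsub>a,n\<^esub>\<close>.  Generators are compared lexicographically;
  this order only serves to fix a monomial basis.
\<close>

type_synonym gen = "nat \<times> int"

definition gens :: "nat \<Rightarrow> gen set" where
  "gens k = {0..k} \<times> UNIV"

text \<open>
  \<open>B\<^sub>k\<close> is the polynomial algebra (k even) or the exterior algebra (k odd; over the complex
  numbers anticommutativity forces \<open>\<phi>\<^sup>2 = 0\<close>) on the generators.  Its basis consists of the
  increasingly sorted products of the multisets below.
\<close>

definition basis_monos :: "nat \<Rightarrow> gen multiset set" where
  "basis_monos k = {M. set_mset M \<subseteq> gens k \<and> (odd k \<longrightarrow> (\<forall>x. count M x \<le> 1))}"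

definition inversions :: "gen multiset \<Rightarrow> gen multiset \<Rightarrow> nat" where
  "inversions A B = (\<Sum>x\<in>#A. size {#y \<in># B. y < x#})"

text \<open>
  The monomials all of whose modes are \<open>\<le> N\<close> form a basis of \<open>B\<^sub>k\<close> modulo the ideal \<open>B\<^bsub>k,N\<^esub>\<close>
  generated by the \<open>\<phi>\<^bsub>a,m\<^esub>\<close> with \<open>m > N\<close>.  Hence an element of the inverse limit of the
  \<open>B\<^sub>k\<^sup>(\<^sup>s\<^sup>) / B\<^bsub>k,N\<^esub>\<^sup>(\<^sup>s\<^sup>)\<close> is a formal, possibly infinite, linear combination of monomials of length s
  that contains, for every N, only finitely many monomials with all modes \<open>\<le> N\<close>.  The bound on the
  lengths expresses the direct sum over s.  In the product, the sorted monomials of A and B multiply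
  to \<open>(-1)\<^bsup>k * inversions A B\<^esup>\<close> times the sorted monomial of \<open>A + B\<close>, or to 0 if \<open>A + B\<close> is
  not in \<open>basis_monos k\<close>.
\<close>

definition Bbar :: "nat \<Rightarrow> (gen multiset \<Rightarrow> complex) ring" where
  "Bbar k =
    \<lparr>carrier = {F. (\<forall>M. F M \<noteq> 0 \<longrightarrow> M \<in> basis_monos k) \<and>
                   (\<exists>s. \<forall>M. F M \<noteq> 0 \<longrightarrow> size M \<le> s) \<and>
                   (\<forall>N. finite {M. F M \<noteq> 0 \<and> (\<forall>x\<in>#M. snd x \<le> N)})},
     mult = (\<lambda>F G M. if M \<in> basis_monos k
                      then \<Sum>A | A \<subseteq># M. (-1) ^ (k * inversions A (M - A)) * F A * G (M - A)
                      else 0),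
     one = (\<lambda>M. if M = {#} then 1 else 0),
     zero = (\<lambda>M. 0),
     add = (\<lambda>F G M. F M + G M)\<rparr>"

definition gen_elem :: "nat \<Rightarrow> gen \<Rightarrow> gen multiset \<Rightarrow> complex" where
  "gen_elem k x = (\<lambda>M. if x \<in> gens k \<and> M = {#x#} then 1 else 0)"

definition word_prod :: "nat \<Rightarrow> gen list \<Rightarrow> gen multiset \<Rightarrow> complex" where
  "word_prod k w = foldr (\<lambda>x F. gen_elem k x \<otimes>\<^bsub>Bbar k\<^esub> F) w \<one>\<^bsub>Bbar k\<^esub>"


lemma inversions_empty [simp]: "inversions {#} B = 0" "inversions A {#} = 0"
  by (simp_all add: inversions_def)

lemma inversions_union:
  "inversions (A + B) C = inversions A C + inversions B C"
  "inversions A (B + C) = inversions A B + inversions A C"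
  by (simp_all add: inversions_def sum_mset.distrib)

lemma basis_monos_mono: "M \<in> basis_monos k \<Longrightarrow> A \<subseteq># M \<Longrightarrow> A \<in> basis_monos k"
  unfolding basis_monos_def
  by (auto dest: set_mset_mono) (metis le_trans mset_subset_eq_count)

lemma finite_submultisets: "finite {A. A \<subseteq># (M :: 'a multiset)}"
proof (induction M)
  case (add x M)
  have "{A. A \<subseteq># add_mset x M} \<subseteq> {A. A \<subseteq># M} \<union> add_mset x ` {A. A \<subseteq># M}"
  proof
    fix A assume "A \<in> {A. A \<subseteq># add_mset x M}"
    then have A: "A \<subseteq># add_mset x M" by simp
    show "A \<in> {A. A \<subseteq># M} \<union> add_mset x ` {A. A \<subseteq># M}"
    proof (cases "x \<in># A")
      case True
      then obtain B where "A = add_mset x B" by (meson multi_member_split)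
      then show ?thesis using A by auto
    next
      case False
      then have "A \<subseteq># M" using A
        by (metis diff_single_trivial add_mset_remove_trivial subset_eq_diff_conv add_mset_add_single)
      then show ?thesis by simp
    qed
  qed
  then show ?case using add finite_subset by blast
qed simp

lemma carrier_mult:
  assumes F: "F \<in> carrier (Bbar k)" and G: "G \<in> carrier (Bbar k)"
  shows "F \<otimes>\<^bsub>Bbar k\<^esub> G \<in> carrier (Bbar k)"
proof -
  let ?H = "F \<otimes>\<^bsub>Bbar k\<^esub> G"
  have nz: "M \<in> basis_monos k \<and> (\<exists>A. A \<subseteq># M \<and> F A \<noteq> 0 \<and> G (M - A) \<noteq> 0)" if "?H M \<noteq> 0" for M
  proof -
    have M: "M \<in> basis_monos k" using that by (auto simp: Bbar_def split: if_splits)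
    then have "(\<Sum>A | A \<subseteq># M. (-1) ^ (k * inversions A (M - A)) * F A * G (M - A)) \<noteq> 0"
      using that by (simp add: Bbar_def)
    then obtain A where "A \<subseteq># M" "(-1) ^ (k * inversions A (M - A)) * F A * G (M - A) \<noteq> 0"
      by (metis (mono_tags, lifting) mem_Collect_eq sum.not_neutral_contains_not_neutral)
    then show ?thesis using M by auto
  qed
  obtain s t where s: "\<forall>M. F M \<noteq> 0 \<longrightarrow> size M \<le> s" and t: "\<forall>M. G M \<noteq> 0 \<longrightarrow> size M \<le> t"
    using F G by (auto simp: Bbar_def)
  have "size M \<le> s + t" if nzM: "?H M \<noteq> 0" for M
  proof -
    obtain A where A: "A \<subseteq># M" "F A \<noteq> 0" "G (M - A) \<noteq> 0" using nz[OF nzM] by blast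
    then have "size M = size A + size (M - A)" by (metis size_union subset_mset.add_diff_inverse)
    then show ?thesis using s t A by (metis add_mono)
  qed
  moreover have "finite {M. ?H M \<noteq> 0 \<and> (\<forall>x\<in>#M. snd x \<le> N)}" for N
  proof -
    let ?S = "\<lambda>F :: gen multiset \<Rightarrow> complex. {M. F M \<noteq> 0 \<and> (\<forall>x\<in>#M. snd x \<le> N)}"
    have "?S ?H \<subseteq> (\<lambda>(A, B). A + B) ` (?S F \<times> ?S G)"
    proof
      fix M assume M: "M \<in> ?S ?H"
      then obtain A where A: "A \<subseteq># M" "F A \<noteq> 0" "G (M - A) \<noteq> 0" using nz by blast
      then have "A \<in> ?S F" "M - A \<in> ?S G" using M by (auto dest: mset_subset_eqD in_diffD)
      moreover have "M = A + (M - A)" using A by simp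
      ultimately show "M \<in> (\<lambda>(A, B). A + B) ` (?S F \<times> ?S G)" by (metis (no_types, lifting) SigmaI case_prod_conv image_eqI)
    qed
    moreover have "finite (?S F)" "finite (?S G)" using F G by (auto simp: Bbar_def)
    ultimately show ?thesis by (meson finite_SigmaI finite_imageI finite_subset)
  qed
  moreover have "carrier (Bbar k) = {F. (\<forall>M. F M \<noteq> 0 \<longrightarrow> M \<in> basis_monos k) \<and>
                   (\<exists>s. \<forall>M. F M \<noteq> 0 \<longrightarrow> size M \<le> s) \<and>
                   (\<forall>N. finite {M. F M \<noteq> 0 \<and> (\<forall>x\<in>#M. snd x \<le> N)})}" by (simp add: Bbar_def)
  ultimately show ?thesis using nz by blast
qed

lemma mult_assoc_Bbar:
  "(F \<otimes>\<^bsub>Bbar k\<^esub> G) \<otimes>\<^bsub>Bbar k\<^esub> H = F \<otimes>\<^bsub>Bbar k\<^esub> (G \<otimes>\<^bsub>Bbar k\<^esub> H)"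
proof
  fix M
  let ?e = "\<lambda>A B. (-1 :: complex) ^ (k * inversions A B)"
  show "((F \<otimes>\<^bsub>Bbar k\<^esub> G) \<otimes>\<^bsub>Bbar k\<^esub> H) M = (F \<otimes>\<^bsub>Bbar k\<^esub> (G \<otimes>\<^bsub>Bbar k\<^esub> H)) M"
  proof (cases "M \<in> basis_monos k")
    case True
    have [simp]: "A \<in> basis_monos k" if "A \<subseteq># M" for A
      using True that by (rule basis_monos_mono)
    have [simp]: "M - A \<in> basis_monos k" for A
      using True by (rule basis_monos_mono) simp
    have "((F \<otimes>\<^bsub>Bbar k\<^esub> G) \<otimes>\<^bsub>Bbar k\<^esub> H) M
        = (\<Sum>A | A \<subseteq># M. \<Sum>C | C \<subseteq># A.
             ?e A (M - A) * (?e C (A - C) * F C * G (A - C)) * H (M - A))"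
      using True by (simp add: Bbar_def sum_distrib_left sum_distrib_right)
    also have "\<dots> = (\<Sum>(A, C)\<in>(SIGMA A:{A. A \<subseteq># M}. {C. C \<subseteq># A}).
             ?e A (M - A) * (?e C (A - C) * F C * G (A - C)) * H (M - A))"
      by (rule sum.Sigma) (simp_all add: finite_submultisets)
    also have "\<dots> = (\<Sum>(C, D)\<in>(SIGMA C:{C. C \<subseteq># M}. {D. D \<subseteq># M - C}).
             ?e C (M - C) * F C * (?e D (M - C - D) * G D * H (M - C - D)))"
    proof (rule sum.reindex_bij_witness[of _ "\<lambda>(C, D). (C + D, C)" "\<lambda>(A, C). (C, A - C)"])
      fix p assume "p \<in> (SIGMA A:{A. A \<subseteq># M}. {C. C \<subseteq># A})"
      then obtain A C where p: "p = (A, C)" "A \<subseteq># M" "C \<subseteq># A" by auto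
      obtain D where D: "A = C + D" using p(3) by (metis subset_mset.le_iff_add)
      obtain E where E: "M = C + D + E" using p(2) D by (metis subset_mset.le_iff_add)
      show "(case case p of (A, C) \<Rightarrow> (C, A - C) of (C, D) \<Rightarrow> (C + D, C)) = p"
        by (simp add: p D)
      show "(case p of (A, C) \<Rightarrow> (C, A - C)) \<in> (SIGMA C:{C. C \<subseteq># M}. {D. D \<subseteq># M - C})"
        by (simp add: p D E)
      show "(case case p of (A, C) \<Rightarrow> (C, A - C) of (C, D) \<Rightarrow>
              ?e C (M - C) * F C * (?e D (M - C - D) * G D * H (M - C - D))) =
            (case p of (A, C) \<Rightarrow>
              ?e A (M - A) * (?e C (A - C) * F C * G (A - C)) * H (M - A))"
        by (simp add: p D E inversions_union distrib_left power_add)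
    next
      fix q assume "q \<in> (SIGMA C:{C. C \<subseteq># M}. {D. D \<subseteq># M - C})"
      then obtain C D where q: "q = (C, D)" "C \<subseteq># M" "D \<subseteq># M - C" by auto
      obtain L where L: "M = C + L" using q(2) by (metis subset_mset.le_iff_add)
      then obtain E where E: "L = D + E" using q(3) by (metis subset_mset.le_iff_add add_diff_cancel_left')
      show "(case case q of (C, D) \<Rightarrow> (C + D, C) of (A, C) \<Rightarrow> (C, A - C)) = q"
        by (simp add: q)
      show "(case q of (C, D) \<Rightarrow> (C + D, C)) \<in> (SIGMA A:{A. A \<subseteq># M}. {C. C \<subseteq># A})"
        by (simp add: q L E)
    qed
    also have "\<dots> = (\<Sum>C | C \<subseteq># M. \<Sum>D | D \<subseteq># M - C.
             ?e C (M - C) * F C * (?e D (M - C - D) * G D * H (M - C - D)))"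
      by (rule sum.Sigma[symmetric]) (simp_all add: finite_submultisets)
    also have "\<dots> = (F \<otimes>\<^bsub>Bbar k\<^esub> (G \<otimes>\<^bsub>Bbar k\<^esub> H)) M"
      using True by (simp add: Bbar_def sum_distrib_left)
    finally show ?thesis .
  qed (simp add: Bbar_def)
qed

lemma ring_Bbar: "ring (Bbar k)"
proof (rule ringI)
  show "abelian_group (Bbar k)"
  proof (rule abelian_groupI)
    fix F G assume FG: "F \<in> carrier (Bbar k)" "G \<in> carrier (Bbar k)"
    obtain s t where "\<forall>M. F M \<noteq> 0 \<longrightarrow> size M \<le> s" "\<forall>M. G M \<noteq> 0 \<longrightarrow> size M \<le> t"
      using FG by (auto simp: Bbar_def)
    then have "\<forall>M. F M + G M \<noteq> 0 \<longrightarrow> size M \<le> s + t"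
      by (metis add.right_neutral trans_le_add1 trans_le_add2)
    then have "\<exists>s. \<forall>M. F M + G M \<noteq> 0 \<longrightarrow> size M \<le> s" by blast
    moreover have "finite {M. F M + G M \<noteq> 0 \<and> (\<forall>x\<in>#M. snd x \<le> N)}" for N
    proof (rule finite_subset)
      show "{M. F M + G M \<noteq> 0 \<and> (\<forall>x\<in>#M. snd x \<le> N)}
          \<subseteq> {M. F M \<noteq> 0 \<and> (\<forall>x\<in>#M. snd x \<le> N)} \<union> {M. G M \<noteq> 0 \<and> (\<forall>x\<in>#M. snd x \<le> N)}"
        by auto
      show "finite ({M. F M \<noteq> 0 \<and> (\<forall>x\<in>#M. snd x \<le> N)} \<union> {M. G M \<noteq> 0 \<and> (\<forall>x\<in>#M. snd x \<le> N)})"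
        using FG by (auto simp: Bbar_def)
    qed
    moreover have "M \<in> basis_monos k" if nz: "F M + G M \<noteq> 0" for M
    proof -
      have "F M \<noteq> 0 \<or> G M \<noteq> 0" using nz by auto
      then show ?thesis using FG by (auto simp: Bbar_def)
    qed
    ultimately show "F \<oplus>\<^bsub>Bbar k\<^esub> G \<in> carrier (Bbar k)"
      by (simp add: Bbar_def)
  next
    fix F assume "F \<in> carrier (Bbar k)"
    then have "(\<lambda>M. - F M) \<in> carrier (Bbar k)" by (simp add: Bbar_def)
    moreover have "(\<lambda>M. - F M) \<oplus>\<^bsub>Bbar k\<^esub> F = \<zero>\<^bsub>Bbar k\<^esub>" by (simp add: Bbar_def)
    ultimately show "\<exists>G\<in>carrier (Bbar k). G \<oplus>\<^bsub>Bbar k\<^esub> F = \<zero>\<^bsub>Bbar k\<^esub>" by blast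
  qed (auto simp: Bbar_def add_ac)
next
  show "monoid (Bbar k)"
  proof (rule monoidI)
    show "\<one>\<^bsub>Bbar k\<^esub> \<in> carrier (Bbar k)"
      by (auto simp: Bbar_def basis_monos_def)
  next
    fix F assume F: "F \<in> carrier (Bbar k)"
    show "\<one>\<^bsub>Bbar k\<^esub> \<otimes>\<^bsub>Bbar k\<^esub> F = F"
    proof
      fix M
      have "(\<Sum>A | A \<subseteq># M. (-1) ^ (k * inversions A (M - A)) * (if A = {#} then 1 else 0) * F (M - A))
          = (\<Sum>A | A \<subseteq># M. if A = {#} then F M else 0)"
        by (rule sum.cong) auto
      also have "\<dots> = F M" by (simp add: finite_submultisets)
      finally show "(\<one>\<^bsub>Bbar k\<^esub> \<otimes>\<^bsub>Bbar k\<^esub> F) M = F M"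
        using F by (auto simp: Bbar_def)
    qed
    show "F \<otimes>\<^bsub>Bbar k\<^esub> \<one>\<^bsub>Bbar k\<^esub> = F"
    proof
      fix M
      have "(\<Sum>A | A \<subseteq># M. (-1) ^ (k * inversions A (M - A)) * F A * (if M - A = {#} then 1 else 0))
          = (\<Sum>A | A \<subseteq># M. if A = M then F M else 0)"
        by (rule sum.cong) (auto simp: Diff_eq_empty_iff_mset subset_mset.antisym)
      also have "\<dots> = F M" by (simp add: finite_submultisets)
      finally show "(F \<otimes>\<^bsub>Bbar k\<^esub> \<one>\<^bsub>Bbar k\<^esub>) M = F M"
        using F by (auto simp: Bbar_def)
    qed
  qed (simp_all add: carrier_mult mult_assoc_Bbar)
next
  fix F G H
  show "(F \<oplus>\<^bsub>Bbar k\<^esub> G) \<otimes>\<^bsub>Bbar k\<^esub> H = F \<otimes>\<^bsub>Bbar k\<^esub> H \<oplus>\<^bsub>Bbar k\<^esub> G \<otimes>\<^bsub>Bbar k\<^esub> H"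
    by (simp add: Bbar_def fun_eq_iff algebra_simps sum.distrib)
  show "H \<otimes>\<^bsub>Bbar k\<^esub> (F \<oplus>\<^bsub>Bbar k\<^esub> G) = H \<otimes>\<^bsub>Bbar k\<^esub> F \<oplus>\<^bsub>Bbar k\<^esub> H \<otimes>\<^bsub>Bbar k\<^esub> G"
    by (simp add: Bbar_def fun_eq_iff algebra_simps sum.distrib)
qed

lemma word_prod_pair:
  "word_prod k [x, y] M = (if M = {#x, y#} \<and> M \<in> basis_monos k then (-1) ^ (if y < x then k else 0) else 0)"
proof (cases "M \<in> basis_monos k")
  case True
  interpret ring "Bbar k" by (rule ring_Bbar)
  have c: "gen_elem k y \<in> carrier (Bbar k)"
    by (auto simp: Bbar_def gen_elem_def basis_monos_def)
  have e: "word_prod k [x, y] = gen_elem k x \<otimes>\<^bsub>Bbar k\<^esub> gen_elem k y" using c by (simp add: word_prod_def)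
  have "(\<Sum>A | A \<subseteq># M. (-1) ^ (k * inversions A (M - A)) * gen_elem k x A * gen_elem k y (M - A))
     = (\<Sum>A | A \<subseteq># M. if A = {#x#} then (if M = {#x, y#} then (-1) ^ (if y < x then k else 0) else 0) else (0::complex))"
  proof (rule sum.cong)
    fix A assume A: "A \<in> {A. A \<subseteq># M}"
    then obtain B where B: "M = A + B" by (metis mem_Collect_eq subset_mset.le_iff_add)
    have "x \<in> gens k" "y \<in> gens k" if "A = {#x#}" "B = {#y#}" using True B that by (auto simp: basis_monos_def)
    then show "(-1) ^ (k * inversions A (M - A)) * gen_elem k x A * gen_elem k y (M - A) = (if A = {#x#} then (if M = {#x, y#} then (-1) ^ (if y < x then k else 0) else 0) else (0::complex))"
      using B by (auto simp: gen_elem_def inversions_def)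
  qed simp
  also have "\<dots> = (if M = {#x, y#} then (-1) ^ (if y < x then k else 0) else 0)"
    by (auto simp: finite_submultisets)
  finally show ?thesis using True unfolding e by (simp add: Bbar_def)
qed (simp add: word_prod_def Bbar_def)

lemma gen_elem_commute: "gen_elem k y \<otimes>\<^bsub>Bbar k\<^esub> gen_elem k x = (\<lambda>M. (-1)^k * (gen_elem k x \<otimes>\<^bsub>Bbar k\<^esub> gen_elem k y) M)"
proof -
  interpret ring "Bbar k" by (rule ring_Bbar)
  have c: "gen_elem k y \<in> carrier (Bbar k)" for y
    by (auto simp: Bbar_def gen_elem_def basis_monos_def)
  have e: "word_prod k [x, y] = gen_elem k x \<otimes>\<^bsub>Bbar k\<^esub> gen_elem k y" for x y using c by (simp add: word_prod_def)
  show ?thesis unfolding e[symmetric]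
    by (auto simp: fun_eq_iff word_prod_pair basis_monos_def add_mset_commute split: if_splits simp flip: power_add)
qed


section \<open>Infinite linear combinations of products\<close>

text \<open>
  A coefficient family on words (not yet sorted products) for which \<open>\<Sum>w. G w \<phi>\<^sub>w\<close> converges in the
  completion.
\<close>

definition word_series :: "nat \<Rightarrow> (gen list \<Rightarrow> complex) set" where
  "word_series k = {G. (\<forall>w. G w \<noteq> 0 \<longrightarrow> set w \<subseteq> gens k) \<and>
                       (\<exists>s. \<forall>w. G w \<noteq> 0 \<longrightarrow> length w \<le> s) \<and>
                       (\<forall>N. finite {w. G w \<noteq> 0 \<and> (\<forall>x\<in>set w. snd x \<le> N)})}"

text \<open>
  The sum \<open>\<Sum>w. G w \<phi>\<^sub>w\<close>; \<open>\<phi>\<^sub>w\<close> is a multiple of the monomial of \<open>mset w\<close>, so each coefficient is a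
  finite sum.
\<close>

definition series_sum :: "nat \<Rightarrow> (gen list \<Rightarrow> complex) \<Rightarrow> gen multiset \<Rightarrow> complex" where
  "series_sum k G = (\<lambda>M. \<Sum>w | mset w = M. G w * word_prod k w M)"

definition single_word :: "gen list \<Rightarrow> gen list \<Rightarrow> complex" where
  "single_word w = (\<lambda>v. if v = w then 1 else 0)"


section \<open>The action of the affine Lie algebra\<close>

datatype chevalley = E0 | E1 | F0 | F1 | H0 | H1

text \<open>
  \<open>act_coeff k g x y\<close> is the coefficient of \<open>\<phi>\<^sub>y\<close> in \<open>g \<phi>\<^sub>x\<close>.  Since \<open>\<phi>\<^sub>a(z) = \<Sum>n. \<phi>\<^bsub>a,n\<^esub> z\<^bsup>-n\<^esup>\<close>,
  multiplication of the current by z raises the mode by one.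
\<close>

fun act_coeff :: "nat \<Rightarrow> chevalley \<Rightarrow> gen \<Rightarrow> gen \<Rightarrow> complex" where
  "act_coeff k E0 (a, n) y = (if a < k \<and> y = (a + 1, n + 1) then of_nat (a + 1) else 0)"
| "act_coeff k E1 (a, n) y = (if 0 < a \<and> a \<le> k \<and> y = (a - 1, n) then of_nat (k - a + 1) else 0)"
| "act_coeff k F0 (a, n) y = (if 0 < a \<and> a \<le> k \<and> y = (a - 1, n - 1) then of_nat (k - a + 1) else 0)"
| "act_coeff k F1 (a, n) y = (if a < k \<and> y = (a + 1, n) then of_nat (a + 1) else 0)"
| "act_coeff k H0 (a, n) y = (if a \<le> k \<and> y = (a, n) then - (of_nat k - 2 * of_nat a) else 0)"
| "act_coeff k H1 (a, n) y = (if a \<le> k \<and> y = (a, n) then of_nat k - 2 * of_nat a else 0)"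

text \<open>
  The derivation on coefficient families: the coefficient of w collects the words that produce w
  when g is applied to one of their letters.
\<close>

definition act_words ::
    "nat \<Rightarrow> chevalley \<Rightarrow> (gen list \<Rightarrow> complex) \<Rightarrow> gen list \<Rightarrow> complex" where
  "act_words k g G = (\<lambda>w. \<Sum>i<length w. \<Sum>x | act_coeff k g x (w ! i) \<noteq> 0.
                             act_coeff k g x (w ! i) * G (w[i := x]))"

text \<open>
  The derivation on the completion: an element is written as a combination of sorted words, g is
  applied to each of their letters in turn, and the result is summed up again.
\<close>

definition act :: "nat \<Rightarrow> chevalley \<Rightarrow> (gen multiset \<Rightarrow> complex) \<Rightarrow> gen multiset \<Rightarrow> complex" where
  "act k g F = series_sum k (act_words k g (\<lambda>w. if sorted w then F (mset w) else 0))"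


section \<open>The quadratic relations and the quotient\<close>

text \<open>
  \<open>\<phi>\<^sub>a\<^sup>(\<^sup>m\<^sup>)(z) = \<Sum>n. (-n)(-n-1)\<dots>(-n-m+1) \<phi>\<^bsub>a,n\<^esub> z\<^bsup>-n-m\<^esup>\<close>; thus \<open>fourier k d\<close> is the coefficient of
  \<open>z\<^bsup>-d-(k-2)\<^esup>\<close> in \<open>\<phi>\<^sub>0(z) \<phi>\<^sub>0\<^sup>(\<^sup>k\<^sup>-\<^sup>2\<^sup>)(z)\<close>.
\<close>

definition deriv_coeff :: "nat \<Rightarrow> int \<Rightarrow> complex" where
  "deriv_coeff m n = (\<Prod>i<m. of_int (- n - int i))"

definition fourier :: "nat \<Rightarrow> int \<Rightarrow> gen list \<Rightarrow> complex" where
  "fourier k d = (\<lambda>w. case w of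
      [(a, m), (b, n)] \<Rightarrow> if a = 0 \<and> b = 0 \<and> m + n = d then deriv_coeff (k - 2) n else 0
    | _ \<Rightarrow> 0)"

inductive_set Q2 :: "nat \<Rightarrow> (gen multiset \<Rightarrow> complex) set" for k :: nat where
  fourier: "series_sum k (fourier k d) \<in> Q2 k"
| add: "F \<in> Q2 k \<Longrightarrow> G \<in> Q2 k \<Longrightarrow> (\<lambda>M. F M + G M) \<in> Q2 k"
| scale: "F \<in> Q2 k \<Longrightarrow> (\<lambda>M. c * F M) \<in> Q2 k"
| act: "F \<in> Q2 k \<Longrightarrow> act k g F \<in> Q2 k"

text \<open>
  Closure in the topology of the inverse limit: F is approximated by elements of I modulo the
  monomials containing a mode \<open>> N\<close>, for every N.
\<close>

definition adic_closure ::
    "nat \<Rightarrow> (gen multiset \<Rightarrow> complex) set \<Rightarrow> (gen multiset \<Rightarrow> complex) set" where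
  "adic_closure k I = {F \<in> carrier (Bbar k).
     \<forall>N. \<exists>G\<in>I. \<forall>M. (\<forall>x\<in>#M. snd x \<le> N) \<longrightarrow> F M = G M}"

text \<open>
  Ideals of the completion are understood as closed ideals: already for \<open>k = 2\<close> the cube of
  \<open>\<phi>\<^bsub>0,0\<^esub>\<close> is congruent to a convergent sum of normal-ordered products modulo the closure of the
  algebraic ideal, but not modulo the algebraic ideal itself.
\<close>

definition rel_ideal :: "nat \<Rightarrow> (gen multiset \<Rightarrow> complex) set" where
  "rel_ideal k = adic_closure k (Idl\<^bsub>Bbar k\<^esub> (Q2 k))"

definition R_alg :: "nat \<Rightarrow> (gen multiset \<Rightarrow> complex) set ring" where
  "R_alg k = Bbar k Quot rel_ideal k"

definition R_class :: "nat \<Rightarrow> (gen multiset \<Rightarrow> complex) \<Rightarrow> (gen multiset \<Rightarrow> complex) set" where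
  "R_class k F = rel_ideal k +>\<^bsub>Bbar k\<^esub> F"


section \<open>Normal ordering\<close>

fun h_fun :: "nat \<Rightarrow> gen \<Rightarrow> gen \<Rightarrow> int" where
  "h_fun k (a, m) (b, n) = int (min a (k - b)) - m + n"

definition normal_pairs :: "nat \<Rightarrow> (gen \<times> gen) set" where
  "normal_pairs k = {(x, y). x \<in> gens k \<and> y \<in> gens k \<and> h_fun k x y \<ge> int k}"

definition normal_ordered :: "nat \<Rightarrow> gen list \<Rightarrow> bool" where
  "normal_ordered k w \<longleftrightarrow> set w \<subseteq> gens k \<and>
     (\<forall>i. i + 1 < length w \<longrightarrow> (w ! i, w ! (i + 1)) \<in> normal_pairs k)"

definition normal_series :: "nat \<Rightarrow> (gen list \<Rightarrow> complex) set" where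
  "normal_series k = {G \<in> word_series k. \<forall>w. G w \<noteq> 0 \<longrightarrow> normal_ordered k w}"

text \<open>
  A normal-ordering rule \<open>\<phi>\<^sub>x \<phi>\<^sub>y = \<Sum>p. C p \<phi>\<^sub>p\<close>, the sum running over normal-ordered pairs.
  (Skew-)commutativity enters through the multiplication of the completion.
\<close>

definition normal_rule :: "nat \<Rightarrow> gen \<Rightarrow> gen \<Rightarrow> (gen list \<Rightarrow> complex) \<Rightarrow> bool" where
  "normal_rule k x y C \<longleftrightarrow> x \<in> gens k \<and> y \<in> gens k \<and> (x, y) \<notin> normal_pairs k \<and>
     C \<in> normal_series k \<and> (\<forall>p. C p \<noteq> 0 \<longrightarrow> length p = 2) \<and>
     (\<lambda>M. word_prod k [x, y] M - series_sum k C M) \<in> Q2 k"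

text \<open>
  One application of a rule: the term of \<open>u @ [x, y] @ v\<close> is replaced by the combination of the
  words \<open>u @ p @ v\<close> given by the rule.  The sum over p has at most one term.
\<close>

definition rewrite_step ::
    "nat \<Rightarrow> (gen list \<Rightarrow> complex) \<Rightarrow> (gen list \<Rightarrow> complex) \<Rightarrow> bool" where
  "rewrite_step k G H \<longleftrightarrow> (\<exists>u v x y C. normal_rule k x y C \<and>
     H = (\<lambda>w. (if w = u @ [x, y] @ v then 0 else G w)
               + G (u @ [x, y] @ v) * (\<Sum>p | w = u @ p @ v. C p)))"

text \<open>
  As the rules have infinite right-hand sides, rewriting means the limit of a sequence of rule
  applications in the topology of the completion, where the coefficients of the words with modes
  \<open>\<le> N\<close> are eventually constant for each N.
\<close>

definition rewrites_to ::
    "nat \<Rightarrow> (gen list \<Rightarrow> complex) \<Rightarrow> (gen list \<Rightarrow> complex) \<Rightarrow> bool" where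
  "rewrites_to k G H \<longleftrightarrow> (\<exists>X. X 0 = G \<and>
     (\<forall>n. X (Suc n) = X n \<or> rewrite_step k (X n) (X (Suc n))) \<and>
     (\<forall>N. \<exists>n0. \<forall>n\<ge>n0. \<forall>w. (\<forall>x\<in>set w. snd x \<le> N) \<longrightarrow> X n w = H w))"

end

theory Submission
  imports
    Defs
    "HOL-Combinatorics.Permutations"
    "HOL-Computational_Algebra.Formal_Power_Series"
begin

text \<open>
  Give the generator \<open>\<phi>\<^bsub>a,n\<^esub>\<close> the position \<open>2n - a\<close>.  Among the pairs of fixed weight \<open>a + b\<close> and fixed
  degree \<open>m + n\<close>, the normal-ordered ones are exactly those whose first position is small.

  Spanning.  Acting with \<open>e\<^sub>0, e\<^sub>1, f\<^sub>1\<close> on the generating relations shows that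
  \<open>\<Sum> R(a,m) \<phi>\<^bsub>a,m\<^esub> \<phi>\<^bsub>s-a,d-m\<^esub>\<close> lies in \<open>Q\<^sub>k\<^sup>(\<^sup>2\<^sup>)\<close> for every polynomial R of total degree less than k.
  Such polynomials interpolate arbitrary values at the points (a, m) for which neither the pair nor
  its transpose is normal-ordered, so every such pair has a normal-ordering rule.  A rule only
  decreases the first position; always rewriting a word of maximal energy (a weighted sum of positions)
  therefore converges.

  Independence.  Let \<open>\<phi>\<^sub>a(z)\<close> be the sum, over the subsets S of \<open>{1..k}\<close> of size a, of the products of k
  independent fermions \<open>\<psi>\<^sup>i(z)\<close>, of index 1 for i in S and 0 otherwise.  The relations hold in this
  realization because \<open>\<phi>\<^sub>0(z) \<phi>\<^sub>0(w)\<close> vanishes to order k at \<open>z = w\<close>.  A tuple of k exterior monomials,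
  read as k increasing columns, determines a normal-ordered word through its row sums, every
  normal-ordered word arises in this way, and the tuple occurs in the image of no other word of the
  same or smaller energy.
\<close>

section \<open>Products of generators\<close>

text \<open>The threshold in \<open>h_fun\<close> comes from counting columns. For k = 1 the encoded
  positions of a normal-ordered word increase strictly, and such a step raises the mode by at least
  one unless it leads from index 1 to index 0. When k columns pass from index sum a to index sum b,
  at most min(a, k - b) of them make the exceptional step. Strict increase in all columns is
  therefore possible exactly when n - m \<ge> k - min(a, k - b).

  The obstacle is that the rules have infinite right-hand sides, so rewriting need not terminate and
  only limits are available. The energy deals with this on both sides. Words of fixed length and
  degree with modes \<le> N have energy bounded below, so pushing the disordered part to ever lower
  energy is convergence. Normal-ordered words of fixed length and total position have energy bounded
  above, so a series that vanishes in the quotient would have a leading word. The fermions are never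
  built as an algebra: a coefficient of the realization is a finite signed sum over tuples of
  permutations, and it sees only finitely many letters, hence is continuous.\<close>

lemma Bbar_mult: "(F \<otimes>\<^bsub>Bbar k\<^esub> G) M =
    (if M \<in> basis_monos k
     then \<Sum>A | A \<subseteq># M. (-1) ^ (k * inversions A (M - A)) * F A * G (M - A) else 0)"
  by (simp add: Bbar_def)

lemma Bbar_add: "(F \<oplus>\<^bsub>Bbar k\<^esub> G) = (\<lambda>M. F M + G M)"
  by (simp add: Bbar_def)

lemma Bbar_zero: "\<zero>\<^bsub>Bbar k\<^esub> = (\<lambda>M. 0)"
  by (simp add: Bbar_def)

lemma Bbar_one: "\<one>\<^bsub>Bbar k\<^esub> = (\<lambda>M. if M = {#} then 1 else 0)"
  by (simp add: Bbar_def)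

lemma Bbar_uminus: "F \<in> carrier (Bbar k) \<Longrightarrow> \<ominus>\<^bsub>Bbar k\<^esub> F = (\<lambda>M. - F M)"
proof -
  assume F: "F \<in> carrier (Bbar k)"
  interpret ring "Bbar k" by (rule ring_Bbar)
  have "(\<lambda>M. - F M) \<in> carrier (Bbar k)" using F by (simp add: Bbar_def)
  moreover have "(\<lambda>M. - F M) \<oplus>\<^bsub>Bbar k\<^esub> F = \<zero>\<^bsub>Bbar k\<^esub>" by (simp add: Bbar_def)
  ultimately show ?thesis using F minus_equality by blast
qed

lemma carrier_scale: "F \<in> carrier (Bbar k) \<Longrightarrow> (\<lambda>M. c * F M) \<in> carrier (Bbar k)"
  by (cases "c = 0") (simp_all add: Bbar_def)

lemma carrier_basis: "F \<in> carrier (Bbar k) \<Longrightarrow> F M \<noteq> 0 \<Longrightarrow> M \<in> basis_monos k"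
  by (simp add: Bbar_def)

lemma gen_elem_carrier: "gen_elem k x \<in> carrier (Bbar k)"
  by (auto simp: Bbar_def gen_elem_def basis_monos_def)

lemma word_prod_Nil: "word_prod k [] = \<one>\<^bsub>Bbar k\<^esub>"
  by (simp add: word_prod_def)

lemma word_prod_Cons: "word_prod k (x # w) = gen_elem k x \<otimes>\<^bsub>Bbar k\<^esub> word_prod k w"
  by (simp add: word_prod_def)

lemma word_prod_carrier: "word_prod k w \<in> carrier (Bbar k)"
proof (induction w)
  case Nil
  interpret ring "Bbar k" by (rule ring_Bbar)
  show ?case by (simp add: word_prod_Nil)
next
  case (Cons x w)
  then show ?case by (simp add: word_prod_Cons carrier_mult gen_elem_carrier)
qed

lemma word_prod_append: "word_prod k (u @ v) = word_prod k u \<otimes>\<^bsub>Bbar k\<^esub> word_prod k v"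
proof (induction u)
  case Nil
  interpret ring "Bbar k" by (rule ring_Bbar)
  show ?case by (simp add: word_prod_Nil word_prod_carrier)
next
  case (Cons x u)
  then show ?case by (simp add: word_prod_Cons mult_assoc_Bbar)
qed

lemma mult_single_left:
  assumes "\<And>A. F A \<noteq> 0 \<Longrightarrow> A = U"
  shows "(F \<otimes>\<^bsub>Bbar k\<^esub> G) M =
    (if U \<subseteq># M \<and> M \<in> basis_monos k
     then (-1) ^ (k * inversions U (M - U)) * F U * G (M - U) else 0)"
proof -
  have "(\<Sum>A | A \<subseteq># M. (-1) ^ (k * inversions A (M - A)) * F A * G (M - A))
      = (\<Sum>A | A \<subseteq># M. if A = U then (-1) ^ (k * inversions U (M - U)) * F U * G (M - U) else 0)"
    using assms by (intro sum.cong) auto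
  also have "\<dots> = (if U \<subseteq># M then (-1) ^ (k * inversions U (M - U)) * F U * G (M - U) else 0)"
    by (simp add: finite_submultisets)
  finally show ?thesis by (simp add: Bbar_mult)
qed

lemma mult_single_right:
  assumes "\<And>A. G A \<noteq> 0 \<Longrightarrow> A = U"
  shows "(F \<otimes>\<^bsub>Bbar k\<^esub> G) M =
    (if U \<subseteq># M \<and> M \<in> basis_monos k
     then (-1) ^ (k * inversions (M - U) U) * F (M - U) * G U else 0)"
proof -
  have "(\<Sum>A | A \<subseteq># M. (-1) ^ (k * inversions A (M - A)) * F A * G (M - A))
      = (\<Sum>A | A \<subseteq># M. if A = M - U then
           (if U \<subseteq># M then (-1) ^ (k * inversions (M - U) U) * F (M - U) * G U else 0) else 0)"
  proof (intro sum.cong refl)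
    fix A assume A: "A \<in> {A. A \<subseteq># M}"
    then obtain B where "M = A + B" by (metis mem_Collect_eq subset_mset.le_iff_add)
    then show "(-1) ^ (k * inversions A (M - A)) * F A * G (M - A) =
      (if A = M - U then
           (if U \<subseteq># M then (-1) ^ (k * inversions (M - U) U) * F (M - U) * G U else 0) else 0)"
      using assms[of B]
      by (auto simp: subset_mset.le_iff_add)
  qed
  also have "\<dots> = (if U \<subseteq># M then (-1) ^ (k * inversions (M - U) U) * F (M - U) * G U else 0)"
    by (simp add: finite_submultisets)
  finally show ?thesis by (simp add: Bbar_mult)
qed

lemma word_prod_supp: "word_prod k w M \<noteq> 0 \<Longrightarrow> M = mset w"
proof (induction w arbitrary: M)
  case Nil
  then show ?case by (simp add: word_prod_Nil Bbar_one split: if_splits)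
next
  case (Cons x w)
  have "word_prod k (x # w) M = (if {#x#} \<subseteq># M \<and> M \<in> basis_monos k
     then (-1) ^ (k * inversions {#x#} (M - {#x#})) * gen_elem k x {#x#} * word_prod k w (M - {#x#}) else 0)"
    unfolding word_prod_Cons
    by (rule mult_single_left) (simp add: gen_elem_def split: if_splits)
  then have "x \<in># M" "M - {#x#} = mset w" using Cons.IH Cons.prems by (auto split: if_splits)
  then show ?case by (metis insert_DiffM mset.simps(2))
qed

lemma word_prod_sorted:
  assumes "sorted w" "mset w \<in> basis_monos k"
  shows "word_prod k w (mset w) = 1"
  using assms
proof (induction w)
  case Nil
  then show ?case by (simp add: word_prod_Nil Bbar_one)
next
  case (Cons x w)
  have x: "x \<in> gens k" using Cons.prems by (simp add: basis_monos_def)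
  have w: "mset w \<in> basis_monos k" using Cons.prems(2) by (rule basis_monos_mono) simp
  have "filter (\<lambda>y. y < x) w = []"
    using Cons.prems(1) by (auto simp: filter_empty_conv)
  then have "filter_mset (\<lambda>y. y < x) (mset w) = {#}"
    by (metis mset.simps(1) mset_filter)
  then have "inversions {#x#} (mset w) = 0" by (simp add: inversions_def)
  moreover have "word_prod k (x # w) (mset (x # w)) =
     (if {#x#} \<subseteq># mset (x # w) \<and> mset (x # w) \<in> basis_monos k
      then (-1) ^ (k * inversions {#x#} (mset (x # w) - {#x#})) * gen_elem k x {#x#}
        * word_prod k w (mset (x # w) - {#x#}) else 0)"
    unfolding word_prod_Cons
    by (rule mult_single_left) (simp add: gen_elem_def split: if_splits)
  moreover have "word_prod k w (mset w) = 1" using Cons w by simp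
  ultimately show ?case
    using Cons.prems(2) x by (simp add: gen_elem_def)
qed

subsection \<open>Skew functions on words\<close>

text \<open>The condition dual to (skew-)commutativity: such a function is determined by its values
  on sorted words. Signs are found by comparing skew functions with one another,
  \<open>word_prod\<close> being one of them, instead of counting inversions of general
  permutations.\<close>

definition skew :: "nat \<Rightarrow> (gen list \<Rightarrow> complex) \<Rightarrow> bool" where
  "skew k f \<longleftrightarrow> (\<forall>u x y v. f (u @ x # y # v) = (-1) ^ k * f (u @ y # x # v))"

lemma skewD: "skew k f \<Longrightarrow> f (u @ x # y # v) = (-1) ^ k * f (u @ y # x # v)"
  unfolding skew_def by blast

lemma skew_embed: "skew k f \<Longrightarrow> skew k (\<lambda>w. f (u @ w @ v))"
  unfolding skew_def by (metis append.assoc append_Cons)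

lemma skew_word_prod: "skew k (\<lambda>w. word_prod k w M)"
proof -
  have "word_prod k (u @ x # y # v) M = (-1) ^ k * word_prod k (u @ y # x # v) M" for u x y v
  proof -
    have e: "word_prod k (u @ x # y # v)
        = word_prod k u \<otimes>\<^bsub>Bbar k\<^esub> ((gen_elem k x \<otimes>\<^bsub>Bbar k\<^esub> gen_elem k y) \<otimes>\<^bsub>Bbar k\<^esub> word_prod k v)" for x y
      by (simp add: word_prod_append word_prod_Cons mult_assoc_Bbar)
    show ?thesis
      unfolding e gen_elem_commute[of k x y]
      by (auto simp: Bbar_mult sum_distrib_left intro!: sum.cong)
  qed
  then show ?thesis unfolding skew_def by blast
qed

lemma skew_move: "skew k f \<Longrightarrow> f (t @ u @ x # v) = (-1) ^ (k * length u) * f (t @ x # u @ v)"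
proof (induction u arbitrary: t)
  case (Cons a u)
  have "f (t @ (a # u) @ x # v) = (-1) ^ (k * length u) * f (t @ a # x # u @ v)"
    using Cons.IH[of "t @ [a]"] Cons.prems by simp
  also have "\<dots> = (-1) ^ (k * length u) * ((-1) ^ k * f (t @ x # a # u @ v))"
    using skewD[OF Cons.prems, of t a x "u @ v"] by simp
  finally show ?case by (simp add: power_add)
qed simp

text \<open>The factor is chosen before f and t: a rearrangement carries one sign for all skew
  functions, so it can be read off from any of them that does not vanish. The prefix t takes up the
  letters already placed during the induction.\<close>

lemma skew_perm:
  assumes "mset w = mset w'"
  obtains c where "\<And>f t. skew k f \<Longrightarrow> f (t @ w) = c * f (t @ w')"
proof -
  have "\<exists>c. \<forall>f t. skew k f \<longrightarrow> f (t @ w) = c * f (t @ w')" using assms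
  proof (induction w' arbitrary: w)
    case (Cons x w')
    then have "x \<in> set w" by (metis list.set_intros(1) set_mset_mset)
    then obtain u v where w: "w = u @ x # v" by (meson split_list)
    then have "mset (u @ v) = mset w'" using Cons.prems by simp
    then obtain c where c: "\<forall>f t. skew k f \<longrightarrow> f (t @ (u @ v)) = c * f (t @ w')"
      using Cons.IH by blast
    have "f (t @ w) = ((-1) ^ (k * length u) * c) * f (t @ x # w')" if "skew k f" for f t
      using skew_move[OF that, of t u x v] c[rule_format, OF that, of "t @ [x]"] w by simp
    then show ?case by blast
  qed (auto intro: exI[of _ 1])
  then show ?thesis using that by blast
qed

text \<open>For odd k two equal letters can be brought together, and exchanging them gives f =
  -f.\<close>

lemma skew_repeated:
  assumes f: "skew k f" and w: "set w \<subseteq> gens k" "mset w \<notin> basis_monos k"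
  shows "f w = 0"
proof -
  obtain x where k: "odd k" and x: "\<not> count (mset w) x \<le> 1"
    using w by (auto simp: basis_monos_def)
  have "{#x, x#} \<subseteq># mset w"
    using x count_le_replicate_mset_subset_eq[of 2 "mset w" x] by (simp add: numeral_2_eq_2)
  then obtain N where "mset w = {#x, x#} + N" by (metis subset_mset.le_iff_add)
  moreover obtain v where "mset v = N" using ex_mset by blast
  ultimately have "mset w = mset (x # x # v)" by simp
  then obtain c where "\<And>f t. skew k f \<Longrightarrow> f (t @ w) = c * f (t @ x # x # v)"
    using skew_perm[of w "x # x # v"] by metis
  then have "f ([] @ w) = c * f ([] @ x # x # v)" using f by blast
  moreover have "f ([] @ x # x # v) = 0" using skewD[OF f, of "[]" x x v] k by simp
  ultimately show ?thesis by simp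
qed

text \<open>The common factor of \<open>skew_perm\<close> is identified by evaluating the skew
  function \<open>word_prod\<close>, whose value at the sorted word is 1. If the word is zero in the
  algebra, both sides vanish.\<close>

lemma skew_sorted:
  assumes f: "skew k f" and w: "set w \<subseteq> gens k"
  shows "f w = word_prod k w (mset w) * f (sorted_list_of_multiset (mset w))"
proof (cases "mset w \<in> basis_monos k")
  case True
  have "mset w = mset (sorted_list_of_multiset (mset w))" by simp
  then obtain c where c: "\<And>f t. skew k f \<Longrightarrow> f (t @ w) = c * f (t @ sorted_list_of_multiset (mset w))"
    using skew_perm by metis
  have "word_prod k ([] @ w) (mset w) = c * word_prod k ([] @ sorted_list_of_multiset (mset w)) (mset w)"
    by (rule c[OF skew_word_prod])
  then have "word_prod k w (mset w) = c"
    using word_prod_sorted[of "sorted_list_of_multiset (mset w)" k] True by simp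
  then show ?thesis using c[OF f, of "[]"] by simp
next
  case False
  then have "word_prod k w (mset w) = 0" using carrier_basis[OF word_prod_carrier] by blast
  then show ?thesis using skew_repeated[OF f w False] by simp
qed

text \<open>Identifies the sign in the product of \<open>Bbar\<close> with the sign rule of skew
  functions; concatenation of words thereby becomes dual to multiplication in
  \<open>fpair_mult\<close>.\<close>

lemma skew_merge:
  assumes f: "skew k f" and AB: "A + B \<in> basis_monos k"
  shows "f (sorted_list_of_multiset A @ sorted_list_of_multiset B)
       = (-1) ^ (k * inversions A B) * f (sorted_list_of_multiset (A + B))"
proof -
  let ?sl = "sorted_list_of_multiset :: gen multiset \<Rightarrow> gen list"
  have A: "A \<in> basis_monos k" "B \<in> basis_monos k"
    using AB by (auto elim: basis_monos_mono)
  have "set (?sl A @ ?sl B) \<subseteq> gens k" using AB by (simp add: basis_monos_def)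
  then have "f (?sl A @ ?sl B) = word_prod k (?sl A @ ?sl B) (A + B) * f (?sl (A + B))"
    using skew_sorted[OF f, of "?sl A @ ?sl B"] by simp
  moreover have "word_prod k (?sl A @ ?sl B) (A + B) = (-1) ^ (k * inversions A B)"
  proof -
    have "(word_prod k (?sl A) \<otimes>\<^bsub>Bbar k\<^esub> word_prod k (?sl B)) (A + B) =
      (if A \<subseteq># A + B \<and> A + B \<in> basis_monos k
       then (-1) ^ (k * inversions A (A + B - A)) * word_prod k (?sl A) A * word_prod k (?sl B) (A + B - A)
       else 0)"
      by (rule mult_single_left) (drule word_prod_supp, simp)
    then show ?thesis
      using word_prod_sorted[of "?sl A" k] word_prod_sorted[of "?sl B" k] A AB
      by (simp add: word_prod_append)
  qed
  ultimately show ?thesis by simp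
qed

section \<open>Convergent series of words\<close>

lemma finite_mset_eq: "finite {w. mset w = M}"
  by (rule finite_subset[OF _ finite_lists_length_eq[of "set_mset M" "size M"]]) auto

lemma series_sum_nz:
  assumes "series_sum k G M \<noteq> 0"
  obtains w where "mset w = M" "G w \<noteq> 0" "M \<in> basis_monos k"
proof -
  obtain w where "mset w = M" "G w * word_prod k w M \<noteq> 0"
    using assms unfolding series_sum_def by (metis (mono_tags, lifting) mem_Collect_eq sum.not_neutral_contains_not_neutral)
  then show ?thesis using that carrier_basis[OF word_prod_carrier] by auto
qed

lemma series_sum_carrier:
  assumes "G \<in> word_series k"
  shows "series_sum k G \<in> carrier (Bbar k)"
proof -
  have "\<exists>s. \<forall>M. series_sum k G M \<noteq> 0 \<longrightarrow> size M \<le> s"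
  proof -
    obtain s where "\<forall>w. G w \<noteq> 0 \<longrightarrow> length w \<le> s" using assms by (auto simp: word_series_def)
    then have "\<forall>M. series_sum k G M \<noteq> 0 \<longrightarrow> size M \<le> s" by (metis series_sum_nz size_mset)
    then show ?thesis ..
  qed
  moreover have "finite {M. series_sum k G M \<noteq> 0 \<and> (\<forall>x\<in>#M. snd x \<le> N)}" for N
  proof (rule finite_subset)
    show "{M. series_sum k G M \<noteq> 0 \<and> (\<forall>x\<in>#M. snd x \<le> N)}
        \<subseteq> mset ` {w. G w \<noteq> 0 \<and> (\<forall>x\<in>set w. snd x \<le> N)}"
      by (auto elim!: series_sum_nz)
    show "finite (mset ` {w. G w \<noteq> 0 \<and> (\<forall>x\<in>set w. snd x \<le> N)})"
      using assms by (simp add: word_series_def)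
  qed
  moreover have "M \<in> basis_monos k" if "series_sum k G M \<noteq> 0" for M
    using that by (rule series_sum_nz)
  ultimately show ?thesis unfolding Bbar_def by simp
qed

lemma series_sum_single: "series_sum k (single_word w) = word_prod k w"
proof
  fix M
  have "series_sum k (single_word w) M = (\<Sum>v | mset v = M. if v = w then word_prod k w M else 0)"
    unfolding series_sum_def single_word_def by (intro sum.cong) auto
  also have "\<dots> = word_prod k w M" using word_prod_supp[of k w M] by (auto simp: finite_mset_eq)
  finally show "series_sum k (single_word w) M = word_prod k w M" .
qed

lemma series_sum_add: "series_sum k (\<lambda>w. G w + H w) M = series_sum k G M + series_sum k H M"
  by (simp add: series_sum_def sum.distrib distrib_right)

lemma series_sum_scale: "series_sum k (\<lambda>w. c * G w) M = c * series_sum k G M"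
  by (simp add: series_sum_def sum_distrib_left mult.assoc)

lemma series_sum_embed:
  "series_sum k (\<lambda>w. \<Sum>p | w = u @ p @ v. C p) =
     word_prod k u \<otimes>\<^bsub>Bbar k\<^esub> series_sum k C \<otimes>\<^bsub>Bbar k\<^esub> word_prod k v"
proof
  fix M
  define r where "r = (\<lambda>F. (word_prod k u \<otimes>\<^bsub>Bbar k\<^esub> F \<otimes>\<^bsub>Bbar k\<^esub> word_prod k v) M)"
  define L where "L = M - mset v - mset u"
  have r1: "r F = (if mset v \<subseteq># M \<and> M \<in> basis_monos k
      then (-1) ^ (k * inversions (M - mset v) (mset v))
        * (word_prod k u \<otimes>\<^bsub>Bbar k\<^esub> F) (M - mset v) * word_prod k v (mset v) else 0)" for F
    unfolding r_def by (rule mult_single_right[of "word_prod k v" "mset v"]) (erule word_prod_supp)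
  have r2: "(word_prod k u \<otimes>\<^bsub>Bbar k\<^esub> F) (M - mset v) =
      (if mset u \<subseteq># M - mset v \<and> M - mset v \<in> basis_monos k
       then (-1) ^ (k * inversions (mset u) L) * word_prod k u (mset u) * F L else 0)" for F
    unfolding L_def by (rule mult_single_left[of "word_prod k u" "mset u"]) (erule word_prod_supp)
  \<comment> \<open>Both outer factors are multiples of single monomials, so for fixed M the product
    depends on F only through its coefficient at L. The scalar c does not depend on F, and the
    series can be compared with its words one at a time.\<close>
  have "\<exists>c. \<forall>F. r F = (if mset u + mset v \<subseteq># M then c * F L else 0)"
  proof (cases "mset u + mset v \<subseteq># M")
    case True
    then have "mset v \<subseteq># M" "mset u \<subseteq># M - mset v"
      by (auto simp: subset_mset.le_iff_add)
    then have "r F = (if M \<in> basis_monos k \<and> M - mset v \<in> basis_monos k then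
        (-1) ^ (k * inversions (M - mset v) (mset v)) * (-1) ^ (k * inversions (mset u) L)
        * word_prod k u (mset u) * word_prod k v (mset v) else 0) * F L" for F
      by (simp add: r1 r2)
    then have "\<exists>c. \<forall>F. r F = c * F L" by blast
    then show ?thesis using True by simp
  next
    case False
    then have "\<not> (mset v \<subseteq># M \<and> mset u \<subseteq># M - mset v)"
      by (auto simp: subset_mset.le_iff_add ac_simps)
    then have "r F = 0" for F by (auto simp: r1 r2)
    then show ?thesis using False by simp
  qed
  then obtain c where c: "r F = (if mset u + mset v \<subseteq># M then c * F L else 0)" for F by blast
  have rw: "r (word_prod k p) = word_prod k (u @ p @ v) M" for p
    by (simp add: r_def word_prod_append mult_assoc_Bbar)
  have "series_sum k (\<lambda>w. \<Sum>p | w = u @ p @ v. C p) M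
      = (\<Sum>w | mset w = M. (\<Sum>p | w = u @ p @ v. C p * r (word_prod k p)))"
    unfolding series_sum_def by (auto simp: sum_distrib_right rw intro!: sum.cong)
  also have "\<dots> = (\<Sum>(w, p)\<in>(SIGMA w:{w. mset w = M}. {p. w = u @ p @ v}). C p * r (word_prod k p))"
  proof (rule sum.Sigma)
    show "\<forall>w\<in>{w. mset w = M}. finite {p. w = u @ p @ v}"
    proof
      fix w
      have "{p. w = u @ p @ v} \<subseteq> {take (length w - length u - length v) (drop (length u) w)}" by auto
      then show "finite {p. w = u @ p @ v}" by (meson finite.simps finite_subset)
    qed
  qed (rule finite_mset_eq)
  also have "\<dots> = (\<Sum>p | mset (u @ p @ v) = M. C p * r (word_prod k p))"
    by (rule sum.reindex_bij_witness[of _ "\<lambda>p. (u @ p @ v, p)" snd]) auto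
  also have "\<dots> = r (series_sum k C)"
  proof (cases "mset u + mset v \<subseteq># M")
    case True
    have "{p. mset (u @ p @ v) = M} = {p. mset p = L}"
    proof -
      obtain Z where "M = mset u + mset v + Z" using True by (metis subset_mset.le_iff_add)
      then show ?thesis by (auto simp: L_def ac_simps)
    qed
    then show ?thesis using True by (simp add: c series_sum_def sum_distrib_left ac_simps)
  next
    case False
    then show ?thesis by (simp add: c)
  qed
  finally show "series_sum k (\<lambda>w. \<Sum>p | w = u @ p @ v. C p) M
      = (word_prod k u \<otimes>\<^bsub>Bbar k\<^esub> series_sum k C \<otimes>\<^bsub>Bbar k\<^esub> word_prod k v) M"
    by (simp add: r_def)
qed

section \<open>Quadratic elements and the action\<close>

definition ser2 :: "nat \<Rightarrow> (gen \<Rightarrow> gen \<Rightarrow> complex) \<Rightarrow> gen multiset \<Rightarrow> complex" where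
  "ser2 k G = series_sum k (\<lambda>w. case w of [x, y] \<Rightarrow> G x y | _ \<Rightarrow> 0)"

definition quad :: "nat \<Rightarrow> (gen multiset \<Rightarrow> complex) \<Rightarrow> bool" where
  "quad k F \<longleftrightarrow> (\<forall>M. F M \<noteq> 0 \<longrightarrow> M \<in> basis_monos k \<and> size M = 2)"

text \<open>The elements of \<open>Q2\<close> are infinite sums, but of bounded total degree. An
  upper bound on the modes then gives a lower bound too, which is why they lie in the
  completion.\<close>

definition bounded_degree :: "(gen multiset \<Rightarrow> complex) \<Rightarrow> int \<Rightarrow> bool" where
  "bounded_degree F d \<longleftrightarrow> (\<forall>x y. F {#x, y#} \<noteq> 0 \<longrightarrow> \<bar>snd x + snd y\<bar> \<le> d)"

text \<open>The (skew-)symmetric coefficient matrix of a quadratic element: the coefficient family G of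
  \<open>ser2 k G\<close> enters it as \<open>G x y + (-1)\<^sup>k G y x\<close>, which explains the factor 2 on the diagonal.\<close>

definition sym_coeff :: "nat \<Rightarrow> (gen multiset \<Rightarrow> complex) \<Rightarrow> gen \<Rightarrow> gen \<Rightarrow> complex" where
  "sym_coeff k F x y =
     (if x < y then 1 else if x = y then (if even k then 2 else 0) else (-1) ^ k) * F {#x, y#}"

lemma size_2_mset: "size M = 2 \<longleftrightarrow> (\<exists>x y. M = {#x, y#})"
proof
  assume "size M = 2"
  then obtain x N where "M = add_mset x N" "size N = 1"
    by (metis One_nat_def Suc_1 diff_Suc_1 size_Suc_Diff1 size_eq_Suc_imp_elem insert_DiffM)
  then show "\<exists>x y. M = {#x, y#}" by (metis size_1_singleton_mset)
qed auto

lemma pair_basis: "{#x, y#} \<in> basis_monos k \<longleftrightarrow> x \<in> gens k \<and> y \<in> gens k \<and> (x = y \<longrightarrow> even k)"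
proof -
  have "(\<forall>z. count {#x, y#} z \<le> 1) \<longleftrightarrow> x \<noteq> y"
  proof
    assume "\<forall>z. count {#x, y#} z \<le> 1"
    from this[rule_format, of y] show "x \<noteq> y" by auto
  qed auto
  then show ?thesis unfolding basis_monos_def by auto
qed

lemma quad_nz:
  assumes "quad k F" "F M \<noteq> 0"
  obtains x y where "M = {#x, y#}" "x \<in> gens k" "y \<in> gens k" "x = y \<longrightarrow> even k"
proof -
  have "M \<in> basis_monos k" "size M = 2" using assms by (auto simp: quad_def)
  moreover obtain x y where "M = {#x, y#}" using calculation(2) size_2_mset by metis
  ultimately show ?thesis using that[of x y] by (simp add: pair_basis)
qed

lemma sym_coeff_eq_0: "quad k F \<Longrightarrow> sym_coeff k F x y = 0 \<longleftrightarrow> F {#x, y#} = 0"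
  using pair_basis[of x y k] by (auto simp: sym_coeff_def quad_def simp del: split_paired_All split: if_splits)

lemma quad_eqI:
  assumes "quad k F" "quad k F'" "\<And>x y. sym_coeff k F x y = sym_coeff k F' x y"
  shows "F = F'"
proof
  fix M
  show "F M = F' M"
  proof (cases "size M = 2")
    case True
    then obtain x y where "M = {#x, y#}" using size_2_mset by metis
    then show ?thesis
      using assms(3)[of x y] sym_coeff_eq_0[OF assms(1), of x y] sym_coeff_eq_0[OF assms(2), of x y]
      by (auto simp: sym_coeff_def split: if_splits)
  next
    case False
    then have "F M = 0" "F' M = 0" using assms(1,2) by (auto simp: quad_def)
    then show ?thesis by simp
  qed
qed

lemma quad_ser2: "quad k (ser2 k G)"
proof -
  have "M \<in> basis_monos k \<and> size M = 2" if "ser2 k G M \<noteq> 0" for M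
    using that unfolding ser2_def by (rule series_sum_nz) (auto split: list.splits)
  then show ?thesis by (simp add: quad_def)
qed

lemma mset_eq_pair: "mset w = {#x, y#} \<longleftrightarrow> w = [x, y] \<or> w = [y, x]"
proof
  assume w: "mset w = {#x, y#}"
  then have "length w = 2" by (metis size_mset size_2_mset)
  then obtain a b where "w = [a, b]" by (auto simp: numeral_2_eq_2 length_Suc_conv)
  then show "w = [x, y] \<or> w = [y, x]" using w by (auto simp: add_eq_conv_ex)
qed (auto simp: add_mset_commute)

lemma sym_coeff_ser2:
  "sym_coeff k (ser2 k G) x y = (if x \<in> gens k \<and> y \<in> gens k then G x y + (-1) ^ k * G y x else 0)"
proof -
  have e: "{w. mset w = {#x, y#}} = {[x, y], [y, x]}" by (auto simp: mset_eq_pair)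
  have "ser2 k G {#x, y#} = (if x = y then G x x * word_prod k [x, x] {#x, x#}
      else G x y * word_prod k [x, y] {#x, y#} + G y x * word_prod k [y, x] {#x, y#})"
    by (simp add: ser2_def series_sum_def e)
  then show ?thesis
    by (auto simp: sym_coeff_def word_prod_pair pair_basis add_mset_commute algebra_simps simp flip: power_add)
qed

lemma ser2_eqI:
  assumes "\<And>x y. x \<in> gens k \<Longrightarrow> y \<in> gens k \<Longrightarrow> G x y + (-1) ^ k * G y x = H x y + (-1) ^ k * H y x"
  shows "ser2 k G = ser2 k H"
  by (rule quad_eqI[OF quad_ser2 quad_ser2]) (use assms in \<open>simp add: sym_coeff_ser2\<close>)

lemma ser2_add: "ser2 k (\<lambda>x y. G x y + H x y) = (\<lambda>M. ser2 k G M + ser2 k H M)"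
  unfolding ser2_def fun_eq_iff series_sum_add[symmetric]
  by (auto simp: series_sum_def intro!: sum.cong split: list.splits)

lemma ser2_scale: "ser2 k (\<lambda>x y. c * G x y) = (\<lambda>M. c * ser2 k G M)"
  unfolding ser2_def fun_eq_iff series_sum_scale[symmetric]
  by (auto simp: series_sum_def intro!: sum.cong split: list.splits)

lemma word_prod_ser2: "word_prod k [x, y] = ser2 k (\<lambda>a b. if a = x \<and> b = y then 1 else 0)"
proof -
  have "single_word [x, y] = (\<lambda>w. case w of [a, b] \<Rightarrow> (if a = x \<and> b = y then 1 else 0) | _ \<Rightarrow> 0)"
    by (auto simp: single_word_def fun_eq_iff split: list.splits)
  then show ?thesis unfolding series_sum_single[symmetric] ser2_def by simp
qed

text \<open>Each generator y occurs in the image of at most one generator \<open>act_pred g y\<close>.\<close>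

fun pred_coeff :: "nat \<Rightarrow> chevalley \<Rightarrow> gen \<Rightarrow> complex" where
  "pred_coeff k E0 (a, n) = (if a \<le> k then of_nat a else 0)"
| "pred_coeff k F1 (a, n) = (if a \<le> k then of_nat a else 0)"
| "pred_coeff k E1 (a, n) = of_nat (k - a)"
| "pred_coeff k F0 (a, n) = of_nat (k - a)"
| "pred_coeff k H0 (a, n) = (if a \<le> k then - (of_nat k - 2 * of_nat a) else 0)"
| "pred_coeff k H1 (a, n) = (if a \<le> k then of_nat k - 2 * of_nat a else 0)"

text \<open>The truncated \<open>a - 1\<close> at a = 0 does no harm, because
  \<open>pred_coeff\<close> is 0 there; in the same way \<open>k - a\<close> cuts off the
  predecessors with index above k.\<close>

fun act_pred :: "chevalley \<Rightarrow> gen \<Rightarrow> gen" where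
  "act_pred E0 (a, n) = (a - 1, n - 1)"
| "act_pred F1 (a, n) = (a - 1, n)"
| "act_pred E1 (a, n) = (a + 1, n)"
| "act_pred F0 (a, n) = (a + 1, n + 1)"
| "act_pred H0 (a, n) = (a, n)"
| "act_pred H1 (a, n) = (a, n)"

lemma act_coeff_pred: "act_coeff k g x y = (if x = act_pred g y then pred_coeff k g y else 0)"
  by (cases g; cases x; cases y) (auto simp: Suc_diff_Suc of_nat_diff)

lemma act_words_pred:
  "act_words k g G w = (\<Sum>i<length w. pred_coeff k g (w ! i) * G (w[i := act_pred g (w ! i)]))"
proof -
  have "(\<Sum>x | act_coeff k g x y \<noteq> 0. act_coeff k g x y * H x) = pred_coeff k g y * H (act_pred g y)"
    for y and H :: "gen \<Rightarrow> complex"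
  proof -
    have "{x. act_coeff k g x y \<noteq> 0} = (if pred_coeff k g y = 0 then {} else {act_pred g y})"
      by (auto simp: act_coeff_pred)
    then show ?thesis by (simp add: act_coeff_pred)
  qed
  then show ?thesis by (simp add: act_words_def)
qed

definition act2 :: "nat \<Rightarrow> chevalley \<Rightarrow> (gen \<Rightarrow> gen \<Rightarrow> complex) \<Rightarrow> gen \<Rightarrow> gen \<Rightarrow> complex" where
  "act2 k g G x y = pred_coeff k g x * G (act_pred g x) y + pred_coeff k g y * G x (act_pred g y)"

lemma act_quad:
  assumes F: "quad k F"
  shows "act k g F = ser2 k (act2 k g (\<lambda>x y. if x \<le> y then F {#x, y#} else 0))"
proof -
  have "act_words k g (\<lambda>w. if sorted w then F (mset w) else 0)
      = (\<lambda>w. case w of [x, y] \<Rightarrow> act2 k g (\<lambda>x y. if x \<le> y then F {#x, y#} else 0) x y | _ \<Rightarrow> 0)"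
  proof
    fix w
    show "act_words k g (\<lambda>w. if sorted w then F (mset w) else 0) w
      = (case w of [x, y] \<Rightarrow> act2 k g (\<lambda>x y. if x \<le> y then F {#x, y#} else 0) x y | _ \<Rightarrow> 0)"
    proof (cases "length w = 2")
      case True
      then obtain x y where "w = [x, y]" by (auto simp: numeral_2_eq_2 length_Suc_conv)
      then show ?thesis by (simp add: act_words_pred act2_def numeral_2_eq_2 lessThan_Suc add.commute)
    next
      case False
      then have "F (mset (w[i := x])) = 0" for i x
        using F by (metis quad_def length_list_update size_mset)
      then have "act_words k g (\<lambda>w. if sorted w then F (mset w) else 0) w = 0"
        unfolding act_words_pred by (intro sum.neutral) (auto simp del: split_paired_All)
      then show ?thesis using False by (auto split: list.splits)
    qed
  qed
  then show ?thesis by (simp add: act_def ser2_def)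
qed

lemma sym_coeff_sorted:
  assumes F: "quad k F"
  shows "sym_coeff k F x y =
    (if x \<le> y then F {#x, y#} else 0) + (-1) ^ k * (if y \<le> x then F {#y, x#} else 0)"
  using sym_coeff_eq_0[OF F, of x x]
  by (auto simp: sym_coeff_def add_mset_commute)

lemma pred_coeff_gens: "x \<notin> gens k \<Longrightarrow> pred_coeff k g x = 0"
  by (cases g; cases x) (auto simp: gens_def)

lemma sym_coeff_gens: "quad k F \<Longrightarrow> x \<notin> gens k \<or> y \<notin> gens k \<Longrightarrow> sym_coeff k F x y = 0"
  by (auto simp: sym_coeff_def quad_def basis_monos_def)

text \<open>\<open>act\<close> passes through sorted words, and applying g to a letter destroys the
  sorting. The symmetrised matrix does not see this, since \<open>act2\<close> commutes with
  exchanging the two letters.\<close>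

lemma sym_coeff_act:
  assumes F: "quad k F"
  shows "sym_coeff k (act k g F) x y = act2 k g (sym_coeff k F) x y"
proof (cases "x \<in> gens k \<and> y \<in> gens k")
  case True
  then show ?thesis
    unfolding act_quad[OF F] sym_coeff_ser2 act2_def sym_coeff_sorted[OF F]
    by (simp add: algebra_simps)
next
  case False
  then show ?thesis
    using sym_coeff_gens[OF F, of x "act_pred g y"] sym_coeff_gens[OF F, of "act_pred g x" y]
      pred_coeff_gens[of x k g] pred_coeff_gens[of y k g]
    unfolding act_quad[OF F] sym_coeff_ser2 act2_def by auto
qed

lemma quad_act: "quad k F \<Longrightarrow> quad k (act k g F)"
  by (simp add: act_quad quad_ser2)

lemma act_ser2: "act k g (ser2 k G) = ser2 k (act2 k g G)"
  if G: "\<And>x y. x \<notin> gens k \<or> y \<notin> gens k \<Longrightarrow> G x y = 0"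
proof (rule quad_eqI[OF quad_act[OF quad_ser2] quad_ser2])
  fix x y
  have G': "sym_coeff k (ser2 k G) = (\<lambda>x y. G x y + (-1) ^ k * G y x)"
  proof (intro ext)
    fix x y
    show "sym_coeff k (ser2 k G) x y = G x y + (-1) ^ k * G y x"
      using G[of x y] G[of y x] by (auto simp: sym_coeff_ser2)
  qed
  have l: "act2 k g (\<lambda>x y. G x y + (-1) ^ k * G y x) x y = act2 k g G x y + (-1) ^ k * act2 k g G y x"
    by (simp add: act2_def algebra_simps)
  have z: "act2 k g G x y = 0" if "x \<notin> gens k \<or> y \<notin> gens k" for x y
    using that G[of "act_pred g x" y] G[of x "act_pred g y"] pred_coeff_gens[of x k g] pred_coeff_gens[of y k g]
    by (auto simp: act2_def)
  show "sym_coeff k (act k g (ser2 k G)) x y = sym_coeff k (ser2 k (act2 k g G)) x y"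
    unfolding sym_coeff_act[OF quad_ser2] G' sym_coeff_ser2 l using z[of x y] z[of y x] by auto
qed

lemma quad_carrier:
  assumes F: "quad k F" and d: "bounded_degree F d"
  shows "F \<in> carrier (Bbar k)"
proof -
  have "finite {M. F M \<noteq> 0 \<and> (\<forall>x\<in>#M. snd x \<le> N)}" for N
  proof (rule finite_subset)
    let ?X = "{0..k} \<times> {- d - N..N}"
    show "{M. F M \<noteq> 0 \<and> (\<forall>x\<in>#M. snd x \<le> N)} \<subseteq> (\<lambda>(x, y). {#x, y#}) ` (?X \<times> ?X)"
    proof
      fix M assume M: "M \<in> {M. F M \<noteq> 0 \<and> (\<forall>x\<in>#M. snd x \<le> N)}"
      then obtain x y where xy: "M = {#x, y#}" "x \<in> gens k" "y \<in> gens k" using quad_nz[OF F] by blast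
      then have "\<bar>snd x + snd y\<bar> \<le> d" "snd x \<le> N" "snd y \<le> N" using M d
        unfolding bounded_degree_def by (simp_all del: split_paired_All)
      then have "x \<in> ?X" "y \<in> ?X" using xy by (cases x; cases y; auto simp: gens_def)+
      then show "M \<in> (\<lambda>(x, y). {#x, y#}) ` (?X \<times> ?X)" using xy(1) by auto
    qed
  qed simp
  moreover have "\<exists>s. \<forall>M. F M \<noteq> 0 \<longrightarrow> size M \<le> s" using F by (metis quad_def order_refl)
  ultimately show ?thesis using F by (simp add: Bbar_def quad_def)
qed

lemma fourier_ser2: "series_sum k (fourier k d) =
    ser2 k (\<lambda>x y. if fst x = 0 \<and> fst y = 0 \<and> snd x + snd y = d then deriv_coeff (k - 2) (snd y) else 0)"
  unfolding ser2_def fourier_def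
  by (rule arg_cong[of _ _ "series_sum k"]) (auto simp: fun_eq_iff split: list.splits)

lemma Q2_quad: "F \<in> Q2 k \<Longrightarrow> quad k F \<and> (\<exists>d. bounded_degree F d)"
proof (induction rule: Q2.induct)
  case (fourier d)
  let ?F = "series_sum k (fourier k d)"
  have q: "quad k ?F" by (simp only: fourier_ser2 quad_ser2)
  have "bounded_degree ?F \<bar>d\<bar>" unfolding bounded_degree_def
  proof (intro allI impI)
    fix x y assume "?F {#x, y#} \<noteq> 0"
    then have "sym_coeff k ?F x y \<noteq> 0" by (simp add: sym_coeff_eq_0[OF q])
    then have "snd x + snd y = d" unfolding fourier_ser2 sym_coeff_ser2 by (auto split: if_splits)
    then show "\<bar>snd x + snd y\<bar> \<le> \<bar>d\<bar>" by simp
  qed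
  then show ?case using q by blast
next
  case (add F G)
  then obtain d e where "bounded_degree F d" "bounded_degree G e" by blast
  then have de: "F {#x, y#} \<noteq> 0 \<Longrightarrow> \<bar>snd x + snd y\<bar> \<le> d" "G {#x, y#} \<noteq> 0 \<Longrightarrow> \<bar>snd x + snd y\<bar> \<le> e" for x y
    by (simp_all add: bounded_degree_def del: split_paired_All)
  have "bounded_degree (\<lambda>M. F M + G M) (max d e)"
    unfolding bounded_degree_def
  proof (intro allI impI)
    fix x y assume "F {#x, y#} + G {#x, y#} \<noteq> 0"
    then have "F {#x, y#} \<noteq> 0 \<or> G {#x, y#} \<noteq> 0" by auto
    then show "\<bar>snd x + snd y\<bar> \<le> max d e" using de[of x y] by linarith
  qed
  moreover have "quad k (\<lambda>M. F M + G M)" using add.IH unfolding quad_def by (metis add.right_neutral)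
  ultimately show ?case by blast
next
  case (scale F c)
  then obtain d where "bounded_degree F d" by blast
  then have "bounded_degree (\<lambda>M. c * F M) d" unfolding bounded_degree_def by auto
  moreover have "quad k (\<lambda>M. c * F M)" using scale.IH by (simp add: quad_def)
  ultimately show ?case by blast
next
  case (act F g)
  then obtain d where F: "quad k F" and d: "bounded_degree F d" by blast
  have "bounded_degree (act k g F) (d + 1)" unfolding bounded_degree_def
  proof (intro allI impI)
    fix x y assume "act k g F {#x, y#} \<noteq> 0"
    then have "act2 k g (sym_coeff k F) x y \<noteq> 0"
      using sym_coeff_eq_0[OF quad_act[OF F]] sym_coeff_act[OF F] by metis
    then have "sym_coeff k F (act_pred g x) y \<noteq> 0 \<or> sym_coeff k F x (act_pred g y) \<noteq> 0"
      by (auto simp: act2_def)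
    then have "\<bar>snd (act_pred g x) + snd y\<bar> \<le> d \<or> \<bar>snd x + snd (act_pred g y)\<bar> \<le> d"
      using d sym_coeff_eq_0[OF F] unfolding bounded_degree_def by metis
    moreover have "\<bar>snd (act_pred g z) - snd z\<bar> \<le> 1" for z by (cases g; cases z) auto
    from this[of x] this[of y] calculation show "\<bar>snd x + snd y\<bar> \<le> d + 1" by linarith
  qed
  then show ?case using quad_act[OF F] by blast
qed

lemma Q2_carrier: "Q2 k \<subseteq> carrier (Bbar k)"
  using Q2_quad quad_carrier by blast

section \<open>The quadratic relations\<close>

text \<open>In fixed weight s and degree d the second letter is determined by the first, so a
  function R of the first letter describes the whole quadratic family.\<close>

definition homog :: "nat \<Rightarrow> nat \<Rightarrow> int \<Rightarrow> (nat \<Rightarrow> int \<Rightarrow> complex) \<Rightarrow> gen \<Rightarrow> gen \<Rightarrow> complex" where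
  "homog k s d R x y = (if fst x \<le> k \<and> fst y \<le> k \<and> fst x + fst y = s \<and> snd x + snd y = d
                        then R (fst x) (snd x) else 0)"

definition relation :: "nat \<Rightarrow> nat \<Rightarrow> int \<Rightarrow> (nat \<Rightarrow> int \<Rightarrow> complex) \<Rightarrow> bool" where
  "relation k s d R \<longleftrightarrow> ser2 k (homog k s d R) \<in> Q2 k"

lemma gens_iff: "x \<in> gens k \<longleftrightarrow> fst x \<le> k"
  by (cases x) (auto simp: gens_def)

lemma relation_zero: "relation k s d (\<lambda>a m. 0)"
proof -
  have "ser2 k (homog k s d (\<lambda>a m. 0)) = (\<lambda>M. 0 * series_sum k (fourier k 0) M)"
    unfolding fourier_ser2 ser2_scale[symmetric] by (rule ser2_eqI) (simp add: homog_def)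
  then show ?thesis unfolding relation_def using Q2.scale[OF Q2.fourier] by metis
qed

lemma relation_add: "relation k s d R \<Longrightarrow> relation k s d R' \<Longrightarrow> relation k s d (\<lambda>a m. R a m + R' a m)"
proof -
  have "homog k s d (\<lambda>a m. R a m + R' a m) = (\<lambda>x y. homog k s d R x y + homog k s d R' x y)"
    by (auto simp: homog_def fun_eq_iff)
  then show "relation k s d R \<Longrightarrow> relation k s d R' \<Longrightarrow> relation k s d (\<lambda>a m. R a m + R' a m)"
    unfolding relation_def ser2_add[symmetric] by (simp add: ser2_add Q2.add)
qed

lemma relation_scale: "relation k s d R \<Longrightarrow> relation k s d (\<lambda>a m. c * R a m)"
proof -
  have "homog k s d (\<lambda>a m. c * R a m) = (\<lambda>x y. c * homog k s d R x y)"
    by (auto simp: homog_def fun_eq_iff)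
  then show "relation k s d R \<Longrightarrow> relation k s d (\<lambda>a m. c * R a m)"
    unfolding relation_def by (simp add: ser2_scale Q2.scale)
qed

lemma relation_diff: "relation k s d R \<Longrightarrow> relation k s d R' \<Longrightarrow> relation k s d (\<lambda>a m. R a m - R' a m)"
  using relation_add[of k s d R "\<lambda>a m. (-1) * R' a m"] relation_scale[of k s d R' "-1"] by simp

lemma relation_sum: "(\<And>i. i \<in> I \<Longrightarrow> relation k s d (R i)) \<Longrightarrow> relation k s d (\<lambda>a m. \<Sum>i\<in>I. R i a m)"
  by (induction I rule: infinite_finite_induct) (simp_all add: relation_zero relation_add)

lemma relation_cong:
  assumes "\<And>a m. a \<le> s \<Longrightarrow> R a m = R' a m" and "relation k s d R"
  shows "relation k s d R'"
proof -
  have "homog k s d R = homog k s d R'" using assms(1) by (auto simp: homog_def fun_eq_iff)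
  then show ?thesis using assms(2) by (simp add: relation_def)
qed

lemma relation_act:
  assumes "relation k s d R" "act2 k g (homog k s d R) = homog k s' d' R'"
  shows "relation k s' d' R'"
proof -
  have "act k g (ser2 k (homog k s d R)) = ser2 k (homog k s' d' R')"
    unfolding assms(2)[symmetric] by (rule act_ser2) (auto simp: homog_def gens_iff)
  then show ?thesis using assms(1) Q2.act unfolding relation_def by metis
qed

text \<open>The factors are those of \<open>pred_coeff\<close>, with Suc s - a the index of the
  second letter. Polynomial coefficient functions stay polynomial.\<close>

lemma relation_F1:
  assumes "relation k s d R"
  shows "relation k (Suc s) d (\<lambda>a m. of_nat a * R (a - 1) m + (of_nat (Suc s) - of_nat a) * R a m)"
proof (rule relation_act[OF assms, where g = F1], intro ext)
  fix x y :: gen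
  obtain a m b n where xy: "x = (a, m)" "y = (b, n)" by fastforce
  show "act2 k F1 (homog k s d R) x y =
    homog k (Suc s) d (\<lambda>a m. of_nat a * R (a - 1) m + (of_nat (Suc s) - of_nat a) * R a m) x y"
  proof (cases "a \<le> k \<and> b \<le> k \<and> a + b = Suc s \<and> m + n = d")
    case True
    then have "of_nat (Suc s) - of_nat a = (of_nat b :: complex)" by (simp add: algebra_simps flip: of_nat_add)
    then show ?thesis using True xy
      by (cases a; cases b) (auto simp: act2_def homog_def simp del: of_nat_Suc)
  next
    case False
    then show ?thesis using xy
      by (cases a; cases b) (auto simp: act2_def homog_def simp del: of_nat_Suc)
  qed
qed

text \<open>Compared with \<open>F1\<close>, only the term coming from the first letter has its mode
  shifted. Subtracting the two leaves a times a difference in m, which is how powers of a arise in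
  \<open>relation_binomial\<close>.\<close>

lemma relation_E0:
  assumes "relation k s d R"
  shows "relation k (Suc s) (d + 1)
    (\<lambda>a m. of_nat a * R (a - 1) (m - 1) + (of_nat (Suc s) - of_nat a) * R a m)"
proof (rule relation_act[OF assms, where g = E0], intro ext)
  fix x y :: gen
  obtain a m b n where xy: "x = (a, m)" "y = (b, n)" by fastforce
  show "act2 k E0 (homog k s d R) x y = homog k (Suc s) (d + 1)
    (\<lambda>a m. of_nat a * R (a - 1) (m - 1) + (of_nat (Suc s) - of_nat a) * R a m) x y"
  proof (cases "a \<le> k \<and> b \<le> k \<and> a + b = Suc s \<and> m + n = d + 1")
    case True
    then have "of_nat (Suc s) - of_nat a = (of_nat b :: complex)" by (simp add: algebra_simps flip: of_nat_add)
    then show ?thesis using True xy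
      by (cases a; cases b) (auto simp: act2_def homog_def simp del: of_nat_Suc)
  next
    case False
    then show ?thesis using xy
      by (cases a; cases b) (auto simp: act2_def homog_def simp del: of_nat_Suc)
  qed
qed

lemma relation_E1:
  assumes "relation k (Suc 0) d R" "k > 0"
  shows "relation k 0 d (\<lambda>a m. of_nat k * (R 1 m + R 0 m))"
proof (rule relation_act[OF assms(1), where g = E1], intro ext)
  fix x y :: gen
  obtain a m b n where xy: "x = (a, m)" "y = (b, n)" by fastforce
  show "act2 k E1 (homog k (Suc 0) d R) x y = homog k 0 d (\<lambda>a m. of_nat k * (R 1 m + R 0 m)) x y"
    using xy assms(2) by (auto simp: act2_def homog_def algebra_simps)
qed

section \<open>Polynomial coefficient functions that give relations\<close>

lemma gchoose_nat_diff: "((x + 1) gchoose Suc j) - (x gchoose Suc j) = (x gchoose j)" for x :: complex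
  by (simp add: gbinomial_Suc_Suc)

text \<open>The generating current is the case j = k - 2, since -n = m - d. Applying
  \<open>E0\<close> and then \<open>E1\<close> to a weight-0 relation acts, up to the factor k, as
  the sum of a shifted and an unshifted copy. Subtracting the relation itself twice leaves a
  difference, which lowers the degree by one.\<close>

lemma relation_falling:
  assumes "k \<ge> 2" "j \<le> k - 2"
  shows "relation k 0 d (\<lambda>a m. (of_int (m - d) :: complex) gchoose j)"
  using assms(2)
proof (induction arbitrary: d rule: inc_induct)
  case base
  have "deriv_coeff (k - 2) n = fact (k - 2) * (of_int (- n) gchoose (k - 2))" for n
    by (simp add: deriv_coeff_def gbinomial_mult_fact atLeast0LessThan)
  then have "series_sum k (fourier k d) =
      ser2 k (homog k 0 d (\<lambda>a m. fact (k - 2) * (of_int (m - d) gchoose (k - 2))))"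
    unfolding fourier_ser2 by (intro arg_cong[of _ _ "ser2 k"] ext) (auto simp: homog_def)
  then have "relation k 0 d (\<lambda>a m. fact (k - 2) * (of_int (m - d) gchoose (k - 2)))"
    unfolding relation_def using Q2.fourier by metis
  from relation_scale[OF this, of "1 / fact (k - 2)"] show ?case by simp
next
  case (step j)
  let ?q = "\<lambda>d m. (of_int (m - d) :: complex) gchoose Suc j"
  let ?P = "\<lambda>R. relation k 0 d (\<lambda>a m. R m)"
  have "relation k (Suc 0) d
      (\<lambda>a m. of_nat a * ?q (d - 1) (m - 1) + (of_nat (Suc 0) - of_nat a) * ?q (d - 1) m)"
    using relation_E0[OF step.IH[of "d - 1"]] by (simp only: diff_add_cancel)
  from relation_E1[OF this] assms
  have "?P (\<lambda>m. of_nat k * (?q (d - 1) (m - 1) + ?q (d - 1) m))" by (simp add: algebra_simps)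
  from relation_scale[OF this, of "1 / of_nat k"]
  have "?P (\<lambda>m. ?q (d - 1) (m - 1) + ?q (d - 1) m)"
    by (rule relation_cong[rotated]) (use assms in simp)
  from relation_diff[OF this relation_scale[OF step.IH[of d], of 2]]
  have "?P (\<lambda>m. ?q (d - 1) (m - 1) + ?q (d - 1) m - 2 * ?q d m)" .
  moreover have "?q (d - 1) (m - 1) + ?q (d - 1) m - 2 * ?q d m = (of_int (m - d) gchoose j)" for m
    using gchoose_nat_diff[of "of_int (m - d)" j] by (simp add: algebra_simps)
  ultimately show ?case by simp
qed

lemma gbinomial_Vandermonde_complex:
  "(\<Sum>i\<le>n. ((x::complex) gchoose i) * (y gchoose (n - i))) = (x + y) gchoose n"
  using gbinomial_Vandermonde[of x y n] by (simp add: atLeast0AtMost)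

lemma relation_binomial_0:
  assumes k: "k \<ge> 2" and j: "j < k"
  shows "relation k 0 d (\<lambda>a m. (of_int m :: complex) gchoose j)"
proof -
  have low: "relation k 0 d (\<lambda>a m. (of_int m :: complex) gchoose j)" if "j \<le> k - 2" for j
  proof -
    have "relation k 0 d (\<lambda>a m. \<Sum>i\<le>j. (of_int d gchoose (j - i)) * ((of_int (m - d) :: complex) gchoose i))"
      using that k by (intro relation_sum relation_scale relation_falling) auto
    moreover have "(\<Sum>i\<le>j. (of_int d gchoose (j - i)) * ((of_int (m - d) :: complex) gchoose i))
        = (of_int m gchoose j)" for m
      using gbinomial_Vandermonde_complex[of "of_int (m - d)" "of_int d" j] by (simp add: mult.commute)
    ultimately show ?thesis by simp
  qed
  show ?thesis
  proof (cases "j \<le> k - 2")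
    case False
    then have jk: "j = k - 1" using j by simp
    \<comment> \<open>The shift for which negating the upper index gives C(m + t, j) = (-1)^j C(d -
      m, j), i.e. the reflection that exchanges the two letters.\<close>
    define t :: complex where "t = of_nat k - 2 - of_int d"
    text \<open>In top degree the relation is a consequence of (skew-)commutativity alone.\<close>
    have "ser2 k (homog k 0 d (\<lambda>a m. (of_int m gchoose j) + ((of_int m + t) gchoose j)))
        = ser2 k (homog k 0 d (\<lambda>a m. 0))"
    proof (rule ser2_eqI)
      have refl: "(of_int m + t) gchoose j = (-1) ^ j * (of_int (d - m) gchoose j)" for m
        using gbinomial_negated_upper[of "of_int m + t" j] jk k
        by (simp add: t_def algebra_simps of_nat_diff)
      have "(-1 :: complex) ^ k = - ((-1) ^ j)" using jk k by (cases k) auto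
      moreover have "(-1 :: complex) ^ j * (-1) ^ j = 1" by (simp flip: power_add)
      ultimately have "A + (-1) ^ j * B + (-1) ^ k * (B + (-1) ^ j * A) = 0" for A B :: complex
        by (simp add: distrib_left flip: mult.assoc)
      then show "homog k 0 d (\<lambda>a m. (of_int m gchoose j) + ((of_int m + t) gchoose j)) x y +
        (-1) ^ k * homog k 0 d (\<lambda>a m. (of_int m gchoose j) + ((of_int m + t) gchoose j)) y x =
        homog k 0 d (\<lambda>a m. 0) x y + (-1) ^ k * homog k 0 d (\<lambda>a m. 0) y x" for x y
        by (auto simp: homog_def refl simp del: of_int_add of_int_diff)
    qed
    then have "relation k 0 d (\<lambda>a m. (of_int m gchoose j) + ((of_int m + t) gchoose j))"
      using relation_zero[of k 0 d] unfolding relation_def by simp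
    moreover have "relation k 0 d (\<lambda>a m. \<Sum>i<j. (t gchoose (j - i)) * ((of_int m :: complex) gchoose i))"
      using jk by (intro relation_sum relation_scale low) auto
    \<comment> \<open>By Vandermonde C(m + t, j) is C(m, j) plus terms of degree less than j, which
      are relations already. What is left is 2 C(m, j), hence the factor 1 / 2.\<close>
    ultimately have "relation k 0 d (\<lambda>a m. (1 / 2) * ((of_int m gchoose j) + ((of_int m + t) gchoose j)
        - (\<Sum>i<j. (t gchoose (j - i)) * (of_int m gchoose i))))"
      by (intro relation_scale relation_diff)
    moreover have "(of_int m + t) gchoose j = (of_int m gchoose j)
        + (\<Sum>i<j. (t gchoose (j - i)) * (of_int m gchoose i))" for m
      unfolding gbinomial_Vandermonde_complex[symmetric]
      by (simp add: mult.commute flip: lessThan_Suc_atMost)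
    ultimately show ?thesis by simp
  qed (rule low)
qed

text \<open>For i = 0 the two terms of \<open>F1\<close> add up to a multiple of the same function
  of m. For i = i' + 1 the difference of \<open>F1\<close> and \<open>E0\<close> on C(a, i') C(m +
  1, j + 1) is a C(a - 1, i') C(m, j) = i C(a, i) C(m, j). The sum i' + (j + 1) equals i + j, so the
  degree bound is respected.\<close>

lemma relation_binomial:
  assumes k: "k \<ge> 2" and "i + j < k"
  shows "relation k s d (\<lambda>a m. of_nat (a choose i) * ((of_int m :: complex) gchoose j))"
  using assms(2)
proof (induction s arbitrary: i j d)
  case 0
  show ?case
  proof (cases "i = 0")
    case True
    then show ?thesis using relation_binomial_0[OF k] 0 by simp
  next
    case False
    then show ?thesis using relation_zero by (rule_tac relation_cong[OF _ relation_zero]) auto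
  qed
next
  case (Suc s)
  show ?case
  proof (cases i)
    case 0
    have "relation k (Suc s) d (\<lambda>a m. of_nat a * (of_int m gchoose j)
        + (of_nat (Suc s) - of_nat a) * (of_int m gchoose j))"
      using relation_F1[OF Suc.IH[of 0 j d]] Suc.prems by simp
    then have "relation k (Suc s) d (\<lambda>a m. of_nat (Suc s) * (of_int m gchoose j))"
      by (simp add: algebra_simps)
    from relation_scale[OF this, of "1 / of_nat (Suc s)"] show ?thesis
      using 0 by (simp del: of_nat_Suc One_nat_def)
  next
    case (Suc i')
    let ?R = "\<lambda>a m. of_nat (a choose i') * ((of_int (m + 1) :: complex) gchoose Suc j)"
    have R: "relation k s d ?R" for d
    proof -
      have "relation k s d (\<lambda>a m. of_nat (a choose i') * ((of_int m :: complex) gchoose j)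
          + of_nat (a choose i') * ((of_int m :: complex) gchoose Suc j))"
        using Suc Suc.prems by (intro relation_add Suc.IH) auto
      then show ?thesis
        by (rule relation_cong[rotated])
          (simp only: of_int_add of_int_1 gbinomial_Suc_Suc distrib_left)
    qed
    have "relation k (Suc s) d (\<lambda>a m. (1 / of_nat (Suc i')) *
        ((of_nat a * ?R (a - 1) m + (of_nat (Suc s) - of_nat a) * ?R a m)
        - (of_nat a * ?R (a - 1) (m - 1) + (of_nat (Suc s) - of_nat a) * ?R a m)))"
      using relation_E0[OF R[of "d - 1"]] by (intro relation_scale relation_diff relation_F1 R) simp
    moreover have "(1 / of_nat (Suc i')) *
        ((of_nat a * ?R (a - 1) m + (of_nat (Suc s) - of_nat a) * ?R a m)
        - (of_nat a * ?R (a - 1) (m - 1) + (of_nat (Suc s) - of_nat a) * ?R a m))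
        = of_nat (a choose Suc i') * ((of_int m :: complex) gchoose j)" for a m
    proof (cases a)
      case (Suc a')
      have "of_nat (Suc i') * of_nat (a choose Suc i') = (of_nat a * of_nat (a' choose i') :: complex)"
        using Suc_times_binomial[of i' a'] Suc by (simp only: flip: of_nat_mult)
      then have e1: "of_nat (a choose Suc i') = (of_nat a * of_nat (a' choose i') / of_nat (Suc i') :: complex)"
        by (simp add: field_simps del: of_nat_Suc)
      have e2: "((of_int (m + 1) :: complex) gchoose Suc j) - (of_int (m - 1 + 1) gchoose Suc j) = (of_int m gchoose j)"
        using gchoose_nat_diff[of "of_int m" j] by simp
      have e3: "1 / q * ((x * (y * u) + v) - (x * (y * u') + v)) = x * y / q * (u - u')" for q x y u u' v :: complex
        by (simp add: algebra_simps diff_divide_distrib)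
      show ?thesis unfolding e1 e2[symmetric] e3 by (simp only: Suc diff_Suc_1)
    qed simp
    ultimately show ?thesis using Suc by simp
  qed
qed

subsection \<open>Interpolation\<close>

text \<open>Polynomials in a and m of total degree less than n, generated by products of binomials.
  In this basis Pascal's rule makes summation in a a mere increase of i.\<close>

inductive_set bipoly :: "nat \<Rightarrow> (nat \<Rightarrow> int \<Rightarrow> complex) set" for n where
  zero: "(\<lambda>a m. 0) \<in> bipoly n"
| add_binomial: "R \<in> bipoly n \<Longrightarrow> i + j < n \<Longrightarrow>
    (\<lambda>a m. R a m + c * (of_nat (a choose i) * (of_int m gchoose j))) \<in> bipoly n"

lemma relation_bipoly: "R \<in> bipoly k \<Longrightarrow> k \<ge> 2 \<Longrightarrow> relation k s d R"
  by (induction rule: bipoly.induct)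
    (auto intro: relation_zero relation_add[OF _ relation_scale[OF relation_binomial]])

lemma bipoly_add:
  assumes "S \<in> bipoly n" "R \<in> bipoly n"
  shows "(\<lambda>a m. R a m + S a m) \<in> bipoly n"
  using assms(1)
proof (induction rule: bipoly.induct)
  case (add_binomial S i j c)
  from bipoly.add_binomial[OF this(3,2), of c] show ?case by (simp add: add.assoc)
qed (use assms in simp)

lemma bipoly_binomial_m: "j < n \<Longrightarrow> (\<lambda>a m. c * (of_int m gchoose j)) \<in> bipoly n"
  using bipoly.add_binomial[OF bipoly.zero, of 0 j n c] by simp

lemma bipoly_sum: "(\<And>i. i \<in> I \<Longrightarrow> R i \<in> bipoly n) \<Longrightarrow> (\<lambda>a m. \<Sum>i\<in>I. R i a m) \<in> bipoly n"
  by (induction I rule: infinite_finite_induct) (auto intro: bipoly.zero bipoly_add)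

lemma bipoly_antidiff:
  assumes "R \<in> bipoly n"
  shows "\<exists>S\<in>bipoly (Suc n). \<forall>a m. S (Suc a) m - S a m = R a m"
  using assms
proof (induction rule: bipoly.induct)
  case zero
  then show ?case by (intro bexI[OF _ bipoly.zero]) simp
next
  case (add_binomial R i j c)
  then obtain S where S: "S \<in> bipoly (Suc n)" "\<forall>a m. S (Suc a) m - S a m = R a m" by blast
  have "(\<lambda>a m. S a m + c * (of_nat (a choose Suc i) * (of_int m gchoose j))) \<in> bipoly (Suc n)"
    using S(1) add_binomial by (intro bipoly.add_binomial) auto
  moreover have "S (Suc a) m + c * (of_nat (Suc a choose Suc i) * (of_int m gchoose j))
      - (S a m + c * (of_nat (a choose Suc i) * (of_int m gchoose j)))
      = R a m + c * (of_nat (a choose i) * (of_int m gchoose j))" for a m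
    using S(2)[rule_format, of a m] by (simp add: algebra_simps)
  ultimately show ?case by (intro bexI[of _ "\<lambda>a m. S a m + c * (of_nat (a choose Suc i) * (of_int m gchoose j))"]) auto
qed

lemma bipoly_mono: "R \<in> bipoly n \<Longrightarrow> n \<le> n' \<Longrightarrow> R \<in> bipoly n'"
  by (induction rule: bipoly.induct) (auto intro: bipoly.intros)

text \<open>Newton interpolation at n consecutive integers: the new term is a multiple of C(m - m0,
  n), which is 0 at the earlier nodes and 1 at m0 + n. Vandermonde re-expands it in binomials of
  m.\<close>

lemma bipoly_interpolate_m:
  "\<exists>p. (\<lambda>a m. p m) \<in> bipoly n \<and> (\<forall>m. m0 \<le> m \<and> m < m0 + int n \<longrightarrow> p m = g m)"
proof (induction n)
  case 0
  show ?case by (intro exI[of _ "\<lambda>m. 0"]) (auto intro: bipoly.zero)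
next
  case (Suc n)
  then obtain p where p: "(\<lambda>a m. p m) \<in> bipoly n" "\<And>m. m0 \<le> m \<Longrightarrow> m < m0 + int n \<Longrightarrow> p m = g m" by blast
  define c where "c = g (m0 + int n) - p (m0 + int n)"
  let ?b = "\<lambda>m. (of_int (m - m0) :: complex) gchoose n"
  have "(\<lambda>a m. \<Sum>i\<le>n. c * (of_int (- m0) gchoose (n - i)) * (of_int m gchoose i)) \<in> bipoly (Suc n)"
    by (intro bipoly_sum bipoly_binomial_m) auto
  moreover have "(\<Sum>i\<le>n. c * (of_int (- m0) gchoose (n - i)) * (of_int m gchoose i)) = c * ?b m" for m
    using gbinomial_Vandermonde_complex[of "of_int m" "of_int (- m0)" n]
    by (simp add: sum_distrib_left[symmetric] mult.assoc mult.commute[of "_ gchoose (n - _)"])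
  ultimately have b: "(\<lambda>a m. c * ?b m) \<in> bipoly (Suc n)" by simp
  have "(\<lambda>a m. p m + c * ?b m) \<in> bipoly (Suc n)"
    by (rule bipoly_add[OF b bipoly_mono[OF p(1)]]) simp
  moreover have "p m + c * ?b m = g m" if m: "m0 \<le> m" "m < m0 + int (Suc n)" for m
  proof -
    have e: "?b m = of_nat (nat (m - m0) choose n)"
      using m(1) by (simp add: binomial_gbinomial)
    show ?thesis
    proof (cases "m < m0 + int n")
      case True
      then have "nat (m - m0) < n" using m by simp
      then show ?thesis using e p(2)[OF m(1) True] by (simp add: binomial_eq_0)
    next
      case False
      then have "m = m0 + int n" using m by simp
      then show ?thesis using e by (simp add: c_def)
    qed
  qed
  ultimately show ?case by (intro exI[of _ "\<lambda>m. p m + c * ?b m"]) auto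
qed

text \<open>The difference in a of the sought polynomial is given on a smaller region of the same shape;
  what remains after summing it up depends only on m, because the rows of the region are intervals.\<close>

lemma bipoly_interpolate:
  fixes g :: "nat \<Rightarrow> int \<Rightarrow> complex"
  shows "\<exists>R\<in>bipoly n. \<forall>a m. lo \<le> a \<and> a \<le> lo + r \<and> c < 2 * m - int a \<and> 2 * m - int a < c + 2 * int n - int r
           \<longrightarrow> R a m = g a m"
proof (induction r arbitrary: n c g)
  case 0
  have eq: "(c < 2 * m - int lo \<and> 2 * m - int lo < c + 2 * int n) \<longrightarrow>
      ((c + int lo) div 2 + 1 \<le> m \<and> m < (c + int lo) div 2 + 1 + int n)" for m
    by linarith
  obtain p where "(\<lambda>a m. p m) \<in> bipoly n"
    "\<forall>m. (c + int lo) div 2 + 1 \<le> m \<and> m < (c + int lo) div 2 + 1 + int n \<longrightarrow> p m = g lo m"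
    using bipoly_interpolate_m[of n "(c + int lo) div 2 + 1" "g lo"] by blast
  then show ?case using eq by (intro bexI[of _ "\<lambda>a m. p m"]) auto
next
  case (Suc r)
  show ?case
  proof (cases n)
    case 0
    then show ?thesis by (intro bexI[OF _ bipoly.zero]) auto
  next
    case n: (Suc n')
    \<comment> \<open>With n - 1 and c + 1 the hypothesis covers exactly the (a, m) for which (a, m)
      and (a + 1, m) both lie in the region.\<close>
    obtain D where D: "D \<in> bipoly n'"
      "\<And>a m. lo \<le> a \<Longrightarrow> a \<le> lo + r \<Longrightarrow> c + 1 < 2 * m - int a \<Longrightarrow> 2 * m - int a < c + 1 + 2 * int n' - int r
         \<Longrightarrow> D a m = g (Suc a) m - g a m"
      using Suc.IH[of n' "c + 1" "\<lambda>a m. g (Suc a) m - g a m"] by blast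
    obtain S where S: "S \<in> bipoly n" "\<And>a m. S (Suc a) m - S a m = D a m"
      using bipoly_antidiff[OF D(1)] n by blast
    \<comment> \<open>The least row a \<ge> lo in which m is still below the upper end, i.e. a > 2 *
      m - c - 2 * n + Suc r.\<close>
    define first where "first = (\<lambda>m. nat (max (int lo) (2 * m - c - 2 * int n + int (Suc r) + 1)))"
    define rest where "rest = (\<lambda>m. g (first m) m - S (first m) m)"
    obtain p where p: "(\<lambda>a m. p m) \<in> bipoly n"
      "\<And>m. (c + int lo) div 2 + 1 \<le> m \<Longrightarrow> m < (c + int lo) div 2 + 1 + int n \<Longrightarrow> p m = rest m"
      using bipoly_interpolate_m[of n "(c + int lo) div 2 + 1" rest] by blast
    have const: "g a m - S a m = rest m"
      if a: "a \<le> lo + Suc r" "c < 2 * m - int a" "first m \<le> a" for a m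
      using a(3,1,2)
    proof (induction rule: dec_induct)
      case base
      then show ?case by (simp add: rest_def)
    next
      case (step a)
      have "int (first m) \<ge> int lo" "int (first m) \<ge> 2 * m - c - 2 * int n + int (Suc r) + 1"
        by (auto simp: first_def)
      then have "D a m = g (Suc a) m - g a m" using step n by (intro D(2)) auto
      moreover have "g a m - S a m = rest m" using step by simp
      ultimately show ?case using S(2)[of a m] by (simp add: algebra_simps)
    qed
    have "S a m + p m = g a m"
      if a: "lo \<le> a" "a \<le> lo + Suc r" "c < 2 * m - int a" "2 * m - int a < c + 2 * int n - int (Suc r)" for a m
    proof -
      \<comment> \<open>All rows together meet at most n values of m: from 2 * m > c + a \<ge> c +
        lo and 2 * m < c + 2 * n - Suc r + a \<le> c + 2 * n + lo. So one p of degree less than n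
        serves every row.\<close>
      have "(c + int lo) div 2 + 1 \<le> m" "m < (c + int lo) div 2 + 1 + int n" using a by linarith+
      moreover have "first m \<le> a" using a by (simp add: first_def)
      ultimately show ?thesis using const[of a m] p(2) a by (simp add: algebra_simps)
    qed
    then show ?thesis using bipoly_add[OF p(1) S(1)]
      by (intro bexI[of _ "\<lambda>a m. S a m + p m"]) auto
  qed
qed

subsection \<open>Normal-ordering rules\<close>

definition pos :: "gen \<Rightarrow> int" where
  "pos x = 2 * snd x - int (fst x)"

text \<open>Because min(a, k - b) = a + min(0, k - a - b), the condition on \<open>h_fun\<close>
  bounds 2 * m - a by a number that depends only on weight and degree.\<close>

lemma normal_pairs_pos:
  assumes "x \<in> gens k" "y \<in> gens k"
  shows "(x, y) \<in> normal_pairs k \<longleftrightarrow>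
    pos x \<le> snd x + snd y - int k + min 0 (int k - int (fst x + fst y))"
proof -
  have h: "h_fun k x y = int (min (fst x) (k - fst y)) - snd x + snd y"
    by (cases x; cases y) simp
  have "int (k - fst y) = int k - int (fst y)" using assms by (simp add: gens_iff of_nat_diff)
  then show ?thesis using assms h unfolding normal_pairs_def pos_def by (auto simp: min_def)
qed

lemma normal_pairs_asym:
  assumes "(x, y) \<in> normal_pairs k" "k \<ge> 1" shows "(y, x) \<notin> normal_pairs k"
proof
  assume yx: "(y, x) \<in> normal_pairs k"
  have g: "x \<in> gens k" "y \<in> gens k" using assms by (auto simp: normal_pairs_def)
  show False
    using assms yx unfolding normal_pairs_pos[OF g] normal_pairs_pos[OF g(2,1)] pos_def
    by (auto simp: min_def split: if_splits)
qed

lemma homogeneous_series: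
  assumes C: "\<And>w. C w \<noteq> 0 \<Longrightarrow> \<exists>x y. w = [x, y] \<and> x \<in> gens k \<and> y \<in> gens k \<and> snd x + snd y = d"
  shows "C \<in> word_series k"
proof -
  have "finite {w. C w \<noteq> 0 \<and> (\<forall>x\<in>set w. snd x \<le> N)}" for N
  proof (rule finite_subset)
    let ?X = "{0..k} \<times> {d - N..N}"
    show "{w. C w \<noteq> 0 \<and> (\<forall>x\<in>set w. snd x \<le> N)} \<subseteq> (\<lambda>(x, y). [x, y]) ` (?X \<times> ?X)"
    proof
      fix w assume w: "w \<in> {w. C w \<noteq> 0 \<and> (\<forall>x\<in>set w. snd x \<le> N)}"
      then obtain x y where xy: "w = [x, y]" "x \<in> gens k" "y \<in> gens k" "snd x + snd y = d" using C by blast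
      then have "snd x \<le> N" "snd y \<le> N" using w by auto
      then have "x \<in> ?X" "y \<in> ?X" using xy by (cases x; cases y; auto simp: gens_def)+
      then show "w \<in> (\<lambda>(x, y). [x, y]) ` (?X \<times> ?X)" using xy(1) by auto
    qed
  qed simp
  moreover have "set w \<subseteq> gens k \<and> length w \<le> 2" if "C w \<noteq> 0" for w using C[OF that] by auto
  ultimately show ?thesis unfolding word_series_def by blast
qed

lemma normal_ordered_pair: "normal_ordered k [x, y] \<longleftrightarrow> (x, y) \<in> normal_pairs k"
  by (auto simp: normal_ordered_def normal_pairs_def less_Suc_eq)

text \<open>If (y, x) is normal-ordered, (skew-)commutativity alone is the rule. Otherwise a
  relation is chosen whose coefficient is 1 at x and 0 at every other first letter of a pair that is
  disordered both ways. The remaining terms can then be normal-ordered by exchanging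
  letters.\<close>

lemma normal_rule_exists:
  assumes k: "k \<ge> 2" and xy: "x \<in> gens k" "y \<in> gens k" "(x, y) \<notin> normal_pairs k"
  obtains C where "normal_rule k x y C"
    "\<And>p. C p \<noteq> 0 \<Longrightarrow> \<exists>x' y'. p = [x', y'] \<and> snd x' + snd y' = snd x + snd y \<and> fst x' + fst y' = fst x + fst y"
proof -
  define s where "s = fst x + fst y"
  define d where "d = snd x + snd y"
  define c where "c = d - int k + min 0 (int k - int s)"
  have np: "(x', y') \<in> normal_pairs k \<longleftrightarrow> pos x' \<le> c"
    if "x' \<in> gens k" "y' \<in> gens k" "fst x' + fst y' = s" "snd x' + snd y' = d" for x' y'
    using normal_pairs_pos[OF that(1,2)] that(3,4) by (simp add: c_def)
  have "\<exists>R. relation k s d R \<and> (\<forall>x' y'. x' \<in> gens k \<longrightarrow> y' \<in> gens k \<longrightarrow> fst x' + fst y' = s \<longrightarrow>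
      snd x' + snd y' = d \<longrightarrow> (x', y') \<notin> normal_pairs k \<longrightarrow> (y', x') \<notin> normal_pairs k \<longrightarrow>
      R (fst x') (snd x') = (if x' = x then 1 else 0))"
  proof -
    \<comment> \<open>The indices a with a \<le> k and s - a \<le> k are those from lo to lo + r;
      truncation makes lo the maximum of 0 and s - k. The two positions of a pair add up to 2 * d -
      s, and 2 * d - s - c = c + 2 * k - r, so the region in \<open>R\<close> is that of the pairs
      disordered in both orders.\<close>
    define lo where "lo = s - k"
    define r where "r = min s (2 * k - s)"
    have s: "s \<le> 2 * k" using xy by (simp add: s_def gens_iff)
    obtain R where R: "R \<in> bipoly k" "\<And>a m. lo \<le> a \<Longrightarrow> a \<le> lo + r \<Longrightarrow> c < 2 * m - int a \<Longrightarrow>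
        2 * m - int a < c + 2 * int k - int r \<Longrightarrow> R a m = (if (a, m) = x then 1 else 0)"
      using bipoly_interpolate[of k lo r c "\<lambda>a m. if (a, m) = x then 1 else 0"] by blast
    have "R (fst x') (snd x') = (if x' = x then 1 else 0)"
      if h: "x' \<in> gens k" "y' \<in> gens k" "fst x' + fst y' = s" "snd x' + snd y' = d"
        "(x', y') \<notin> normal_pairs k" "(y', x') \<notin> normal_pairs k" for x' y'
    proof -
      have "pos x' > c" "pos y' > c" using np[of x' y'] np[of y' x'] h by (auto simp: add.commute)
      moreover have "fst x' \<le> k" "fst y' \<le> k" using h by (auto simp: gens_iff)
      ultimately have "R (fst x') (snd x') = (if (fst x', snd x') = x then 1 else 0)"
        using h(3,4) s by (intro R(2)) (auto simp: lo_def r_def pos_def c_def min_def)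
      then show ?thesis by simp
    qed
    then show ?thesis using relation_bipoly[OF R(1) k] by blast
  qed
  then obtain R where R: "relation k s d R" and ind: "\<And>x' y'. x' \<in> gens k \<Longrightarrow> y' \<in> gens k \<Longrightarrow>
      fst x' + fst y' = s \<Longrightarrow> snd x' + snd y' = d \<Longrightarrow> (x', y') \<notin> normal_pairs k \<Longrightarrow> (y', x') \<notin> normal_pairs k \<Longrightarrow>
      R (fst x') (snd x') = (if x' = x then 1 else 0)" by blast
  define bad where "bad = ((y, x) \<notin> normal_pairs k)"
  define H where "H = (if bad then homog k s d R else (\<lambda>x y. 0))"
  \<comment> \<open>The whole symmetrised coefficient of the difference is placed on the
    normal-ordered one of the two orders. By \<open>normal_pairs_asym\<close> the other order
    receives nothing.\<close>
  define C2 where "C2 = (\<lambda>x' y'. if (x', y') \<in> normal_pairs k \<and> fst x' + fst y' = s \<and> snd x' + snd y' = d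
    then (if x' = y \<and> y' = x then (-1) ^ k else 0) - (H x' y' + (-1) ^ k * H y' x') else 0)"
  define C where "C = (\<lambda>w. case w of [x', y'] \<Rightarrow> C2 x' y' | _ \<Rightarrow> 0)"
  have C_nz: "\<exists>x' y'. p = [x', y'] \<and> (x', y') \<in> normal_pairs k \<and> x' \<in> gens k \<and> y' \<in> gens k \<and>
      snd x' + snd y' = d \<and> fst x' + fst y' = s" if "C p \<noteq> 0" for p
    using that by (auto simp: C_def C2_def normal_pairs_def split: list.splits if_splits)
  have H_Q2: "ser2 k H \<in> Q2 k"
  proof (cases bad)
    case True
    then show ?thesis using R by (simp add: H_def relation_def)
  next
    case False
    then have "H = homog k s d (\<lambda>a m. 0)" by (auto simp: H_def homog_def fun_eq_iff)
    then show ?thesis using relation_zero by (simp add: relation_def)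
  qed
  define \<delta> :: "gen \<Rightarrow> gen \<Rightarrow> complex" where "\<delta> = (\<lambda>a b. if a = x \<and> b = y then 1 else 0)"
  have eq: "\<delta> x' y' + (-1) ^ k * \<delta> y' x' - (C2 x' y' + (-1) ^ k * C2 y' x') = H x' y' + (-1) ^ k * H y' x'"
    if g: "x' \<in> gens k" "y' \<in> gens k" for x' y'
  proof (cases "fst x' + fst y' = s \<and> snd x' + snd y' = d")
    case sd: True
    then have sd': "fst y' + fst x' = s \<and> snd y' + snd x' = d" by auto
    have sgn: "(-1 :: complex) ^ k * (-1) ^ k = 1" by (simp flip: power_add)
    consider (n) "(x', y') \<in> normal_pairs k" | (n') "(y', x') \<in> normal_pairs k"
      | (b) "(x', y') \<notin> normal_pairs k" "(y', x') \<notin> normal_pairs k" by blast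
    then show ?thesis
    proof cases
      case n
      then have "C2 y' x' = 0" using normal_pairs_asym[of x' y' k] k by (simp add: C2_def)
      moreover have "C2 x' y' = (-1) ^ k * \<delta> y' x' - (H x' y' + (-1) ^ k * H y' x')"
        using n sd by (auto simp: C2_def \<delta>_def)
      moreover have "\<delta> x' y' = 0" using n xy(3) by (auto simp: \<delta>_def)
      ultimately show ?thesis by simp
    next
      case n'
      then have "C2 x' y' = 0" using normal_pairs_asym[of y' x' k] k by (simp add: C2_def)
      moreover have "C2 y' x' = (-1) ^ k * \<delta> x' y' - (H y' x' + (-1) ^ k * H x' y')"
        using n' sd' by (auto simp: C2_def \<delta>_def)
      moreover have "\<delta> y' x' = 0" using n' xy(3) by (auto simp: \<delta>_def)
      moreover have "(-1) ^ k * ((-1) ^ k * A - (B + (-1) ^ k * A')) = A - A' - (-1) ^ k * B" for A A' B :: complex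
        using sgn by (simp add: algebra_simps flip: mult.assoc)
      ultimately show ?thesis by simp
    next
      case b
      have "H x' y' = (if x' = x \<and> y' = y then 1 else 0)" "H y' x' = (if y' = x \<and> x' = y then 1 else 0)"
      proof -
        have "y' = y" if "x' = x" using that sd by (cases y; cases y') (auto simp: s_def d_def)
        moreover have "x' = y" if "y' = x" using that sd' by (cases y; cases x') (auto simp: s_def d_def)
        moreover have bad if "x' = x \<or> y' = x" using that b calculation by (auto simp: bad_def)
        ultimately show "H x' y' = (if x' = x \<and> y' = y then 1 else 0)" "H y' x' = (if y' = x \<and> x' = y then 1 else 0)"
          using ind[OF g] ind[OF g(2,1)] sd sd' b g by (auto simp: H_def homog_def gens_iff)
      qed
      then show ?thesis using b by (auto simp: C2_def \<delta>_def)
    qed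
  next
    case False
    then have "\<not> (fst y' + fst x' = s \<and> snd y' + snd x' = d)" by (simp add: add.commute)
    then have "C2 x' y' = 0" "C2 y' x' = 0" "H x' y' = 0" "H y' x' = 0"
      using False by (auto simp: C2_def H_def homog_def)
    moreover have "\<delta> x' y' = 0" "\<delta> y' x' = 0"
      using False by (auto simp: \<delta>_def s_def d_def add.commute)
    ultimately show ?thesis by simp
  qed
  have "(\<lambda>M. word_prod k [x, y] M - series_sum k C M) = ser2 k H"
  proof -
    have "(\<lambda>M. word_prod k [x, y] M - series_sum k C M) = (\<lambda>M. ser2 k \<delta> M + ser2 k (\<lambda>a b. (-1) * C2 a b) M)"
      unfolding ser2_scale by (simp add: word_prod_ser2 \<delta>_def C_def ser2_def)
    also have "\<dots> = ser2 k (\<lambda>a b. \<delta> a b + (-1) * C2 a b)" by (rule ser2_add[symmetric])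
    also have "\<dots> = ser2 k H"
      by (rule ser2_eqI) (use eq in \<open>simp add: algebra_simps\<close>)
    finally show ?thesis .
  qed
  moreover have "C \<in> word_series k"
    by (rule homogeneous_series[of C k d]) (drule C_nz, blast)
  moreover have "normal_ordered k p \<and> length p = 2" if "C p \<noteq> 0" for p
    using C_nz[OF that] by (auto simp: normal_ordered_pair)
  ultimately have "normal_rule k x y C"
    using xy H_Q2 unfolding normal_rule_def normal_series_def by simp
  moreover have "\<exists>x' y'. p = [x', y'] \<and> snd x' + snd y' = snd x + snd y \<and> fst x' + fst y' = fst x + fst y"
    if "C p \<noteq> 0" for p using C_nz[OF that] unfolding s_def d_def by blast
  ultimately show ?thesis by (rule that)
qed

section \<open>The closed ideal of relations\<close>

lemma ideal_Q2: "ideal (Idl\<^bsub>Bbar k\<^esub> (Q2 k)) (Bbar k)"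
  using ring.genideal_ideal[OF ring_Bbar Q2_carrier] .

lemma Idl_Q2_add:
  assumes "F \<in> Idl\<^bsub>Bbar k\<^esub> (Q2 k)" "G \<in> Idl\<^bsub>Bbar k\<^esub> (Q2 k)"
  shows "(\<lambda>M. F M + G M) \<in> Idl\<^bsub>Bbar k\<^esub> (Q2 k)"
  using additive_subgroup.a_closed[OF ideal.axioms(1)[OF ideal_Q2] assms] by (simp add: Bbar_add)

lemma Idl_Q2_zero: "(\<lambda>M. 0) \<in> Idl\<^bsub>Bbar k\<^esub> (Q2 k)"
  using additive_subgroup.zero_closed[OF ideal.axioms(1)[OF ideal_Q2]] by (simp add: Bbar_zero)

lemma Idl_Q2_uminus:
  assumes "F \<in> Idl\<^bsub>Bbar k\<^esub> (Q2 k)"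
  shows "(\<lambda>M. - F M) \<in> Idl\<^bsub>Bbar k\<^esub> (Q2 k)"
proof -
  interpret ideal "Idl\<^bsub>Bbar k\<^esub> (Q2 k)" "Bbar k" by (rule ideal_Q2)
  show ?thesis
    using additive_subgroup.a_inv_closed[OF ideal.axioms(1)[OF ideal_Q2] assms] Bbar_uminus[OF Icarr[OF assms]]
    by simp
qed

lemma rel_ideal_carrier: "F \<in> rel_ideal k \<Longrightarrow> F \<in> carrier (Bbar k)"
  by (simp add: rel_ideal_def adic_closure_def)

lemma rel_ideal_zero: "(\<lambda>M. 0) \<in> rel_ideal k"
proof -
  interpret ring "Bbar k" by (rule ring_Bbar)
  have "(\<lambda>M. 0) \<in> carrier (Bbar k)" using zero_closed by (simp add: Bbar_zero)
  then show ?thesis unfolding rel_ideal_def adic_closure_def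
    by (intro CollectI conjI allI bexI[OF _ Idl_Q2_zero]) auto
qed

lemma rel_ideal_add:
  assumes "F \<in> rel_ideal k" "G \<in> rel_ideal k"
  shows "(\<lambda>M. F M + G M) \<in> rel_ideal k"
proof -
  interpret ring "Bbar k" by (rule ring_Bbar)
  have "(\<lambda>M. F M + G M) \<in> carrier (Bbar k)"
    using a_closed[OF rel_ideal_carrier[OF assms(1)] rel_ideal_carrier[OF assms(2)]] by (simp add: Bbar_add)
  moreover have "\<exists>H\<in>Idl\<^bsub>Bbar k\<^esub> (Q2 k). \<forall>M. (\<forall>x\<in>#M. snd x \<le> N) \<longrightarrow> F M + G M = H M" for N
  proof -
    obtain F' G' where FG: "F' \<in> Idl\<^bsub>Bbar k\<^esub> (Q2 k)" "\<forall>M. (\<forall>x\<in>#M. snd x \<le> N) \<longrightarrow> F M = F' M"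
      "G' \<in> Idl\<^bsub>Bbar k\<^esub> (Q2 k)" "\<forall>M. (\<forall>x\<in>#M. snd x \<le> N) \<longrightarrow> G M = G' M"
      using assms unfolding rel_ideal_def adic_closure_def by blast
    show ?thesis by (rule bexI[OF _ Idl_Q2_add[OF FG(1,3)]]) (use FG in simp)
  qed
  ultimately show ?thesis by (simp add: rel_ideal_def adic_closure_def)
qed

lemma rel_ideal_uminus:
  assumes "F \<in> rel_ideal k"
  shows "(\<lambda>M. - F M) \<in> rel_ideal k"
proof -
  have "(\<lambda>M. - F M) \<in> carrier (Bbar k)"
    using carrier_scale[OF rel_ideal_carrier[OF assms], of "-1"] by simp
  moreover have "\<exists>H\<in>Idl\<^bsub>Bbar k\<^esub> (Q2 k). \<forall>M. (\<forall>x\<in>#M. snd x \<le> N) \<longrightarrow> - F M = H M" for N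
  proof -
    obtain F' where "F' \<in> Idl\<^bsub>Bbar k\<^esub> (Q2 k)" "\<forall>M. (\<forall>x\<in>#M. snd x \<le> N) \<longrightarrow> F M = F' M"
      using assms unfolding rel_ideal_def adic_closure_def by blast
    then show ?thesis by (intro bexI[OF _ Idl_Q2_uminus]) auto
  qed
  ultimately show ?thesis by (simp add: rel_ideal_def adic_closure_def)
qed

lemma R_class_def': "R_class k F = {(\<lambda>M. H M + F M) | H. H \<in> rel_ideal k}"
  by (auto simp: R_class_def a_r_coset_def' Bbar_def)

lemma R_class_eqI:
  assumes "(\<lambda>M. F M - G M) \<in> rel_ideal k"
  shows "R_class k F = R_class k G"
proof -
  have "R_class k F \<subseteq> R_class k G" if D: "(\<lambda>M. F M - G M) \<in> rel_ideal k" for F G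
  proof
    fix X assume "X \<in> R_class k F"
    then obtain H where "H \<in> rel_ideal k" "X = (\<lambda>M. H M + F M)" by (auto simp: R_class_def')
    then have "X = (\<lambda>M. (H M + (F M - G M)) + G M)" "(\<lambda>M. H M + (F M - G M)) \<in> rel_ideal k"
      using rel_ideal_add[OF _ D] by auto
    then show "X \<in> R_class k G"
      unfolding R_class_def' by (intro CollectI exI[of _ "\<lambda>M. H M + (F M - G M)"] conjI)
  qed
  from this[OF assms] this[of G F] rel_ideal_uminus[OF assms] show ?thesis by auto
qed

lemma R_class_zero:
  assumes "R_class k F = \<zero>\<^bsub>R_alg k\<^esub>"
  shows "F \<in> rel_ideal k"
proof -
  have "\<zero>\<^bsub>R_alg k\<^esub> = rel_ideal k" by (simp add: R_alg_def FactRing_def)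
  moreover have "(\<lambda>M. 0 + F M) \<in> R_class k F"
    unfolding R_class_def' by (intro CollectI exI[of _ "\<lambda>M. 0"] conjI refl rel_ideal_zero)
  ultimately show ?thesis using assms by simp
qed

section \<open>Rewriting\<close>

text \<open>A weighted sum of positions that strictly decreases under rewriting.\<close>

fun energy :: "gen list \<Rightarrow> int" where
  "energy [] = 0"
| "energy (x # w) = int (length w + 1) * pos x + energy w"

lemma energy_append: "energy (u @ v) = energy u + int (length v) * sum_list (map pos u) + energy v"
  by (induction u) (simp_all add: algebra_simps)

text \<open>Neighbouring weights differ by one, so moving part of the position from the left letter
  to the right one lowers the energy by exactly that amount.\<close>

lemma energy_pair:
  assumes "pos x' + pos y' = pos x + pos y"
  shows "energy (u @ [x', y'] @ v) = energy (u @ [x, y] @ v) + (pos x' - pos x)"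
proof -
  have e: "pos y' = pos x + pos y - pos x'" using assms by simp
  show ?thesis by (simp add: energy_append e algebra_simps)
qed

definition degree_sum :: "gen list \<Rightarrow> int" where
  "degree_sum w = sum_list (map snd w)"

lemma degree_sum_le: "\<forall>x\<in>set w. snd x \<le> N \<Longrightarrow> degree_sum w \<le> int (length w) * N"
  by (induction w) (auto simp: degree_sum_def algebra_simps)

text \<open>A mode can be very negative only if others compensate for it, and these contribute at
  most s * |N|. Only finitely many words remain, which ties the energy to the topology of the
  completion.\<close>

lemma energy_lower_bound:
  "\<exists>B. \<forall>w. set w \<subseteq> gens k \<and> length w = s \<and> degree_sum w = d \<and> (\<forall>x\<in>set w. snd x \<le> N) \<longrightarrow> B \<le> energy w"
proof -
  let ?A = "{0..k} \<times> {d - int s * \<bar>N\<bar>..N}"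
  let ?W = "{w. set w \<subseteq> ?A \<and> length w = s}"
  have fin: "finite ?W" by (rule finite_lists_length_eq) simp
  have "Min (insert 0 (energy ` ?W)) \<le> energy w"
    if w: "set w \<subseteq> gens k" "length w = s" "degree_sum w = d" "\<forall>x\<in>set w. snd x \<le> N" for w
  proof -
    have "x \<in> ?A" if x: "x \<in> set w" for x
    proof -
      obtain u v where uv: "w = u @ x # v" using split_list[OF x] by blast
      then have "degree_sum u + snd x + degree_sum v = d" using w(3) by (simp add: degree_sum_def)
      moreover have "degree_sum u \<le> int (length u) * \<bar>N\<bar>" "degree_sum v \<le> int (length v) * \<bar>N\<bar>"
        using w(4) uv by (auto intro!: degree_sum_le order_trans[OF _ abs_ge_self])
      moreover have "int (length u) * \<bar>N\<bar> + int (length v) * \<bar>N\<bar> \<le> int s * \<bar>N\<bar>"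
        using w(2) uv by (simp add: distrib_right[symmetric] mult_right_mono flip: of_nat_add)
      ultimately have "d - int s * \<bar>N\<bar> \<le> snd x" by linarith
      then show ?thesis using w(1,4) x by (cases x) (auto simp: gens_def)
    qed
    then have "w \<in> ?W" using w(2) by blast
    then show ?thesis using fin by (intro Min_le) auto
  qed
  then show ?thesis by blast
qed

section \<open>Convergence by rewriting disordered words of maximal energy\<close>

definition admissible :: "nat \<Rightarrow> nat \<Rightarrow> int \<Rightarrow> int \<Rightarrow> (gen list \<Rightarrow> complex) \<Rightarrow> bool" where
  "admissible k s d e X \<longleftrightarrow>
     (\<forall>w. X w \<noteq> 0 \<longrightarrow> set w \<subseteq> gens k \<and> length w = s \<and> degree_sum w = d \<and> energy w \<le> e) \<and>
     (\<forall>B. finite {w. X w \<noteq> 0 \<and> B \<le> energy w})"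

lemma admissibleD:
  "admissible k s d e X \<Longrightarrow> X w \<noteq> 0 \<Longrightarrow> set w \<subseteq> gens k \<and> length w = s \<and> degree_sum w = d \<and> energy w \<le> e"
  "admissible k s d e X \<Longrightarrow> finite {w. X w \<noteq> 0 \<and> B \<le> energy w}"
  by (auto simp: admissible_def)

lemma not_normal_ordered_split:
  assumes "set w \<subseteq> gens k" "\<not> normal_ordered k w"
  obtains u x y v where "w = u @ [x, y] @ v" "x \<in> gens k" "y \<in> gens k" "(x, y) \<notin> normal_pairs k"
proof -
  obtain i where i: "i + 1 < length w" "(w ! i, w ! (i + 1)) \<notin> normal_pairs k"
    using assms by (auto simp: normal_ordered_def)
  have "drop i w = [w ! i, w ! (i + 1)] @ drop (i + 2) w"
    using i(1) Cons_nth_drop_Suc[of i w] Cons_nth_drop_Suc[of "Suc i" w] by simp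
  then have "w = take i w @ [w ! i, w ! (i + 1)] @ drop (i + 2) w"
    by (metis append_take_drop_id)
  moreover have "w ! i \<in> gens k" "w ! (i + 1) \<in> gens k" using assms i by auto
  ultimately show ?thesis using that i by blast
qed

text \<open>Normal-ordered pairs of one weight and degree are those with first position below a
  common threshold, so a rule lowers the first position and keeps the sum. All new words have energy
  strictly below that of w, and the coefficients of the other words at or above this energy stay
  untouched.\<close>

lemma rewrite_admissible:
  assumes k: "k \<ge> 2" and X: "admissible k s d e X" and w: "X w \<noteq> 0" "\<not> normal_ordered k w"
  obtains Y where "rewrite_step k X Y" "admissible k s d e Y" "Y w = 0"
    "\<And>v. v \<noteq> w \<Longrightarrow> energy w \<le> energy v \<Longrightarrow> Y v = X v"
    "(\<lambda>M. series_sum k X M - series_sum k Y M) \<in> Idl\<^bsub>Bbar k\<^esub> (Q2 k)"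
proof -
  have wg: "set w \<subseteq> gens k" "length w = s" "degree_sum w = d" "energy w \<le> e" using admissibleD(1)[OF X w(1)] by auto
  obtain u x y v where uv: "w = u @ [x, y] @ v" and xy: "x \<in> gens k" "y \<in> gens k" "(x, y) \<notin> normal_pairs k"
    using not_normal_ordered_split[OF wg(1) w(2)] by metis
  obtain C where C: "normal_rule k x y C" and Cw: "\<And>p. C p \<noteq> 0 \<Longrightarrow>
      \<exists>x' y'. p = [x', y'] \<and> snd x' + snd y' = snd x + snd y \<and> fst x' + fst y' = fst x + fst y"
    using normal_rule_exists[OF k xy] by blast
  define T where "T = (\<lambda>z. \<Sum>p | z = u @ p @ v. C p)"
  define Y where "Y = (\<lambda>z. (if z = w then 0 else X z) + X w * T z)"
  have T1: "T (u @ p @ v) = C p" for p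
  proof -
    have "{p'. u @ p @ v = u @ p' @ v} = {p}" by auto
    then show ?thesis by (simp add: T_def)
  qed
  have T2: "\<exists>p. z = u @ p @ v \<and> C p \<noteq> 0" if "T z \<noteq> 0" for z
  proof -
    have "\<exists>p. z = u @ p @ v" using that unfolding T_def by (metis (mono_tags, lifting) mem_Collect_eq sum.not_neutral_contains_not_neutral)
    then show ?thesis using that T1 by auto
  qed
  have Cp: "\<exists>x' y'. p = [x', y'] \<and> x' \<in> gens k \<and> y' \<in> gens k \<and> snd x' + snd y' = snd x + snd y \<and>
      pos x' < pos x \<and> pos x' + pos y' = pos x + pos y \<and> energy (u @ p @ v) = energy w + (pos x' - pos x)"
    if p: "C p \<noteq> 0" for p
  proof -
    obtain x' y' where p': "p = [x', y']" "snd x' + snd y' = snd x + snd y" "fst x' + fst y' = fst x + fst y"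
      using Cw[OF p] by blast
    have "normal_ordered k p" using C p by (auto simp: normal_rule_def normal_series_def)
    then have n: "(x', y') \<in> normal_pairs k" using p'(1) by (simp add: normal_ordered_pair)
    then have g: "x' \<in> gens k" "y' \<in> gens k" by (auto simp: normal_pairs_def)
    have "pos x' < pos x" using n xy(3) p' normal_pairs_pos[OF g] normal_pairs_pos[OF xy(1,2)] by simp
    moreover have sum: "pos x' + pos y' = pos x + pos y"
      using p'(2) arg_cong[OF p'(3), of int] by (simp add: pos_def)
    moreover have "energy (u @ p @ v) = energy w + (pos x' - pos x)"
      unfolding uv p'(1) by (rule energy_pair[OF sum])
    ultimately show ?thesis using p' g by blast
  qed
  have low: "T z = 0" if "energy w \<le> energy z" for z
  proof (rule ccontr)
    assume "T z \<noteq> 0"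
    then obtain p where "z = u @ p @ v" "C p \<noteq> 0" using T2 by blast
    then show False using Cp[of p] that by auto
  qed
  have "rewrite_step k X Y"
    unfolding rewrite_step_def by (intro exI[of _ u] exI[of _ v] exI[of _ x] exI[of _ y] exI[of _ C])
      (simp add: C Y_def T_def uv)
  moreover have Yw: "Y w = 0" using low[of w] by (simp add: Y_def)
  moreover have "Y v = X v" if "v \<noteq> w" "energy w \<le> energy v" for v
    using that low[of v] by (simp add: Y_def)
  moreover have "admissible k s d e Y"
    unfolding admissible_def
  proof (intro conjI allI impI)
    fix z assume "Y z \<noteq> 0"
    then have "X z \<noteq> 0 \<or> T z \<noteq> 0" by (auto simp: Y_def split: if_splits)
    then have "set z \<subseteq> gens k \<and> length z = s \<and> degree_sum z = d \<and> energy z \<le> e"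
    proof
      assume "T z \<noteq> 0"
      then obtain p where p: "z = u @ p @ v" "C p \<noteq> 0" using T2 by blast
      then show ?thesis using Cp[OF p(2)] wg unfolding uv by (auto simp: degree_sum_def)
    qed (use admissibleD(1)[OF X] in blast)
    then show "set z \<subseteq> gens k" "length z = s" "degree_sum z = d" "energy z \<le> e" by auto
  next
    fix B
    \<comment> \<open>A lower bound on the energy bounds \<open>pos x'\<close> from below, hence the
      mode of y' from above; the mode of x' is bounded by \<open>pos x' < pos x\<close>. Convergence
      of the rule then leaves finitely many new words.\<close>
    define N where "N = \<bar>pos x\<bar> + int k + \<bar>B\<bar> + \<bar>energy w\<bar> + \<bar>snd x + snd y\<bar>"
    have "{z. Y z \<noteq> 0 \<and> B \<le> energy z} \<subseteq> {z. X z \<noteq> 0 \<and> B \<le> energy z}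
        \<union> (\<lambda>p. u @ p @ v) ` {p. C p \<noteq> 0 \<and> (\<forall>x\<in>set p. snd x \<le> N)}"
    proof
      fix z assume z: "z \<in> {z. Y z \<noteq> 0 \<and> B \<le> energy z}"
      show "z \<in> {z. X z \<noteq> 0 \<and> B \<le> energy z} \<union> (\<lambda>p. u @ p @ v) ` {p. C p \<noteq> 0 \<and> (\<forall>x\<in>set p. snd x \<le> N)}"
      proof (cases "X z = 0")
        case True
        then have "T z \<noteq> 0" using z by (auto simp: Y_def split: if_splits)
        then obtain p where p: "z = u @ p @ v" "C p \<noteq> 0" using T2 by blast
        obtain x' y' where p': "p = [x', y']" "x' \<in> gens k" "snd x' + snd y' = snd x + snd y" "pos x' < pos x"
          "energy z = energy w + (pos x' - pos x)" using Cp[OF p(2)] p(1) by blast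
        have "0 \<le> int (fst x')" "int (fst x') \<le> int k" using p'(2) by (auto simp: gens_iff)
        then have "snd x' \<le> N" "snd y' \<le> N" using p'(3-5) z unfolding N_def pos_def by auto
        then show ?thesis using p p'(1) by auto
      qed (use z in simp)
    qed
    moreover have "finite {p. C p \<noteq> 0 \<and> (\<forall>x\<in>set p. snd x \<le> N)}"
      using C by (auto simp: normal_rule_def normal_series_def word_series_def)
    ultimately show "finite {z. Y z \<noteq> 0 \<and> B \<le> energy z}"
      using admissibleD(2)[OF X, of B] by (meson finite_UnI finite_imageI finite_subset)
  qed
  moreover have "(\<lambda>M. series_sum k X M - series_sum k Y M) \<in> Idl\<^bsub>Bbar k\<^esub> (Q2 k)"
  proof -
    interpret ideal "Idl\<^bsub>Bbar k\<^esub> (Q2 k)" "Bbar k" by (rule ideal_Q2)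
    \<comment> \<open>The change made by the step is this multiple of the rule, placed between u and
      v; it therefore lies in the two-sided ideal.\<close>
    define D where "D = (\<lambda>p. X w * (single_word [x, y] p + (-1) * C p))"
    have "(\<lambda>M. X w * (word_prod k [x, y] M - series_sum k C M)) \<in> Q2 k"
      using C by (intro Q2.scale) (simp add: normal_rule_def)
    moreover have "series_sum k D = (\<lambda>M. X w * (word_prod k [x, y] M - series_sum k C M))"
      unfolding D_def fun_eq_iff series_sum_scale series_sum_add series_sum_single by simp
    ultimately have "series_sum k D \<in> Idl\<^bsub>Bbar k\<^esub> (Q2 k)"
      using genideal_self[OF Q2_carrier] by auto
    then have "word_prod k u \<otimes>\<^bsub>Bbar k\<^esub> series_sum k D \<otimes>\<^bsub>Bbar k\<^esub> word_prod k v \<in> Idl\<^bsub>Bbar k\<^esub> (Q2 k)"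
      by (intro I_r_closed I_l_closed word_prod_carrier)
    moreover have "(\<lambda>M. series_sum k X M - series_sum k Y M)
        = word_prod k u \<otimes>\<^bsub>Bbar k\<^esub> series_sum k D \<otimes>\<^bsub>Bbar k\<^esub> word_prod k v"
    proof -
      have "(\<Sum>p | z = u @ p @ v. D p) = X z + (-1) * Y z" for z
      proof (cases "\<exists>p. z = u @ p @ v")
        case True
        then obtain p where p: "z = u @ p @ v" by blast
        then have "{p. z = u @ p @ v} = {p}" by auto
        then show ?thesis using p T1[of p] by (auto simp: D_def Y_def uv single_word_def algebra_simps)
      next
        case False
        then have "T z = 0" "z \<noteq> w" using T2[of z] uv by auto
        then show ?thesis using False by (simp add: Y_def)
      qed
      then show ?thesis unfolding series_sum_embed[symmetric] fun_eq_iff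
        by (simp only: series_sum_add series_sum_scale) simp
    qed
    ultimately show ?thesis by simp
  qed
  ultimately show ?thesis using that[of Y] by blast
qed

definition disordered :: "nat \<Rightarrow> (gen list \<Rightarrow> complex) \<Rightarrow> gen list set" where
  "disordered k X = {w. X w \<noteq> 0 \<and> \<not> normal_ordered k w}"

text \<open>The choice of w matters: with maximal energy, the coefficients above that energy are
  already final, and each energy level contains only finitely many words to treat.\<close>

definition rewrite_top :: "nat \<Rightarrow> (gen list \<Rightarrow> complex) \<Rightarrow> (gen list \<Rightarrow> complex) \<Rightarrow> bool" where
  "rewrite_top k X Y \<longleftrightarrow> (disordered k X = {} \<and> Y = X) \<or>
     (\<exists>w\<in>disordered k X. (\<forall>v\<in>disordered k X. energy v \<le> energy w) \<and> rewrite_step k X Y \<and> Y w = 0 \<and>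
        (\<forall>v. v \<noteq> w \<longrightarrow> energy w \<le> energy v \<longrightarrow> Y v = X v) \<and>
        (\<lambda>M. series_sum k X M - series_sum k Y M) \<in> Idl\<^bsub>Bbar k\<^esub> (Q2 k))"

lemma rewrite_top_exists:
  assumes k: "k \<ge> 2" and X: "admissible k s d e X"
  shows "\<exists>Y. admissible k s d e Y \<and> rewrite_top k X Y"
proof (cases "disordered k X = {}")
  case True
  then show ?thesis using X by (auto simp: rewrite_top_def)
next
  case False
  then obtain w0 where w0: "w0 \<in> disordered k X" by blast
  let ?S = "{w \<in> disordered k X. energy w0 \<le> energy w}"
  have fin: "finite ?S"
    by (rule finite_subset[OF _ admissibleD(2)[OF X, of "energy w0"]]) (auto simp: disordered_def)
  then have "Max (energy ` ?S) \<in> energy ` ?S" using w0 by (intro Max_in) auto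
  then obtain w where w: "w \<in> ?S" "energy w = Max (energy ` ?S)" by auto
  have max: "energy v \<le> energy w" if "v \<in> disordered k X" for v
  proof (cases "energy w0 \<le> energy v")
    case True
    then show ?thesis using fin that unfolding w(2) by (intro Max_ge) auto
  qed (use w(1) in auto)
  have wX: "w \<in> disordered k X" using w(1) by simp
  then have "X w \<noteq> 0" "\<not> normal_ordered k w" by (auto simp: disordered_def)
  then obtain Y where Y: "rewrite_step k X Y" "admissible k s d e Y" "Y w = 0"
    "\<And>v. v \<noteq> w \<Longrightarrow> energy w \<le> energy v \<Longrightarrow> Y v = X v"
    "(\<lambda>M. series_sum k X M - series_sum k Y M) \<in> Idl\<^bsub>Bbar k\<^esub> (Q2 k)"
    using rewrite_admissible[OF k X, of w] by blast
  have "rewrite_top k X Y"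
    unfolding rewrite_top_def
    by (intro disjI2 bexI[OF _ wX] conjI ballI allI impI max Y(1,3,4,5))
  then show ?thesis using Y(2) by blast
qed

lemma word_rewrites:
  assumes k: "k \<ge> 2" and w0: "set w0 \<subseteq> gens k"
  shows "\<exists>G\<in>normal_series k. rewrites_to k (single_word w0) G \<and>
           R_class k (word_prod k w0) = R_class k (series_sum k G)"
proof -
  define s d e where "s = length w0" and "d = degree_sum w0" and "e = energy w0"
  have adm0: "admissible k s d e (single_word w0)"
  proof -
    have "{w. single_word w0 w \<noteq> 0 \<and> B \<le> energy w} \<subseteq> {w0}" for B by (auto simp: single_word_def)
    then have "finite {w. single_word w0 w \<noteq> 0 \<and> B \<le> energy w}" for B by (rule finite_subset) simp
    then show ?thesis using w0 by (auto simp: admissible_def single_word_def s_def d_def e_def)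
  qed
  have "\<exists>X. \<forall>n. (admissible k s d e (X n) \<and> (n = 0 \<longrightarrow> X n = single_word w0)) \<and> rewrite_top k (X n) (X (Suc n))"
  proof (rule dependent_nat_choice)
    show "\<exists>X. admissible k s d e X \<and> (0 = 0 \<longrightarrow> X = single_word w0)" using adm0 by blast
    fix X and n :: nat assume "admissible k s d e X \<and> (n = 0 \<longrightarrow> X = single_word w0)"
    then show "\<exists>Y. (admissible k s d e Y \<and> (Suc n = 0 \<longrightarrow> Y = single_word w0)) \<and> rewrite_top k X Y"
      using rewrite_top_exists[OF k] by auto
  qed
  then obtain X where adm: "\<And>n. admissible k s d e (X n)" and X0: "X 0 = single_word w0"
    and top: "\<And>n. rewrite_top k (X n) (X (Suc n))" by blast
  have stable_step: "X (Suc n) v = X n v" if "\<forall>w\<in>disordered k (X n). energy w < B" "B \<le> energy v" for n v B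
    using top[of n] that unfolding rewrite_top_def by (metis less_le_not_le order.trans less_imp_le)
  \<comment> \<open>The disordered words are cleared level by level: after finitely many steps none
    of the top j levels e, e - 1, ... contains one.\<close>
  have "\<exists>n0. \<forall>n\<ge>n0. \<forall>w\<in>disordered k (X n). energy w < e + 1 - int j" for j
  proof (induction j)
    case 0
    have "energy w < e + 1" if "w \<in> disordered k (X n)" for n w
      using admissibleD(1)[OF adm[of n], of w] that by (auto simp: disordered_def)
    then show ?case by auto
  next
    case (Suc j)
    then obtain n0 where n0: "\<And>n w. n \<ge> n0 \<Longrightarrow> w \<in> disordered k (X n) \<Longrightarrow> energy w < e + 1 - int j" by blast
    define b where "b = e - int j"
    \<comment> \<open>Once the levels above b are clear, a step removes one word from this finite
      set as long as it is nonempty, and can add none, because new words have lower energy.\<close>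
    define S where "S = (\<lambda>n. {w \<in> disordered k (X n). energy w = b})"
    have fin: "finite (S n)" for n
      by (rule finite_subset[OF _ admissibleD(2)[OF adm[of n], of b]]) (auto simp: disordered_def S_def)
    have dec: "card (S (Suc n)) \<le> card (S n) - 1" if n: "n \<ge> n0" for n
    proof (cases "disordered k (X n) = {}")
      case True
      then have "S (Suc n) = {}" using top[of n] by (auto simp: rewrite_top_def S_def)
      then show ?thesis by simp
    next
      case False
      then obtain w where w: "w \<in> disordered k (X n)" "\<forall>v\<in>disordered k (X n). energy v \<le> energy w" "X (Suc n) w = 0"
        "\<forall>v. v \<noteq> w \<longrightarrow> energy w \<le> energy v \<longrightarrow> X (Suc n) v = X n v"
        using top[of n] unfolding rewrite_top_def by blast
      have wb: "energy w \<le> b" using n0[OF n w(1)] by (simp add: b_def)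
      have sub: "S (Suc n) \<subseteq> S n - {w}"
      proof
        fix v assume v: "v \<in> S (Suc n)"
        then have "v \<noteq> w" using w(3) by (auto simp: S_def disordered_def)
        moreover from this have "X (Suc n) v = X n v" using v w(4) wb by (auto simp: S_def)
        ultimately show "v \<in> S n - {w}" using v by (auto simp: S_def disordered_def)
      qed
      show ?thesis
      proof (cases "energy w = b")
        case True
        then have "w \<in> S n" using w(1) by (simp add: S_def)
        then show ?thesis using card_mono[OF _ sub] fin[of n] by simp
      next
        case False
        then have "S n = {}" using w(2) wb by (auto simp: S_def)
        then show ?thesis using sub by simp
      qed
    qed
    have "card (S (n0 + i)) \<le> card (S n0) - i" for i
    proof (induction i)
      case (Suc i)
      then show ?case using dec[of "n0 + i"] by simp
    qed simp
    then have card0: "card (S n) = 0" if "n \<ge> n0 + card (S n0)" for n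
      using that by (metis add_leD1 diff_is_0_eq le_add_diff_inverse le_zero_eq nat_add_left_cancel_le)
    have empty: "S n = {}" if "n \<ge> n0 + card (S n0)" for n
      using card0[OF that] fin[of n] by (simp only: card_0_eq)
    have "energy w < e + 1 - int (Suc j)" if n: "n \<ge> n0 + card (S n0)" and w: "w \<in> disordered k (X n)" for n w
    proof -
      have "energy w \<noteq> b" using empty[OF n] w by (auto simp: S_def)
      then show ?thesis using n0[of n w] n w by (simp add: b_def)
    qed
    then show ?case by blast
  qed
  then have "\<exists>n0. \<forall>n\<ge>n0. \<forall>w\<in>disordered k (X n). energy w < B" for B
  proof -
    assume a: "\<And>j. \<exists>n0. \<forall>n\<ge>n0. \<forall>w\<in>disordered k (X n). energy w < e + 1 - int j"
    obtain n0 where "\<forall>n\<ge>n0. \<forall>w\<in>disordered k (X n). energy w < e + 1 - int (nat (e + 1 - B))" using a by blast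
    moreover have "\<forall>n. \<forall>w\<in>disordered k (X n). energy w < e + 1"
      using admissibleD(1)[OF adm] by (auto simp: disordered_def)
    ultimately have "\<forall>n\<ge>n0. \<forall>w\<in>disordered k (X n). energy w < B"
      by (cases "B \<le> e + 1") (auto, force)
    then show ?thesis by blast
  qed
  then obtain n0 where n0: "\<And>B n w. n \<ge> n0 B \<Longrightarrow> w \<in> disordered k (X n) \<Longrightarrow> energy w < B" by metis
  have stable: "X n v = X (n0 B) v" if "n \<ge> n0 B" "B \<le> energy v" for n v B
    using that(1)
  proof (induction n rule: dec_induct)
    case (step n)
    then show ?case using stable_step[of n B v] n0[of B n] that(2) by simp
  qed simp
  \<comment> \<open>At stage \<open>n0 (energy w)\<close> every disordered word has energy below
    that of w. So the coefficient of w is final, and w is normal-ordered if it is nonzero.\<close>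
  define G where "G = (\<lambda>w. X (n0 (energy w)) w)"
  have G: "X n v = G v" if "n \<ge> n0 B" "B \<le> energy v" for n v B
  proof -
    have "X n v = X (max n (n0 (energy v))) v"
      using stable[OF that] stable[of B "max n (n0 (energy v))" v] that by simp
    then show ?thesis using stable[of "energy v" "max n (n0 (energy v))" v] by (simp add: G_def)
  qed
  have G_adm: "set w \<subseteq> gens k \<and> length w = s \<and> degree_sum w = d" if "G w \<noteq> 0" for w
    using admissibleD(1)[OF adm, of "n0 (energy w)" w] that by (simp add: G_def)
  have G_normal: "normal_ordered k w" if "G w \<noteq> 0" for w
    using that n0[of "energy w" "n0 (energy w)" w] by (auto simp: G_def disordered_def)
  have lim: "\<exists>n1. \<forall>n\<ge>n1. \<forall>w. (\<forall>x\<in>set w. snd x \<le> N) \<longrightarrow> X n w = G w" for N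
  proof -
    obtain B where B: "\<And>w. set w \<subseteq> gens k \<and> length w = s \<and> degree_sum w = d \<and> (\<forall>x\<in>set w. snd x \<le> N) \<Longrightarrow> B \<le> energy w"
      using energy_lower_bound[of k s d N] by blast
    have "X n w = G w" if "n \<ge> n0 B" "\<forall>x\<in>set w. snd x \<le> N" for n w
    proof (cases "set w \<subseteq> gens k \<and> length w = s \<and> degree_sum w = d")
      case True
      then show ?thesis using G[OF that(1), of w] B[of w] that(2) by blast
    next
      case False
      then have "X n w = 0" "G w = 0" using admissibleD(1)[OF adm, of n w] G_adm[of w] by blast+
      then show ?thesis by simp
    qed
    then show ?thesis by blast
  qed
  have ws: "G \<in> word_series k"
  proof -
    have "finite {w. G w \<noteq> 0 \<and> (\<forall>x\<in>set w. snd x \<le> N)}" for N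
    proof -
      obtain B where B: "\<And>w. set w \<subseteq> gens k \<and> length w = s \<and> degree_sum w = d \<and> (\<forall>x\<in>set w. snd x \<le> N) \<Longrightarrow> B \<le> energy w"
        using energy_lower_bound[of k s d N] by blast
      obtain n where n: "\<forall>w. (\<forall>x\<in>set w. snd x \<le> N) \<longrightarrow> X n w = G w" using lim[of N] by blast
      have "{w. G w \<noteq> 0 \<and> (\<forall>x\<in>set w. snd x \<le> N)} \<subseteq> {w. X n w \<noteq> 0 \<and> B \<le> energy w}"
        using n B G_adm by auto
      then show ?thesis using admissibleD(2)[OF adm] by (rule finite_subset)
    qed
    moreover have "\<exists>s. \<forall>w. G w \<noteq> 0 \<longrightarrow> length w \<le> s" using G_adm by (intro exI[of _ s]) simp
    ultimately show ?thesis using G_adm unfolding word_series_def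
      by (intro CollectI conjI allI impI) auto
  qed
  then have ns: "G \<in> normal_series k" using G_normal by (simp add: normal_series_def)
  have "rewrites_to k (single_word w0) G"
    unfolding rewrites_to_def
  proof (intro exI[of _ X] conjI allI)
    show "X (Suc n) = X n \<or> rewrite_step k (X n) (X (Suc n))" for n
      using top[of n] by (auto simp: rewrite_top_def)
  qed (use X0 lim in auto)
  moreover have "R_class k (word_prod k w0) = R_class k (series_sum k G)"
  proof (rule R_class_eqI)
    \<comment> \<open>Every finite stage stays congruent modulo the algebraic ideal; only the
      passage to the limit uses its closure.\<close>
    have diff: "(\<lambda>M. word_prod k w0 M - series_sum k (X n) M) \<in> Idl\<^bsub>Bbar k\<^esub> (Q2 k)" for n
    proof (induction n)
      case 0
      then show ?case using Idl_Q2_zero by (simp add: X0 series_sum_single)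
    next
      case (Suc n)
      have "(\<lambda>M. series_sum k (X n) M - series_sum k (X (Suc n)) M) \<in> Idl\<^bsub>Bbar k\<^esub> (Q2 k)"
        using top[of n] Idl_Q2_zero by (auto simp: rewrite_top_def)
      from Idl_Q2_add[OF Suc this] show ?case by simp
    qed
    interpret ring "Bbar k" by (rule ring_Bbar)
    have "word_prod k w0 \<oplus>\<^bsub>Bbar k\<^esub> (\<lambda>M. (-1) * series_sum k G M) \<in> carrier (Bbar k)"
      by (intro a_closed word_prod_carrier carrier_scale series_sum_carrier ws)
    then have "(\<lambda>M. word_prod k w0 M - series_sum k G M) \<in> carrier (Bbar k)" by (simp add: Bbar_add)
    moreover have "\<exists>H\<in>Idl\<^bsub>Bbar k\<^esub> (Q2 k). \<forall>M. (\<forall>x\<in>#M. snd x \<le> N) \<longrightarrow> word_prod k w0 M - series_sum k G M = H M" for N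
    proof -
      obtain n where n: "\<forall>w. (\<forall>x\<in>set w. snd x \<le> N) \<longrightarrow> X n w = G w" using lim[of N] by blast
      have "series_sum k G M = series_sum k (X n) M" if "\<forall>x\<in>#M. snd x \<le> N" for M
        unfolding series_sum_def using n that by (intro sum.cong) auto
      then show ?thesis by (intro bexI[OF _ diff[of n]]) auto
    qed
    ultimately show "(\<lambda>M. word_prod k w0 M - series_sum k G M) \<in> rel_ideal k"
      by (simp add: rel_ideal_def adic_closure_def)
  qed
  ultimately show ?thesis using ns by blast
qed

section \<open>Functionals given by skew functions\<close>

text \<open>The sum runs over the support of f, not over that of F, so a finitely supported f can be
  applied to infinite elements of the completion.\<close>

definition fpair :: "(gen list \<Rightarrow> complex) \<Rightarrow> (gen multiset \<Rightarrow> complex) \<Rightarrow> complex" where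
  "fpair f F = (\<Sum>M | f (sorted_list_of_multiset M) \<noteq> 0. F M * f (sorted_list_of_multiset M))"

lemma finite_msupp:
  assumes "finite {w. f w \<noteq> (0 :: complex)}"
  shows "finite {M. f (sorted_list_of_multiset M) \<noteq> 0}"
proof (rule finite_subset)
  show "{M. f (sorted_list_of_multiset M) \<noteq> 0} \<subseteq> mset ` {w. f w \<noteq> 0}"
  proof
    fix M assume "M \<in> {M. f (sorted_list_of_multiset M) \<noteq> 0}"
    then show "M \<in> mset ` {w. f w \<noteq> 0}" by (intro image_eqI[of _ _ "sorted_list_of_multiset M"]) auto
  qed
qed (use assms in simp)

lemma fpair_superset:
  assumes "finite S" "{M. f (sorted_list_of_multiset M) \<noteq> 0} \<subseteq> S"
  shows "fpair f F = (\<Sum>M\<in>S. F M * f (sorted_list_of_multiset M))"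
  unfolding fpair_def by (rule sum.mono_neutral_left) (use assms in auto)

lemma fpair_add: "fpair f (\<lambda>M. F M + G M) = fpair f F + fpair f G"
  by (simp add: fpair_def distrib_right sum.distrib)

lemma fpair_scale: "fpair f (\<lambda>M. c * F M) = c * fpair f F"
  by (simp add: fpair_def sum_distrib_left mult.assoc)

lemma finite_splits:
  fixes f :: "'a :: linorder list \<Rightarrow> complex"
  assumes "finite {w. f w \<noteq> 0}"
  shows "finite {(A, B). f (sorted_list_of_multiset A @ sorted_list_of_multiset B) \<noteq> 0}"
proof (rule finite_subset)
  let ?W = "{w. f w \<noteq> 0}"
  show "{(A, B). f (sorted_list_of_multiset A @ sorted_list_of_multiset B) \<noteq> 0}
      \<subseteq> (\<Union>w\<in>?W. (\<lambda>i. (mset (take i w), mset (drop i w))) ` {..length w})"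
  proof clarify
    fix A B :: "'a multiset"
    let ?w = "sorted_list_of_multiset A @ sorted_list_of_multiset B"
    assume "f ?w \<noteq> 0"
    moreover have len: "length (sorted_list_of_multiset A) = size A"
      by (metis mset_sorted_list_of_multiset size_mset)
    then have "(A, B) = (mset (take (size A) ?w), mset (drop (size A) ?w))" by simp
    moreover have "size A \<le> length ?w" using len by simp
    ultimately show "(A, B) \<in> (\<Union>w\<in>?W. (\<lambda>i. (mset (take i w), mset (drop i w))) ` {..length w})"
      by blast
  qed
qed (use assms in simp)

lemma fpair_mult:
  assumes f: "skew k f" and fin: "finite {w. f w \<noteq> 0}"
    and F: "F \<in> carrier (Bbar k)" and G: "G \<in> carrier (Bbar k)"
  shows "fpair f (F \<otimes>\<^bsub>Bbar k\<^esub> G) =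
    (\<Sum>(A, B) | f (sorted_list_of_multiset A @ sorted_list_of_multiset B) \<noteq> 0.
       F A * G B * f (sorted_list_of_multiset A @ sorted_list_of_multiset B))"
proof -
  let ?sl = "sorted_list_of_multiset :: gen multiset \<Rightarrow> gen list"
  define S where "S = {M \<in> basis_monos k. f (?sl M) \<noteq> 0}"
  have finS: "finite S" using finite_msupp[OF fin] by (rule finite_subset[rotated]) (auto simp: S_def)
  have "fpair f (F \<otimes>\<^bsub>Bbar k\<^esub> G) = (\<Sum>M\<in>S. (F \<otimes>\<^bsub>Bbar k\<^esub> G) M * f (?sl M))"
    unfolding fpair_def by (rule sum.mono_neutral_right) (auto simp: S_def finite_msupp[OF fin] Bbar_mult)
  also have "\<dots> = (\<Sum>M\<in>S. \<Sum>A | A \<subseteq># M. F A * G (M - A) * f (?sl A @ ?sl (M - A)))"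
  proof (rule sum.cong)
    fix M assume M: "M \<in> S"
    have e: "(-1) ^ (k * inversions A (M - A)) * F A * G (M - A) * f (?sl M)
        = F A * G (M - A) * f (?sl A @ ?sl (M - A))" if "A \<subseteq># M" for A
      using skew_merge[OF f, of A "M - A"] M that by (simp add: S_def)
    have "(F \<otimes>\<^bsub>Bbar k\<^esub> G) M * f (?sl M)
        = (\<Sum>A | A \<subseteq># M. (-1) ^ (k * inversions A (M - A)) * F A * G (M - A) * f (?sl M))"
      using M by (simp add: Bbar_mult S_def sum_distrib_right)
    also have "\<dots> = (\<Sum>A | A \<subseteq># M. F A * G (M - A) * f (?sl A @ ?sl (M - A)))"
      by (rule sum.cong) (simp_all only: mem_Collect_eq e)
    finally show "(F \<otimes>\<^bsub>Bbar k\<^esub> G) M * f (?sl M) = (\<Sum>A | A \<subseteq># M. F A * G (M - A) * f (?sl A @ ?sl (M - A)))" .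
  qed simp
  also have "\<dots> = (\<Sum>(M, A)\<in>(SIGMA M:S. {A. A \<subseteq># M}). F A * G (M - A) * f (?sl A @ ?sl (M - A)))"
    by (rule sum.Sigma) (simp_all add: finS finite_submultisets)
  also have "\<dots> = (\<Sum>(A, B) | A + B \<in> S. F A * G B * f (?sl A @ ?sl B))"
    by (rule sum.reindex_bij_witness[of _ "\<lambda>(A, B). (A + B, A)" "\<lambda>(M, A). (A, M - A)"]) auto
  also have "\<dots> = (\<Sum>(A, B) | f (?sl A @ ?sl B) \<noteq> 0. F A * G B * f (?sl A @ ?sl B))"
  proof (rule sum.mono_neutral_cong)
    show "finite {(A, B). f (?sl A @ ?sl B) \<noteq> 0}" by (rule finite_splits[OF fin])
    show "finite {(A, B). A + B \<in> S}"
    proof (rule finite_subset)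
      show "{(A, B). A + B \<in> S} \<subseteq> (\<lambda>(M, A). (A, M - A)) ` (SIGMA M:S. {A. A \<subseteq># M})"
      proof clarify
        fix A B assume "A + B \<in> S"
        then show "(A, B) \<in> (\<lambda>(M, A). (A, M - A)) ` (SIGMA M:S. {A. A \<subseteq># M})"
          by (intro image_eqI[of _ _ "(A + B, A)"]) auto
      qed
    qed (simp add: finS finite_submultisets)
  next
    fix p assume "p \<in> {(A, B). f (?sl A @ ?sl B) \<noteq> 0} - {(A, B). A + B \<in> S}"
    then obtain A B where p: "p = (A, B)" "f (?sl A @ ?sl B) \<noteq> 0" "A + B \<notin> S" by auto
    \<comment> \<open>If both were nonzero, all letters would be generators, and f \<noteq> 0 on the
      joined word would exclude repetitions for odd k. Then A + B would be a basis monomial, and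
      \<open>skew_merge\<close> would put it in S.\<close>
    have "F A = 0 \<or> G B = 0"
    proof (rule ccontr)
      assume nz: "\<not> (F A = 0 \<or> G B = 0)"
      then have "A \<in> basis_monos k" "B \<in> basis_monos k" using F G carrier_basis by blast+
      then have g: "set (?sl A @ ?sl B) \<subseteq> gens k" by (auto simp: basis_monos_def)
      have "A + B \<in> basis_monos k" using skew_repeated[OF f g] p(2) by auto
      then show False using skew_merge[OF f, of A B] p by (auto simp: S_def)
    qed
    then show "(case p of (A, B) \<Rightarrow> F A * G B * f (?sl A @ ?sl B)) = 0" using p by auto
  qed auto
  finally show ?thesis .
qed

text \<open>For each first factor A what acts on G is f with a prefix inserted. Vanishing in all
  contexts is thus stable under multiplication, which is the reason for the u and v in
  \<open>annihilator\<close>.\<close>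

lemma fpair_mult_left_zero:
  assumes f: "skew k f" and fin: "finite {w. f w \<noteq> 0}"
    and F: "F \<in> carrier (Bbar k)" and G: "G \<in> carrier (Bbar k)"
    and z: "\<And>u. fpair (\<lambda>v. f (u @ v)) G = 0"
  shows "fpair f (F \<otimes>\<^bsub>Bbar k\<^esub> G) = 0"
proof -
  let ?sl = "sorted_list_of_multiset :: gen multiset \<Rightarrow> gen list"
  let ?P = "{(A, B). f (?sl A @ ?sl B) \<noteq> 0}"
  have finP: "finite ?P" by (rule finite_splits[OF fin])
  have "fpair f (F \<otimes>\<^bsub>Bbar k\<^esub> G) = (\<Sum>(A, B)\<in>fst ` ?P \<times> snd ` ?P. F A * G B * f (?sl A @ ?sl B))"
    unfolding fpair_mult[OF f fin F G]
    by (rule sum.mono_neutral_left) (use finP in \<open>force+\<close>)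
  also have "\<dots> = (\<Sum>A\<in>fst ` ?P. F A * (\<Sum>B\<in>snd ` ?P. G B * f (?sl A @ ?sl B)))"
    by (simp add: sum.cartesian_product[symmetric] sum_distrib_left mult.assoc)
  also have "\<dots> = (\<Sum>A\<in>fst ` ?P. F A * fpair (\<lambda>v. f (?sl A @ v)) G)"
    by (intro sum.cong refl arg_cong2[of _ _ _ _ "(*)"] fpair_superset[symmetric]) (use finP in \<open>force+\<close>)
  finally show ?thesis using z by simp
qed

lemma fpair_mult_right_zero:
  assumes f: "skew k f" and fin: "finite {w. f w \<noteq> 0}"
    and F: "F \<in> carrier (Bbar k)" and G: "G \<in> carrier (Bbar k)"
    and z: "\<And>v. fpair (\<lambda>u. f (u @ v)) F = 0"
  shows "fpair f (F \<otimes>\<^bsub>Bbar k\<^esub> G) = 0"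
proof -
  let ?sl = "sorted_list_of_multiset :: gen multiset \<Rightarrow> gen list"
  let ?P = "{(A, B). f (?sl A @ ?sl B) \<noteq> 0}"
  have finP: "finite ?P" by (rule finite_splits[OF fin])
  have "fpair f (F \<otimes>\<^bsub>Bbar k\<^esub> G) = (\<Sum>(A, B)\<in>fst ` ?P \<times> snd ` ?P. F A * G B * f (?sl A @ ?sl B))"
    unfolding fpair_mult[OF f fin F G]
    by (rule sum.mono_neutral_left) (use finP in \<open>force+\<close>)
  also have "\<dots> = (\<Sum>A\<in>fst ` ?P. \<Sum>B\<in>snd ` ?P. F A * G B * f (?sl A @ ?sl B))"
    by (simp add: sum.cartesian_product)
  also have "\<dots> = (\<Sum>B\<in>snd ` ?P. \<Sum>A\<in>fst ` ?P. F A * G B * f (?sl A @ ?sl B))"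
    by (rule sum.swap)
  also have "\<dots> = (\<Sum>B\<in>snd ` ?P. G B * (\<Sum>A\<in>fst ` ?P. F A * f (?sl A @ ?sl B)))"
    by (simp add: sum_distrib_left ac_simps)
  also have "\<dots> = (\<Sum>B\<in>snd ` ?P. G B * fpair (\<lambda>u. f (u @ ?sl B)) F)"
    by (intro sum.cong refl arg_cong2[of _ _ _ _ "(*)"] fpair_superset[symmetric]) (use finP in \<open>force+\<close>)
  finally show ?thesis using z by simp
qed

lemma fpair_series:
  assumes f: "skew k f" and fin: "finite {w. f w \<noteq> 0}" and G: "\<And>w. G w \<noteq> 0 \<Longrightarrow> set w \<subseteq> gens k"
  shows "fpair f (series_sum k G) = (\<Sum>w | f w \<noteq> 0. G w * f w)"
proof -
  let ?S = "mset ` {w. f w \<noteq> 0}"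
  have "fpair f (series_sum k G) = (\<Sum>M\<in>?S. series_sum k G M * f (sorted_list_of_multiset M))"
  proof (rule fpair_superset)
    show "{M. f (sorted_list_of_multiset M) \<noteq> 0} \<subseteq> ?S"
    proof
      fix M assume "M \<in> {M. f (sorted_list_of_multiset M) \<noteq> 0}"
      then show "M \<in> ?S" by (intro image_eqI[of _ _ "sorted_list_of_multiset M"]) auto
    qed
  qed (use fin in simp)
  also have "\<dots> = (\<Sum>M\<in>?S. \<Sum>w | mset w = M. G w * f w)"
  proof (rule sum.cong)
    fix M
    have e: "G w * word_prod k w M * f (sorted_list_of_multiset M) = G w * f w" if "mset w = M" for w
      using skew_sorted[OF f G[of w]] that by (cases "G w = 0") auto
    show "series_sum k G M * f (sorted_list_of_multiset M) = (\<Sum>w | mset w = M. G w * f w)"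
      unfolding series_sum_def sum_distrib_right by (rule sum.cong) (simp_all only: mem_Collect_eq e)
  qed simp
  also have "\<dots> = (\<Sum>(M, w)\<in>(SIGMA M:?S. {w. mset w = M}). G w * f w)"
    by (rule sum.Sigma) (use fin in \<open>auto simp: finite_mset_eq\<close>)
  also have "\<dots> = (\<Sum>w | mset w \<in> ?S. G w * f w)"
    by (rule sum.reindex_bij_witness[of _ "\<lambda>w. (mset w, w)" snd]) auto
  also have "\<dots> = (\<Sum>w | f w \<noteq> 0. G w * f w)"
  proof (rule sum.mono_neutral_right)
    have "{w. mset w \<in> ?S} = (\<Union>M\<in>?S. {w. mset w = M})" by blast
    then show "finite {w. mset w \<in> ?S}" using fin by (simp only:) (intro finite_UN_I; simp add: finite_mset_eq)
  qed auto
  finally show ?thesis .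
qed

section \<open>Finite differences\<close>

text \<open>Degree less than n, phrased as the vanishing of n-fold differences with arbitrary steps;
  this is the form in which sums over subsets use it.\<close>

fun degree_less :: "nat \<Rightarrow> (int \<Rightarrow> complex) \<Rightarrow> bool" where
  "degree_less 0 f \<longleftrightarrow> (\<forall>x. f x = 0)"
| "degree_less (Suc n) f \<longleftrightarrow> (\<forall>h. degree_less n (\<lambda>x. f (x + h) - f x))"

lemma degree_less_add: "degree_less n f \<Longrightarrow> degree_less n g \<Longrightarrow> degree_less n (\<lambda>x. f x + g x)"
proof (induction n arbitrary: f g)
  case (Suc n)
  have "degree_less n (\<lambda>x. (f (x + h) - f x) + (g (x + h) - g x))" for h
    using Suc by (intro Suc.IH) auto
  then show ?case by (simp add: algebra_simps)
qed simp

lemma degree_less_scale: "degree_less n f \<Longrightarrow> degree_less n (\<lambda>x. c * f x)"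
  by (induction n arbitrary: f) (simp_all flip: right_diff_distrib)

lemma degree_less_shift: "degree_less n f \<Longrightarrow> degree_less n (\<lambda>x. f (x + c))"
proof (induction n arbitrary: f)
  case (Suc n)
  have "degree_less n (\<lambda>x. f (x + c + h) - f (x + c))" for h
    using Suc.IH[of "\<lambda>x. f (x + h) - f x"] Suc.prems by simp
  then show ?case by (simp add: ac_simps)
qed simp

lemma degree_less_reflect: "degree_less n f \<Longrightarrow> degree_less n (\<lambda>x. f (c - x))"
proof (induction n arbitrary: f)
  case (Suc n)
  have "degree_less n (\<lambda>x. f (c - x + - h) - f (c - x))" for h
    using Suc.IH[of "\<lambda>x. f (x + - h) - f x"] Suc.prems unfolding degree_less.simps by blast
  then show ?case by (simp add: algebra_simps)
qed simp

lemma degree_less_Suc: "degree_less n f \<Longrightarrow> degree_less (Suc n) f"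
  by (induction n arbitrary: f) auto

lemma degree_less_mult_linear:
  "degree_less n f \<Longrightarrow> degree_less (Suc n) (\<lambda>x. of_int (a * x + b) * f x)"
proof (induction n arbitrary: f)
  case (Suc n)
  have "degree_less (Suc n) (\<lambda>x. of_int (a * (x + h) + b) * f (x + h) - of_int (a * x + b) * f x)" for h
  proof -
    have "degree_less (Suc n) (\<lambda>x. of_int (a * x + b) * (f (x + h) - f x) + of_int (a * h) * f (x + h))"
      using Suc.prems by (intro degree_less_add Suc.IH degree_less_scale degree_less_shift) auto
    then show ?thesis by (simp add: algebra_simps)
  qed
  then show ?case unfolding degree_less.simps(2)[of "Suc n"] by blast
qed simp

lemma degree_less_deriv_coeff: "degree_less (Suc m) (deriv_coeff m)"
proof (induction m)
  case 0
  then show ?case by (simp add: deriv_coeff_def)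
next
  case (Suc m)
  have "deriv_coeff (Suc m) = (\<lambda>x. of_int (- 1 * x + - int m) * deriv_coeff m x)"
    by (simp add: deriv_coeff_def fun_eq_iff)
  then show ?case using degree_less_mult_linear[OF Suc, of "-1" "- int m"] by simp
qed

lemma sum_Pow_insert:
  fixes f :: "'a set \<Rightarrow> complex"
  assumes "finite A" "a \<notin> A"
  shows "(\<Sum>S\<in>Pow (insert a A). f S) = (\<Sum>S\<in>Pow A. f S + f (insert a S))"
proof -
  have "(\<Sum>S\<in>Pow (insert a A). f S) = (\<Sum>S\<in>Pow A. f S) + (\<Sum>S\<in>insert a ` Pow A. f S)"
    unfolding Pow_insert by (rule sum.union_disjoint) (use assms in auto)
  moreover have "inj_on (insert a) (Pow A)"
    by (rule inj_onI) (metis Pow_iff assms(2) insert_ident subsetD)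
  then have "(\<Sum>S\<in>insert a ` Pow A. f S) = (\<Sum>S\<in>Pow A. f (insert a S))"
    by (simp add: sum.reindex)
  ultimately show ?thesis by (simp add: sum.distrib)
qed

text \<open>Up to sign the sum is the iterated difference of f with one step for each element of
  A.\<close>

lemma alternating_sum_zero:
  assumes "finite A" "degree_less (card A) f"
  shows "(\<Sum>S\<in>Pow A. (-1) ^ card S * f (c + (\<Sum>i\<in>S. \<delta> i))) = 0"
  using assms
proof (induction A arbitrary: f rule: finite_induct)
  case (insert a A)
  let ?D = "\<lambda>x. f (x + \<delta> a) - f x"
  have "(-1) ^ card S * f (c + (\<Sum>i\<in>S. \<delta> i)) + (-1) ^ card (insert a S) * f (c + (\<Sum>i\<in>insert a S. \<delta> i))
      = - ((-1) ^ card S * ?D (c + (\<Sum>i\<in>S. \<delta> i)))" if S: "S \<in> Pow A" for S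
  proof -
    have "a \<notin> S" "finite S" using S insert.hyps finite_subset by auto
    then show ?thesis by (simp add: algebra_simps)
  qed
  then have "(\<Sum>S\<in>Pow (insert a A). (-1) ^ card S * f (c + (\<Sum>i\<in>S. \<delta> i)))
      = (\<Sum>S\<in>Pow A. - ((-1) ^ card S * ?D (c + (\<Sum>i\<in>S. \<delta> i))))"
    using insert.hyps by (simp add: sum_Pow_insert)
  also have "\<dots> = - (\<Sum>S\<in>Pow A. (-1) ^ card S * ?D (c + (\<Sum>i\<in>S. \<delta> i)))"
    by (rule sum_negf)
  also have "\<dots> = 0" using insert.IH[of ?D] insert.prems insert.hyps by simp
  finally show ?case .
qed simp

section \<open>Rows of fermionic positions\<close>

text \<open>The integer p encodes the level-one generator with index \<open>p mod 2\<close> and mode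
  \<open>(p + 1) div 2\<close>; the natural order of the integers is then the normal order for \<open>k = 1\<close>.
  A row of k such positions contributes to the level-k generator whose index and mode are the sums.\<close>

definition row :: "nat \<Rightarrow> (nat \<Rightarrow> int) \<Rightarrow> gen" where
  "row k r = ((\<Sum>i<k. nat (r i mod 2)), (\<Sum>i<k. (r i + 1) div 2))"

lemma row_cong: "(\<And>i. i < k \<Longrightarrow> r i = r' i) \<Longrightarrow> row k r = row k r'"
  by (simp add: row_def)

lemma row_gens: "row k r \<in> gens k"
proof -
  have "(\<Sum>i<k. nat (r i mod 2)) \<le> (\<Sum>i<k. 1)" by (rule sum_mono) (simp add: nat_le_iff)
  then show ?thesis by (simp add: row_def gens_iff)
qed

lemma pos_row: "pos (row k r) = (\<Sum>i<k. r i)"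
proof -
  have "2 * ((p + 1) div 2) - p mod 2 = p" for p :: int by presburger
  then have "(\<Sum>i<k. r i) = (\<Sum>i<k. 2 * ((r i + 1) div 2) - r i mod 2)" by simp
  also have "\<dots> = pos (row k r)"
    by (simp add: pos_def row_def sum_subtractf sum_distrib_left)
  finally show ?thesis by simp
qed

lemma row_update:
  assumes "i < k"
  shows "fst (row k (r(i := z))) + nat (r i mod 2) = fst (row k r) + nat (z mod 2)"
    "snd (row k (r(i := z))) + (r i + 1) div 2 = snd (row k r) + (z + 1) div 2"
  using assms sum.remove[of "{..<k}" i "\<lambda>i. nat (r i mod 2)"] sum.remove[of "{..<k}" i "\<lambda>i. (r i + 1) div 2"]
    sum.remove[of "{..<k}" i "\<lambda>j. nat ((r(i := z)) j mod 2)"] sum.remove[of "{..<k}" i "\<lambda>j. ((r(i := z)) j + 1) div 2"]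
  by (simp_all add: row_def)

text \<open>\<open>pos_coeff\<close> and \<open>pos_pred\<close> are \<open>pred_coeff\<close> and
  \<open>act_pred\<close> for k = 1, written in the encoding p = 2 * n - a.\<close>

fun pos_coeff :: "chevalley \<Rightarrow> int \<Rightarrow> complex" where
  "pos_coeff E0 p = (if odd p then 1 else 0)"
| "pos_coeff F1 p = (if odd p then 1 else 0)"
| "pos_coeff E1 p = (if even p then 1 else 0)"
| "pos_coeff F0 p = (if even p then 1 else 0)"
| "pos_coeff H0 p = (if even p then -1 else 1)"
| "pos_coeff H1 p = (if even p then 1 else -1)"

fun pos_pred :: "chevalley \<Rightarrow> int \<Rightarrow> int" where
  "pos_pred E0 p = p - 1"
| "pos_pred F1 p = p + 1"
| "pos_pred E1 p = p - 1"
| "pos_pred F0 p = p + 1"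
| "pos_pred H0 p = p"
| "pos_pred H1 p = p"

lemma row_act_pred:
  assumes "i < k" "pos_coeff g (r i) \<noteq> 0"
  shows "row k (r(i := pos_pred g (r i))) = act_pred g (row k r)"
proof -
  obtain a m where am: "row k r = (a, m)" by fastforce
  show ?thesis
  proof (cases "g = H0 \<or> g = H1")
    case True
    then show ?thesis using am by auto
  next
    case False
    have e: "even p \<Longrightarrow> nat (p mod 2) = 0" "odd p \<Longrightarrow> nat (p mod 2) = 1" for p :: int
      by (auto simp: even_iff_mod_2_eq_zero odd_iff_mod_2_eq_one)
    have d: "odd p \<Longrightarrow> (p + 1) div 2 = (p - 1) div 2 + 1" "odd p \<Longrightarrow> (p + 1 + 1) div 2 = (p + 1) div 2"
      "even p \<Longrightarrow> (p + 1) div 2 = (p - 1 + 1) div 2" "even p \<Longrightarrow> (p + 1 + 1) div 2 = (p + 1) div 2 + 1" for p :: int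
      by presburger+
    show ?thesis
      using False assms(2) row_update[OF assms(1), of r "pos_pred g (r i)"] am
      by (cases g) (auto intro!: prod_eqI simp: e d split: if_splits)
  qed
qed

lemma sum_pos_coeff: "(\<Sum>i<k. pos_coeff g (r i)) = pred_coeff k g (row k r)"
proof -
  have o: "(\<Sum>i<k. if odd (r i) then 1 else 0 :: complex) = of_nat (fst (row k r))"
    unfolding row_def fst_conv of_nat_sum
    by (intro sum.cong) (auto simp: even_iff_mod_2_eq_zero odd_iff_mod_2_eq_one)
  have "(\<Sum>i<k. if even (r i) then 1 else 0 :: complex) = (\<Sum>i<k. 1 - (if odd (r i) then 1 else 0))"
    by (intro sum.cong) auto
  then have e: "(\<Sum>i<k. if even (r i) then 1 else 0 :: complex) = of_nat k - of_nat (fst (row k r))"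
    using o by (simp add: sum_subtractf)
  have h: "(\<Sum>i<k. if even (r i) then 1 else -1 :: complex) = of_nat k - 2 * of_nat (fst (row k r))"
  proof -
    have "(\<Sum>i<k. if even (r i) then 1 else -1 :: complex) = (\<Sum>i<k. 1 - 2 * (if odd (r i) then 1 else 0))"
      by (intro sum.cong) auto
    also have "\<dots> = of_nat k - 2 * of_nat (fst (row k r))"
      using o by (simp add: sum_subtractf flip: sum_distrib_left)
    finally show ?thesis .
  qed
  have h': "(\<Sum>i<k. if even (r i) then -1 else 1 :: complex) = - (of_nat k - 2 * of_nat (fst (row k r)))"
    unfolding h[symmetric] sum_negf[symmetric] by (intro sum.cong) auto
  obtain a m where am: "row k r = (a, m)" by fastforce
  have "a \<le> k" using row_gens[of k r] am by (simp add: gens_iff)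
  then show ?thesis using o e h h' am by (cases g) (simp_all add: of_nat_diff)
qed

text \<open>The level-k currents behave like symmetric tensors in the k-fold power of level one: an
  admissible change of a single entry changes the row as \<open>act_pred\<close> prescribes, and the
  level-one coefficients add up to \<open>pred_coeff\<close>.\<close>

lemma row_pred_sum:
  "pred_coeff k g (row k r) * H (act_pred g (row k r))
    = (\<Sum>i<k. pos_coeff g (r i) * H (row k (r(i := pos_pred g (r i)))))"
proof -
  have "(\<Sum>i<k. pos_coeff g (r i) * H (row k (r(i := pos_pred g (r i)))))
      = (\<Sum>i<k. pos_coeff g (r i) * H (act_pred g (row k r)))"
    using row_act_pred[of _ k g r] by (intro sum.cong) force+
  then show ?thesis by (simp add: sum_pos_coeff flip: sum_distrib_right)
qed

section \<open>Exchanging entries between two rows\<close>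

definition mix :: "nat set \<Rightarrow> (nat \<Rightarrow> int) \<Rightarrow> (nat \<Rightarrow> int) \<Rightarrow> nat \<Rightarrow> int" where
  "mix S p q = (\<lambda>i. if i \<in> S then q i else p i)"

text \<open>The coefficient of F at k pairs of fermion modes p i, q i. In each column the two modes
  anticommute and may occur in either order; S is the set of columns in which the order is
  reversed.\<close>

definition alt_coeff :: "nat \<Rightarrow> (gen multiset \<Rightarrow> complex) \<Rightarrow> (nat \<Rightarrow> int) \<Rightarrow> (nat \<Rightarrow> int) \<Rightarrow> complex" where
  "alt_coeff k F p q =
     (\<Sum>S\<in>Pow {..<k}. (-1) ^ card S * sym_coeff k F (row k (mix S p q)) (row k (mix S q p)))"

text \<open>Changing an entry commutes with exchanging columns, whichever row the entry currently
  occupies. Vanishing for all p and q is therefore inherited by \<open>act k g F\<close>.\<close>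

lemma alt_coeff_act:
  assumes F: "quad k F"
  shows "alt_coeff k (act k g F) p q = (\<Sum>i<k. pos_coeff g (p i) * alt_coeff k F (p(i := pos_pred g (p i))) q
      + pos_coeff g (q i) * alt_coeff k F p (q(i := pos_pred g (q i))))"
proof -
  let ?y = "sym_coeff k F"
  have "act2 k g ?y (row k (mix S p q)) (row k (mix S q p)) = (\<Sum>i<k.
      pos_coeff g (p i) * ?y (row k (mix S (p(i := pos_pred g (p i))) q)) (row k (mix S q (p(i := pos_pred g (p i)))))
      + pos_coeff g (q i) * ?y (row k (mix S p (q(i := pos_pred g (q i))))) (row k (mix S (q(i := pos_pred g (q i))) p)))" for S
  proof -
    have "act2 k g ?y (row k (mix S p q)) (row k (mix S q p)) = (\<Sum>i<k.
      pos_coeff g (mix S p q i) * ?y (row k ((mix S p q)(i := pos_pred g (mix S p q i)))) (row k (mix S q p))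
      + pos_coeff g (mix S q p i) * ?y (row k (mix S p q)) (row k ((mix S q p)(i := pos_pred g (mix S q p i)))))"
      unfolding act2_def sum.distrib
      by (subst row_pred_sum[of k g "mix S p q" "\<lambda>x. ?y x (row k (mix S q p))"],
          subst row_pred_sum[of k g "mix S q p" "\<lambda>x. ?y (row k (mix S p q)) x"]) simp
    also have "\<dots> = (\<Sum>i<k.
      pos_coeff g (p i) * ?y (row k (mix S (p(i := pos_pred g (p i))) q)) (row k (mix S q (p(i := pos_pred g (p i)))))
      + pos_coeff g (q i) * ?y (row k (mix S p (q(i := pos_pred g (q i))))) (row k (mix S (q(i := pos_pred g (q i))) p)))"
    proof (rule sum.cong)
      fix i
      have m: "mix S (p(i := z)) q = (if i \<in> S then mix S p q else (mix S p q)(i := z))"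
        "mix S p (q(i := z)) = (if i \<in> S then (mix S p q)(i := z) else mix S p q)" for p q :: "nat \<Rightarrow> int" and z
        by (auto simp: mix_def fun_eq_iff)
      show "pos_coeff g (mix S p q i) * ?y (row k ((mix S p q)(i := pos_pred g (mix S p q i)))) (row k (mix S q p))
        + pos_coeff g (mix S q p i) * ?y (row k (mix S p q)) (row k ((mix S q p)(i := pos_pred g (mix S q p i))))
        = pos_coeff g (p i) * ?y (row k (mix S (p(i := pos_pred g (p i))) q)) (row k (mix S q (p(i := pos_pred g (p i)))))
        + pos_coeff g (q i) * ?y (row k (mix S p (q(i := pos_pred g (q i))))) (row k (mix S (q(i := pos_pred g (q i))) p))"
        unfolding m by (cases "i \<in> S") (simp_all add: mix_def)
    qed simp
    finally show ?thesis .
  qed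
  then have "alt_coeff k (act k g F) p q = (\<Sum>S\<in>Pow {..<k}. \<Sum>i<k. (-1) ^ card S * (
      pos_coeff g (p i) * ?y (row k (mix S (p(i := pos_pred g (p i))) q)) (row k (mix S q (p(i := pos_pred g (p i)))))
      + pos_coeff g (q i) * ?y (row k (mix S p (q(i := pos_pred g (q i))))) (row k (mix S (q(i := pos_pred g (q i))) p))))"
    unfolding alt_coeff_def sym_coeff_act[OF F] by (simp only: sum_distrib_left)
  also have "\<dots> = (\<Sum>i<k. \<Sum>S\<in>Pow {..<k}. (-1) ^ card S * (
      pos_coeff g (p i) * ?y (row k (mix S (p(i := pos_pred g (p i))) q)) (row k (mix S q (p(i := pos_pred g (p i)))))
      + pos_coeff g (q i) * ?y (row k (mix S p (q(i := pos_pred g (q i))))) (row k (mix S (q(i := pos_pred g (q i))) p))))"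
    by (rule sum.swap)
  also have "\<dots> = (\<Sum>i<k. pos_coeff g (p i) * alt_coeff k F (p(i := pos_pred g (p i))) q
      + pos_coeff g (q i) * alt_coeff k F p (q(i := pos_pred g (q i))))"
    unfolding alt_coeff_def sum_distrib_left sum.distrib[symmetric]
    by (intro sum.cong refl) (simp add: algebra_simps)
  finally show ?thesis .
qed

lemma row_mix_sum:
  "fst (row k (mix S p q)) + fst (row k (mix S q p)) = fst (row k p) + fst (row k q)"
  "snd (row k (mix S p q)) + snd (row k (mix S q p)) = snd (row k p) + snd (row k q)"
  by (auto simp: row_def mix_def sum.distrib[symmetric] intro!: sum.cong)

lemma row_mix_snd:
  assumes "S \<subseteq> {..<k}"
  shows "snd (row k (mix S p q)) = snd (row k p) + (\<Sum>i\<in>S. (q i + 1) div 2 - (p i + 1) div 2)"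
proof -
  have "(\<Sum>i\<in>S. (q i + 1) div 2 - (p i + 1) div 2)
      = (\<Sum>i<k. if i \<in> S then (q i + 1) div 2 - (p i + 1) div 2 else 0)"
    using assms by (simp add: sum.inter_restrict[symmetric] Int_absorb1)
  then show ?thesis
    by (auto simp: row_def mix_def sum.distrib[symmetric] intro!: sum.cong)
qed

text \<open>In weight 0 the exchange over S only shifts the mode, by a sum of increments over S,
  while the symmetrised coefficient is a polynomial of degree less than k in the mode. The
  alternating sum is its k-fold difference.\<close>

lemma alt_coeff_fourier:
  assumes k: "k \<ge> 2"
  shows "alt_coeff k (series_sum k (fourier k d)) p q = 0"
proof (cases "fst (row k p) + fst (row k q) = 0 \<and> snd (row k p) + snd (row k q) = d")
  case True
  define f where "f = (\<lambda>n. deriv_coeff (k - 2) n + (-1) ^ k * deriv_coeff (k - 2) (d - n))"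
  have "degree_less (k - 1) (deriv_coeff (k - 2))"
    using degree_less_deriv_coeff[of "k - 2"] k by (simp add: Suc_diff_Suc numeral_2_eq_2)
  then have "degree_less (Suc (k - 1)) (deriv_coeff (k - 2))" by (rule degree_less_Suc)
  then have P: "degree_less k (deriv_coeff (k - 2))" using k by simp
  have f: "degree_less k f"
    unfolding f_def by (intro degree_less_add degree_less_scale degree_less_reflect P)
  have "sym_coeff k (series_sum k (fourier k d)) (row k (mix S p q)) (row k (mix S q p))
      = f (snd (row k q) + (\<Sum>i\<in>S. (p i + 1) div 2 - (q i + 1) div 2))" if S: "S \<in> Pow {..<k}" for S
  proof -
    have "fst (row k (mix S p q)) = 0" "fst (row k (mix S q p)) = 0"
      using row_mix_sum(1)[of k S p q] True by auto
    moreover have "snd (row k (mix S p q)) = d - snd (row k (mix S q p))"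
      using row_mix_sum(2)[of k S p q] True by auto
    ultimately show ?thesis
      using row_mix_snd[of S k q p] S by (simp add: fourier_ser2 sym_coeff_ser2 row_gens f_def)
  qed
  then have "alt_coeff k (series_sum k (fourier k d)) p q = (\<Sum>S\<in>Pow {..<k}. (-1) ^ card S *
      f (snd (row k q) + (\<Sum>i\<in>S. (p i + 1) div 2 - (q i + 1) div 2)))"
    by (simp add: alt_coeff_def)
  also have "\<dots> = 0" by (rule alternating_sum_zero) (use f in simp_all)
  finally show ?thesis .
next
  case False
  have "sym_coeff k (series_sum k (fourier k d)) (row k (mix S p q)) (row k (mix S q p)) = 0" for S
    using row_mix_sum[of k S p q] False by (auto simp: fourier_ser2 sym_coeff_ser2)
  then show ?thesis by (simp add: alt_coeff_def)
qed

lemma alt_coeff_Q2: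
  assumes "k \<ge> 2" "F \<in> Q2 k"
  shows "alt_coeff k F p q = 0"
  using assms(2)
proof (induction arbitrary: p q rule: Q2.induct)
  case (fourier d)
  then show ?case by (rule alt_coeff_fourier[OF assms(1)])
next
  case (add F G)
  have "alt_coeff k (\<lambda>M. F M + G M) p q = alt_coeff k F p q + alt_coeff k G p q"
    by (simp add: alt_coeff_def sym_coeff_def sum.distrib[symmetric] distrib_left)
  then show ?case using add by simp
next
  case (scale F c)
  have "alt_coeff k (\<lambda>M. c * F M) p q = c * alt_coeff k F p q"
    by (simp add: alt_coeff_def sym_coeff_def sum_distrib_left ac_simps)
  then show ?case using scale by simp
next
  case (act F g)
  then show ?case using Q2_quad[of F k] by (simp add: alt_coeff_act)
qed

section \<open>Determinantal functionals\<close>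

definition tuples :: "nat \<Rightarrow> nat \<Rightarrow> (nat \<Rightarrow> nat \<Rightarrow> nat) set" where
  "tuples k s = PiE {..<k} (\<lambda>_. {\<pi>. \<pi> permutes {..<s}})"

definition tuple_sign :: "nat \<Rightarrow> (nat \<Rightarrow> nat \<Rightarrow> nat) \<Rightarrow> complex" where
  "tuple_sign k \<sigma> = (\<Prod>i<k. of_int (sign (\<sigma> i)))"

definition arranges :: "nat \<Rightarrow> nat \<Rightarrow> (nat \<Rightarrow> nat \<Rightarrow> int) \<Rightarrow> (nat \<Rightarrow> nat \<Rightarrow> nat) \<Rightarrow> gen list \<Rightarrow> bool" where
  "arranges k s T \<sigma> w \<longleftrightarrow> length w = s \<and> (\<forall>l<s. w ! l = row k (\<lambda>i. T i (\<sigma> i l)))"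

text \<open>The coefficient of the exterior monomials given by the columns \<open>T i\<close> in the image of the word w
  under \<open>\<phi>\<^sub>a(z) \<mapsto> \<Sum>\<psi>\<^sup>1(z) \<dots> \<psi>\<^sup>k(z)\<close>, with k independent pairs of fermions.\<close>

definition det_fun :: "nat \<Rightarrow> nat \<Rightarrow> (nat \<Rightarrow> nat \<Rightarrow> int) \<Rightarrow> gen list \<Rightarrow> complex" where
  "det_fun k s T w = (\<Sum>\<sigma>\<in>tuples k s. if arranges k s T \<sigma> w then tuple_sign k \<sigma> else 0)"

definition letters :: "nat \<Rightarrow> nat \<Rightarrow> (nat \<Rightarrow> nat \<Rightarrow> int) \<Rightarrow> gen set" where
  "letters k s T = (\<lambda>(\<sigma>, l). row k (\<lambda>i. T i (\<sigma> i l))) ` (tuples k s \<times> {..<s})"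

text \<open>Exchanges the entries of the rows l and l + 1 in the columns of S only. Taking all
  columns exchanges two letters; general S produces \<open>mix\<close>. The restriction keeps the
  tuple extensional.\<close>

definition swap_tuple :: "nat \<Rightarrow> nat \<Rightarrow> nat set \<Rightarrow> (nat \<Rightarrow> nat \<Rightarrow> nat) \<Rightarrow> nat \<Rightarrow> nat \<Rightarrow> nat" where
  "swap_tuple k l S \<sigma> = restrict (\<lambda>i. if i \<in> S then \<sigma> i \<circ> transpose l (Suc l) else \<sigma> i) {..<k}"

lemma finite_tuples: "finite (tuples k s)"
  unfolding tuples_def by (intro finite_PiE) (simp_all add: finite_permutations)

lemma finite_letters: "finite (letters k s T)"
  by (simp add: letters_def finite_tuples)

lemma tuples_permutes: "\<sigma> \<in> tuples k s \<Longrightarrow> i < k \<Longrightarrow> \<sigma> i permutes {..<s}"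
  by (auto simp: tuples_def)

lemma swap_tuple_mem:
  assumes "\<sigma> \<in> tuples k s" "Suc l < s"
  shows "swap_tuple k l S \<sigma> \<in> tuples k s"
proof -
  have "transpose l (Suc l) permutes {..<s}" using assms(2) by (intro permutes_swap_id) auto
  then show ?thesis using tuples_permutes[OF assms(1)]
    by (auto simp: tuples_def swap_tuple_def intro!: permutes_compose)
qed

lemma swap_tuple_twice:
  assumes "\<sigma> \<in> tuples k s"
  shows "swap_tuple k l S (swap_tuple k l S \<sigma>) = \<sigma>"
proof
  fix i
  show "swap_tuple k l S (swap_tuple k l S \<sigma>) i = \<sigma> i"
  proof (cases "i < k")
    case True
    then show ?thesis by (simp add: swap_tuple_def comp_def)
  next
    case False
    then show ?thesis using assms PiE_arb[of \<sigma> "{..<k}" _ i] by (simp add: swap_tuple_def tuples_def)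
  qed
qed

lemma tuple_sign_swap:
  assumes "\<sigma> \<in> tuples k s" "S \<subseteq> {..<k}"
  shows "tuple_sign k (swap_tuple k l S \<sigma>) = (-1) ^ card S * tuple_sign k \<sigma>"
proof -
  have "of_int (sign (swap_tuple k l S \<sigma> i)) = (if i \<in> S then -1 else 1) * (of_int (sign (\<sigma> i)) :: complex)"
    if "i < k" for i
  proof -
    have "permutation (\<sigma> i)" using permutes_imp_permutation[OF _ tuples_permutes[OF assms(1) that]] by simp
    then show ?thesis using that
      by (simp add: swap_tuple_def sign_compose sign_swap_id permutation_swap_id)
  qed
  then have "tuple_sign k (swap_tuple k l S \<sigma>) = (\<Prod>i<k. if i \<in> S then -1 else 1) * tuple_sign k \<sigma>"
    unfolding tuple_sign_def prod.distrib[symmetric] by (intro prod.cong) auto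
  also have "(\<Prod>i<k. if i \<in> S then -1 else 1 :: complex) = (-1) ^ card S"
    using assms(2) by (simp add: prod.If_cases Int_absorb1)
  finally show ?thesis .
qed

lemma det_fun_swap:
  assumes "Suc l < s" "S \<subseteq> {..<k}"
  shows "det_fun k s T w = (\<Sum>\<sigma>\<in>tuples k s.
    if arranges k s T (swap_tuple k l S \<sigma>) w then (-1) ^ card S * tuple_sign k \<sigma> else 0)"
  unfolding det_fun_def
  by (rule sum.reindex_bij_witness[of _ "swap_tuple k l S" "swap_tuple k l S"])
    (use assms in \<open>auto simp: swap_tuple_mem swap_tuple_twice tuple_sign_swap\<close>)

lemma skew_det_fun: "skew k (det_fun k s T)"
  unfolding skew_def
proof (intro allI)
  fix u v :: "gen list" and x y
  show "det_fun k s T (u @ x # y # v) = (-1) ^ k * det_fun k s T (u @ y # x # v)"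
  proof (cases "length u + 2 + length v = s")
    case True
    let ?l = "length u"
    have l: "Suc ?l < s" using True by simp
    have "arranges k s T (swap_tuple k ?l {..<k} \<sigma>) (u @ x # y # v) \<longleftrightarrow> arranges k s T \<sigma> (u @ y # x # v)" for \<sigma>
    proof -
      have r: "row k (\<lambda>i. T i (swap_tuple k ?l {..<k} \<sigma> i j)) = row k (\<lambda>i. T i (\<sigma> i (transpose ?l (Suc ?l) j)))" for j
        by (rule row_cong) (simp add: swap_tuple_def)
      have n: "(u @ x # y # v) ! transpose ?l (Suc ?l) j = (u @ y # x # v) ! j" for j
        by (auto simp: transpose_def nth_append nth_Cons')
      have t: "transpose ?l (Suc ?l) j < s \<longleftrightarrow> j < s" for j using l by (auto simp: transpose_def)
      have "(\<forall>j<s. (u @ x # y # v) ! j = R (transpose ?l (Suc ?l) j)) \<longleftrightarrow> (\<forall>j<s. (u @ y # x # v) ! j = R j)" for R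
      proof (intro iffI allI impI)
        fix j assume R: "\<forall>j<s. (u @ x # y # v) ! j = R (transpose ?l (Suc ?l) j)" and "j < s"
        then show "(u @ y # x # v) ! j = R j" using R[rule_format, of "transpose ?l (Suc ?l) j"] t[of j] n[of j] by simp
      next
        fix j assume R: "\<forall>j<s. (u @ y # x # v) ! j = R j" and "j < s"
        then show "(u @ x # y # v) ! j = R (transpose ?l (Suc ?l) j)"
          using R[rule_format, of "transpose ?l (Suc ?l) j"] t[of j] n[of "transpose ?l (Suc ?l) j"] by simp
      qed
      from this[of "\<lambda>j. row k (\<lambda>i. T i (\<sigma> i j))"] show ?thesis unfolding arranges_def r by simp
    qed
    then show ?thesis
      unfolding det_fun_swap[OF l subset_refl, of k T "u @ x # y # v"]
      by (auto simp: det_fun_def sum_distrib_left intro!: sum.cong)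
  next
    case False
    then show ?thesis by (simp add: det_fun_def arranges_def)
  qed
qed

lemma det_fun_nz:
  assumes "det_fun k s T w \<noteq> 0"
  obtains \<sigma> where "\<sigma> \<in> tuples k s" "arranges k s T \<sigma> w"
proof -
  have "\<exists>\<sigma>\<in>tuples k s. arranges k s T \<sigma> w"
  proof (rule ccontr)
    assume "\<not> (\<exists>\<sigma>\<in>tuples k s. arranges k s T \<sigma> w)"
    then have "det_fun k s T w = 0" unfolding det_fun_def by (intro sum.neutral) simp
    then show False using assms by simp
  qed
  then show ?thesis using that by blast
qed

lemma det_fun_supp:
  assumes "det_fun k s T w \<noteq> 0"
  shows "length w = s \<and> set w \<subseteq> letters k s T"
proof -
  obtain \<sigma> where \<sigma>: "\<sigma> \<in> tuples k s" "arranges k s T \<sigma> w" by (rule det_fun_nz[OF assms])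
  have "w ! l \<in> letters k s T" if "l < s" for l
    unfolding letters_def using \<sigma> that by (intro image_eqI[of _ _ "(\<sigma>, l)"]) (auto simp: arranges_def)
  moreover have "length w = s" using \<sigma>(2) by (simp add: arranges_def)
  ultimately have "x \<in> letters k s T" if "x \<in> set w" for x using that by (metis in_set_conv_nth)
  then show ?thesis using \<open>length w = s\<close> by blast
qed

lemma finite_det_fun_embed: "finite {w. det_fun k s T (u @ w @ v) \<noteq> 0}"
proof (rule finite_subset)
  show "{w. det_fun k s T (u @ w @ v) \<noteq> 0} \<subseteq> {w. set w \<subseteq> letters k s T \<and> length w \<le> s}"
    using det_fun_supp by fastforce
qed (rule finite_lists_length_le[OF finite_letters])

text \<open>When F fills two adjacent places, exchanging the entries there column by column collects
  the contributions into values of \<open>alt_coeff\<close> at F, and these vanish.\<close>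

lemma det_fun_kills_Q2:
  assumes k: "k \<ge> 2" and F: "F \<in> Q2 k"
  shows "fpair (\<lambda>w. det_fun k s T (u @ w @ v)) F = 0"
proof -
  define h where "h = (\<lambda>w. det_fun k s T (u @ w @ v))"
  define X where "X = letters k s T"
  have finX: "finite X" by (simp add: X_def finite_letters)
  have q: "quad k F" using Q2_quad[OF F] by simp
  have skew: "skew k h" unfolding h_def by (rule skew_embed[OF skew_det_fun])
  have fin: "finite {w. h w \<noteq> 0}" unfolding h_def by (rule finite_det_fun_embed)
  define Gs where "Gs = (\<lambda>x y. if x \<le> y then F {#x, y#} else 0)"
  define G where "G = (\<lambda>w. case w of [x, y] \<Rightarrow> Gs x y | _ \<Rightarrow> 0)"
  have y: "sym_coeff k F x y = Gs x y + (-1) ^ k * Gs y x" for x y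
    using sym_coeff_sorted[OF q] by (simp add: Gs_def)
  have "F = ser2 k Gs"
    by (rule quad_eqI[OF q quad_ser2]) (use sym_coeff_gens[OF q] in \<open>auto simp: sym_coeff_ser2 y\<close>)
  then have FG: "F = series_sum k G" by (simp add: ser2_def G_def)
  have Gsupp: "set w \<subseteq> gens k \<and> (\<exists>x y. w = [x, y])" if "G w \<noteq> 0" for w
    using that q pair_basis[of _ _ k] by (auto simp: G_def Gs_def quad_def simp del: split_paired_All split: list.splits if_splits)
  have "fpair h F = (\<Sum>w | h w \<noteq> 0. G w * h w)"
    unfolding FG by (rule fpair_series[OF skew fin]) (use Gsupp in blast)
  also have "\<dots> = (\<Sum>w\<in>(\<lambda>(x, y). [x, y]) ` (X \<times> X). G w * h w)"
  proof (rule sum.mono_neutral_cong)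
    show "finite ((\<lambda>(x, y). [x, y]) ` (X \<times> X))" using finX by simp
  next
    fix w assume w: "w \<in> {w. h w \<noteq> 0} - (\<lambda>(x, y). [x, y]) ` (X \<times> X)"
    then have "set w \<subseteq> X" using det_fun_supp[of k s T "u @ w @ v"] by (auto simp: h_def X_def)
    then show "G w * h w = 0" using w Gsupp[of w] by (cases "G w = 0") auto
  qed (use fin in auto)
  also have "\<dots> = (\<Sum>x\<in>X. \<Sum>y\<in>X. Gs x y * h [x, y])"
    by (subst sum.reindex) (auto simp: inj_on_def G_def sum.cartesian_product intro!: sum.cong)
  finally have p1: "fpair h F = (\<Sum>x\<in>X. \<Sum>y\<in>X. Gs x y * h [x, y])" .
  have "(\<Sum>x\<in>X. \<Sum>y\<in>X. Gs x y * h [x, y]) = (\<Sum>y\<in>X. \<Sum>x\<in>X. Gs x y * h [x, y])"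
    by (rule sum.swap)
  also have "\<dots> = (\<Sum>x\<in>X. \<Sum>y\<in>X. (-1) ^ k * Gs y x * h [x, y])"
  proof (intro sum.cong refl)
    fix x y
    show "Gs y x * h [y, x] = (-1) ^ k * Gs y x * h [x, y]"
      using skewD[OF skew, of "[]" y x "[]"] by simp
  qed
  finally have "2 * fpair h F = (\<Sum>x\<in>X. \<Sum>y\<in>X. sym_coeff k F x y * h [x, y])"
    using p1 by (simp add: y distrib_right sum.distrib)
  moreover have "(\<Sum>x\<in>X. \<Sum>y\<in>X. sym_coeff k F x y * h [x, y]) = 0"
  proof (cases "length u + 2 + length v = s")
    case False
    then have "h [x, y] = 0" for x y by (simp add: h_def det_fun_def arranges_def)
    then show ?thesis by simp
  next
    case True
    define l where "l = length u"
    have l: "Suc l < s" using True by (simp add: l_def)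
    define P Q where "P = (\<lambda>\<sigma> i. T i (\<sigma> i l))" and "Q = (\<lambda>\<sigma> i. T i (\<sigma> i (Suc l)))"
    \<comment> \<open>The letters (0, 0) merely fill the places l and l + 1, which
      \<open>rest\<close> ignores; so it does not depend on x and y.\<close>
    define rest where "rest = (\<lambda>\<sigma>. \<forall>j<s. j \<noteq> l \<longrightarrow> j \<noteq> Suc l \<longrightarrow>
      (u @ (0, 0) # (0, 0) # v) ! j = row k (\<lambda>i. T i (\<sigma> i j)))"
    have arr: "arranges k s T (swap_tuple k l S \<sigma>) (u @ [x, y] @ v) \<longleftrightarrow>
        rest \<sigma> \<and> x = row k (mix S (P \<sigma>) (Q \<sigma>)) \<and> y = row k (mix S (Q \<sigma>) (P \<sigma>))" for S \<sigma> x y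
    proof -
      have r1: "row k (\<lambda>i. T i (swap_tuple k l S \<sigma> i l)) = row k (mix S (P \<sigma>) (Q \<sigma>))"
        by (rule row_cong) (simp add: swap_tuple_def mix_def P_def Q_def)
      have r2: "row k (\<lambda>i. T i (swap_tuple k l S \<sigma> i (Suc l))) = row k (mix S (Q \<sigma>) (P \<sigma>))"
        by (rule row_cong) (simp add: swap_tuple_def mix_def P_def Q_def)
      have r3: "row k (\<lambda>i. T i (swap_tuple k l S \<sigma> i j)) = row k (\<lambda>i. T i (\<sigma> i j))" if "j \<noteq> l" "j \<noteq> Suc l" for j
        by (rule row_cong) (use that in \<open>simp add: swap_tuple_def transpose_def\<close>)
      have n: "(u @ [x, y] @ v) ! j = (u @ (0, 0) # (0, 0) # v) ! j" if "j \<noteq> l" "j \<noteq> Suc l" for j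
        using that by (auto simp: nth_append nth_Cons' l_def)
      have n': "(u @ [x, y] @ v) ! l = x" "(u @ [x, y] @ v) ! Suc l = y" by (simp_all add: l_def nth_append)
      have split: "(\<forall>j<s. \<Phi> j) \<longleftrightarrow> (\<forall>j<s. j \<noteq> l \<longrightarrow> j \<noteq> Suc l \<longrightarrow> \<Phi> j) \<and> \<Phi> l \<and> \<Phi> (Suc l)" for \<Phi>
        using l Suc_lessD[OF l] by blast
      have eq: "(\<forall>j<s. j \<noteq> l \<longrightarrow> j \<noteq> Suc l \<longrightarrow>
          (u @ [x, y] @ v) ! j = row k (\<lambda>i. T i (swap_tuple k l S \<sigma> i j))) \<longleftrightarrow> rest \<sigma>"
        unfolding rest_def by (simp only: n r3 not_False_eq_True cong: imp_cong)
      have "(\<forall>j<s. (u @ [x, y] @ v) ! j = row k (\<lambda>i. T i (swap_tuple k l S \<sigma> i j))) \<longleftrightarrow>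
          rest \<sigma> \<and> x = row k (mix S (P \<sigma>) (Q \<sigma>)) \<and> y = row k (mix S (Q \<sigma>) (P \<sigma>))"
        by (subst split) (simp only: n' r1 r2 eq)
      then show ?thesis using True by (simp add: arranges_def)
    qed
    have inX: "row k (mix S (P \<sigma>) (Q \<sigma>)) \<in> X" "row k (mix S (Q \<sigma>) (P \<sigma>)) \<in> X"
      if "\<sigma> \<in> tuples k s" for S \<sigma>
    proof -
      have "row k (mix S (P \<sigma>) (Q \<sigma>)) = row k (\<lambda>i. T i (swap_tuple k l S \<sigma> i l))"
        "row k (mix S (Q \<sigma>) (P \<sigma>)) = row k (\<lambda>i. T i (swap_tuple k l S \<sigma> i (Suc l)))"
        by (rule row_cong, simp add: swap_tuple_def mix_def P_def Q_def)+
      then show "row k (mix S (P \<sigma>) (Q \<sigma>)) \<in> X" "row k (mix S (Q \<sigma>) (P \<sigma>)) \<in> X"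
        using swap_tuple_mem[OF that l, of S] l unfolding X_def letters_def by force+
    qed
    define c where "c = (\<lambda>\<sigma>. if rest \<sigma> then tuple_sign k \<sigma> else 0)"
    define \<delta> :: "nat set \<Rightarrow> (nat \<Rightarrow> nat \<Rightarrow> nat) \<Rightarrow> gen \<times> gen \<Rightarrow> complex" where
      "\<delta> = (\<lambda>S \<sigma> z. if z = (row k (mix S (P \<sigma>) (Q \<sigma>)), row k (mix S (Q \<sigma>) (P \<sigma>))) then 1 else 0)"
    \<comment> \<open>\<open>det_fun_swap\<close> expresses \<open>h [x, y]\<close> once for each S.
      Adding all 2^k expressions creates the sum over S in \<open>alt_coeff\<close>, at the price of
      a nonzero factor.\<close>
    have hx: "of_nat (card (Pow {..<k})) * h [x, y] =
        (\<Sum>S\<in>Pow {..<k}. \<Sum>\<sigma>\<in>tuples k s. c \<sigma> * (-1) ^ card S * \<delta> S \<sigma> (x, y))" for x y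
    proof -
      have "h [x, y] = (\<Sum>\<sigma>\<in>tuples k s. c \<sigma> * (-1) ^ card S * \<delta> S \<sigma> (x, y))" if "S \<in> Pow {..<k}" for S
      proof -
        have S: "S \<subseteq> {..<k}" using that by simp
        show ?thesis unfolding h_def det_fun_swap[OF l S] arr
          by (rule sum.cong) (auto simp: c_def \<delta>_def)
      qed
      then have "(\<Sum>S\<in>Pow {..<k}. h [x, y]) =
          (\<Sum>S\<in>Pow {..<k}. \<Sum>\<sigma>\<in>tuples k s. c \<sigma> * (-1) ^ card S * \<delta> S \<sigma> (x, y))"
        by (rule sum.cong[OF refl])
      then show ?thesis by simp
    qed
    let ?y = "\<lambda>z. sym_coeff k F (fst z) (snd z)"
    have "of_nat (card (Pow {..<k})) * (\<Sum>x\<in>X. \<Sum>y\<in>X. sym_coeff k F x y * h [x, y])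
        = (\<Sum>z\<in>X \<times> X. ?y z * (of_nat (card (Pow {..<k})) * h [fst z, snd z]))"
      by (simp only: sum.cartesian_product sum_distrib_left) (auto intro!: sum.cong)
    also have "\<dots> = (\<Sum>z\<in>X \<times> X. \<Sum>S\<in>Pow {..<k}. \<Sum>\<sigma>\<in>tuples k s. c \<sigma> * (-1) ^ card S * (?y z * \<delta> S \<sigma> z))"
      unfolding hx sum_distrib_left by (intro sum.cong refl) simp
    also have "\<dots> = (\<Sum>\<sigma>\<in>tuples k s. \<Sum>S\<in>Pow {..<k}. \<Sum>z\<in>X \<times> X. c \<sigma> * (-1) ^ card S * (?y z * \<delta> S \<sigma> z))"
      by (subst sum.swap, subst (2) sum.swap, subst sum.swap) (rule refl)
    also have "\<dots> = (\<Sum>\<sigma>\<in>tuples k s. \<Sum>S\<in>Pow {..<k}. c \<sigma> * ((-1) ^ card S *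
        sym_coeff k F (row k (mix S (P \<sigma>) (Q \<sigma>))) (row k (mix S (Q \<sigma>) (P \<sigma>)))))"
    proof (intro sum.cong refl)
      fix \<sigma> S assume "\<sigma> \<in> tuples k s"
      let ?a = "row k (mix S (P \<sigma>) (Q \<sigma>))" and ?b = "row k (mix S (Q \<sigma>) (P \<sigma>))"
      have ab: "(?a, ?b) \<in> X \<times> X" using inX[OF \<open>\<sigma> \<in> tuples k s\<close>] by simp
      have "(\<Sum>z\<in>X \<times> X. c \<sigma> * (-1) ^ card S * (?y z * \<delta> S \<sigma> z))
          = (\<Sum>z\<in>X \<times> X. if z = (?a, ?b) then c \<sigma> * ((-1) ^ card S * sym_coeff k F ?a ?b) else 0)"
        by (intro sum.cong refl) (simp add: \<delta>_def)
      also have "\<dots> = c \<sigma> * ((-1) ^ card S * sym_coeff k F ?a ?b)"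
        using ab finX by (simp only: sum.delta finite_cartesian_product if_True)
      finally show "(\<Sum>z\<in>X \<times> X. c \<sigma> * (-1) ^ card S * (?y z * \<delta> S \<sigma> z))
          = c \<sigma> * ((-1) ^ card S * sym_coeff k F ?a ?b)" .
    qed
    also have "\<dots> = (\<Sum>\<sigma>\<in>tuples k s. c \<sigma> * alt_coeff k F (P \<sigma>) (Q \<sigma>))"
      by (simp only: alt_coeff_def sum_distrib_left)
    also have "\<dots> = 0" by (simp add: alt_coeff_Q2[OF k F])
    finally show ?thesis by (simp add: card_Pow)
  qed
  ultimately show ?thesis by (simp add: h_def)
qed

definition annihilator :: "nat \<Rightarrow> (gen multiset \<Rightarrow> complex) set" where
  "annihilator k = {F \<in> carrier (Bbar k). \<forall>s T u v. fpair (\<lambda>w. det_fun k s T (u @ w @ v)) F = 0}"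

lemma ideal_annihilator: "ideal (annihilator k) (Bbar k)"
proof -
  interpret ring "Bbar k" by (rule ring_Bbar)
  have skew: "skew k (\<lambda>w. det_fun k s T (u @ w @ v))" for s T u v
    by (rule skew_embed[OF skew_det_fun])
  show ?thesis
  proof (rule idealI)
    show "subgroup (annihilator k) (add_monoid (Bbar k))"
    proof (rule subgroup.intro)
      show "annihilator k \<subseteq> carrier (add_monoid (Bbar k))" by (auto simp: annihilator_def)
      show "\<one>\<^bsub>add_monoid (Bbar k)\<^esub> \<in> annihilator k"
        using zero_closed by (auto simp: annihilator_def Bbar_zero fpair_def)
    next
      fix F G assume "F \<in> annihilator k" "G \<in> annihilator k"
      then show "F \<otimes>\<^bsub>add_monoid (Bbar k)\<^esub> G \<in> annihilator k"
        using a_closed[of F G] by (auto simp: annihilator_def Bbar_add fpair_add)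
    next
      fix F assume F: "F \<in> annihilator k"
      have "fpair f (\<lambda>M. - F M) = - fpair f F" for f using fpair_scale[of f "-1" F] by simp
      then have "(\<lambda>M. - F M) \<in> annihilator k"
        using F carrier_scale[of F k "-1"] by (simp add: annihilator_def)
      moreover have "inv\<^bsub>add_monoid (Bbar k)\<^esub> F = (\<lambda>M. - F M)"
        using Bbar_uminus[of F k] F by (simp add: annihilator_def a_inv_def)
      ultimately show "inv\<^bsub>add_monoid (Bbar k)\<^esub> F \<in> annihilator k" by simp
    qed
  next
    fix F G assume F: "F \<in> annihilator k" and G: "G \<in> carrier (Bbar k)"
    have Fc: "F \<in> carrier (Bbar k)" and Fz: "fpair (\<lambda>w. det_fun k s T (u @ w @ v)) F = 0" for s T u v
      using F by (auto simp: annihilator_def)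
    have "fpair (\<lambda>w. det_fun k s T (u @ w @ v)) (G \<otimes>\<^bsub>Bbar k\<^esub> F) = 0" for s T u v
      using fpair_mult_left_zero[OF skew finite_det_fun_embed G Fc] Fz[of s T "u @ _" v] by simp
    then show "G \<otimes>\<^bsub>Bbar k\<^esub> F \<in> annihilator k"
      using carrier_mult[OF G Fc] by (simp add: annihilator_def)
    have "fpair (\<lambda>w. det_fun k s T (u @ w @ v)) (F \<otimes>\<^bsub>Bbar k\<^esub> G) = 0" for s T u v
      using fpair_mult_right_zero[OF skew finite_det_fun_embed Fc G] Fz[of s T u "_ @ v"] by simp
    then show "F \<otimes>\<^bsub>Bbar k\<^esub> G \<in> annihilator k"
      using carrier_mult[OF Fc G] by (simp add: annihilator_def)
  qed (rule ring_axioms)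
qed

text \<open>Only finitely many letters enter the functional, so it cannot distinguish F from an
  approximation in the algebraic ideal that is correct up to the largest of their modes.\<close>

lemma det_fun_kills_rel_ideal:
  assumes k: "k \<ge> 2" and F: "F \<in> rel_ideal k"
  shows "fpair (det_fun k s T) F = 0"
proof -
  have "Q2 k \<subseteq> annihilator k"
    using Q2_carrier det_fun_kills_Q2[OF k] by (auto simp: annihilator_def)
  then have sub: "Idl\<^bsub>Bbar k\<^esub> (Q2 k) \<subseteq> annihilator k"
    by (rule ring.genideal_minimal[OF ring_Bbar ideal_annihilator])
  define N where "N = Max (insert 0 (snd ` letters k s T))"
  obtain G where G: "G \<in> Idl\<^bsub>Bbar k\<^esub> (Q2 k)" "\<And>M. \<forall>x\<in>#M. snd x \<le> N \<Longrightarrow> F M = G M"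
    using F unfolding rel_ideal_def adic_closure_def by blast
  have "fpair (det_fun k s T) F = fpair (det_fun k s T) G"
    unfolding fpair_def
  proof (rule sum.cong)
    fix M assume "M \<in> {M. det_fun k s T (sorted_list_of_multiset M) \<noteq> 0}"
    then have "set_mset M \<subseteq> letters k s T"
      using det_fun_supp[of k s T "sorted_list_of_multiset M"] by simp
    then have "snd x \<le> N" if "x \<in># M" for x
      unfolding N_def using that by (intro Max_ge) (auto simp: finite_letters)
    then show "F M * det_fun k s T (sorted_list_of_multiset M) = G M * det_fun k s T (sorted_list_of_multiset M)"
      using G(2)[of M] by simp
  qed simp
  also have "\<dots> = 0"
  proof -
    have "fpair (\<lambda>w. det_fun k s T ([] @ w @ [])) G = 0" using G(1) sub unfolding annihilator_def by blast
    then show ?thesis by simp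
  qed
  finally show ?thesis .
qed

section \<open>Triangularity\<close>

text \<open>The rearrangement inequality with its case of equality. Composing with the transposition
  that sends the largest entry to the last place reduces s by one.\<close>

lemma rearrangement:
  fixes t :: "nat \<Rightarrow> int"
  assumes "\<pi> permutes {..<s}" "\<And>i j. i < j \<Longrightarrow> j < s \<Longrightarrow> t i < t j"
  shows "(\<Sum>l<s. int l * t (\<pi> l)) \<le> (\<Sum>l<s. int l * t l) \<and>
    ((\<Sum>l<s. int l * t (\<pi> l)) = (\<Sum>l<s. int l * t l) \<longrightarrow> \<pi> = id)"
  using assms
proof (induction s arbitrary: \<pi>)
  case 0
  then show ?case by (simp add: permutes_empty)
next
  case (Suc s)
  obtain j where pj: "\<pi> j = s" using permutes_surj[OF Suc.prems(1)] by (metis surjD)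
  have j: "j \<le> s" using permutes_in_image[OF Suc.prems(1), of j] pj by simp
  have ps: "\<pi> s \<le> s" using permutes_in_image[OF Suc.prems(1), of s] by simp
  define \<rho> where "\<rho> = \<pi> \<circ> transpose j s"
  have rs: "\<rho> s = s" by (simp add: \<rho>_def pj)
  have "\<rho> permutes {..<Suc s}"
    unfolding \<rho>_def using j by (intro permutes_compose[OF permutes_swap_id Suc.prems(1)]) auto
  then have rho: "\<rho> permutes {..<s}"
    by (rule permutes_superset) (use rs in \<open>auto simp: less_Suc_eq\<close>)
  have IH: "(\<Sum>l<s. int l * t (\<rho> l)) \<le> (\<Sum>l<s. int l * t l)"
    "(\<Sum>l<s. int l * t (\<rho> l)) = (\<Sum>l<s. int l * t l) \<Longrightarrow> \<rho> = id"
    using Suc.IH[OF rho] Suc.prems(2) by auto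
  have diff: "(\<Sum>l<Suc s. int l * t (\<rho> l)) - (\<Sum>l<Suc s. int l * t (\<pi> l)) = (int s - int j) * (t s - t (\<pi> s))"
  proof (cases "j = s")
    case True
    then show ?thesis by (simp add: \<rho>_def)
  next
    case False
    then have js: "j < s" using j by simp
    have "(\<Sum>l<s. int l * t (\<rho> l)) = int j * t (\<rho> j) + (\<Sum>l\<in>{..<s} - {j}. int l * t (\<rho> l))"
      "(\<Sum>l<s. int l * t (\<pi> l)) = int j * t (\<pi> j) + (\<Sum>l\<in>{..<s} - {j}. int l * t (\<pi> l))"
      using js by (auto intro: sum.remove)
    moreover have "(\<Sum>l\<in>{..<s} - {j}. int l * t (\<rho> l)) = (\<Sum>l\<in>{..<s} - {j}. int l * t (\<pi> l))"
      by (rule sum.cong) (auto simp: \<rho>_def transpose_def)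
    moreover have "\<rho> j = \<pi> s" by (simp add: \<rho>_def)
    ultimately show ?thesis by (simp add: rs pj algebra_simps)
  qed
  have tps: "t (\<pi> s) \<le> t s" using Suc.prems(2)[of "\<pi> s" s] ps by (cases "\<pi> s = s") auto
  have nonneg: "(int s - int j) * (t s - t (\<pi> s)) \<ge> 0" using j tps by simp
  have strict: "(int s - int j) * (t s - t (\<pi> s)) > 0" if "j \<noteq> s"
  proof -
    have "\<pi> s \<noteq> s" using that pj permutes_inj[OF Suc.prems(1)] by (metis injD)
    then have "t (\<pi> s) < t s" using Suc.prems(2)[of "\<pi> s" s] ps by simp
    then show ?thesis using that j by simp
  qed
  have "\<pi> = id" if eq: "(\<Sum>l<Suc s. int l * t (\<pi> l)) = (\<Sum>l<Suc s. int l * t l)"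
  proof -
    have "j = s" using strict diff eq IH(1) rs by (force simp: algebra_simps)
    then have "\<rho> = \<pi>" by (simp add: \<rho>_def)
    moreover have "\<rho> = id" using IH(2) eq \<open>\<rho> = \<pi>\<close> rs by simp
    ultimately show ?thesis by simp
  qed
  moreover have "(\<Sum>l<Suc s. int l * t (\<pi> l)) \<le> (\<Sum>l<Suc s. int l * t l)"
    using diff nonneg IH(1) rs by simp
  ultimately show ?case by blast
qed

lemma energy_sum: "energy w = (\<Sum>l<length w. (int (length w) - int l) * pos (w ! l))"
proof (induction w)
  case (Cons x w)
  have "(\<Sum>l<Suc (length w). (int (Suc (length w)) - int l) * pos ((x # w) ! l))
      = int (Suc (length w)) * pos x + (\<Sum>l<length w. (int (length w) - int l) * pos (w ! l))"
    unfolding sum.lessThan_Suc_shift by simp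
  then show ?case using Cons by simp
qed simp

definition total_pos :: "gen list \<Rightarrow> int" where
  "total_pos w = (\<Sum>l<length w. pos (w ! l))"

lemma arranges_energy:
  assumes "arranges k s T \<sigma> w"
  shows "energy w = (\<Sum>i<k. int s * (\<Sum>l<s. T i (\<sigma> i l)) - (\<Sum>l<s. int l * T i (\<sigma> i l)))"
    "total_pos w = (\<Sum>i<k. \<Sum>l<s. T i (\<sigma> i l))"
proof -
  have w: "length w = s" "\<And>l. l < s \<Longrightarrow> pos (w ! l) = (\<Sum>i<k. T i (\<sigma> i l))"
    using assms by (auto simp: arranges_def pos_row)
  have "energy w = (\<Sum>l<s. \<Sum>i<k. (int s - int l) * T i (\<sigma> i l))"
    by (simp add: energy_sum w sum_distrib_left)
  also have "\<dots> = (\<Sum>i<k. \<Sum>l<s. (int s - int l) * T i (\<sigma> i l))" by (rule sum.swap)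
  finally show "energy w = (\<Sum>i<k. int s * (\<Sum>l<s. T i (\<sigma> i l)) - (\<Sum>l<s. int l * T i (\<sigma> i l)))"
    by (simp add: left_diff_distrib sum_subtractf sum_distrib_left)
  have "total_pos w = (\<Sum>l<s. \<Sum>i<k. T i (\<sigma> i l))" by (simp add: total_pos_def w)
  also have "\<dots> = (\<Sum>i<k. \<Sum>l<s. T i (\<sigma> i l))" by (rule sum.swap)
  finally show "total_pos w = (\<Sum>i<k. \<Sum>l<s. T i (\<sigma> i l))" .
qed

definition id_tuple :: "nat \<Rightarrow> nat \<Rightarrow> nat \<Rightarrow> nat" where
  "id_tuple k = restrict (\<lambda>_. id) {..<k}"

lemma id_tuple_mem: "id_tuple k \<in> tuples k s"
  by (auto simp: id_tuple_def tuples_def permutes_id)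

text \<open>The column sums are the same for all tuples, so the energy is a constant minus the
  weighted column sums. Each of these is largest only for the identity, because the columns increase
  strictly.\<close>

lemma arranges_triangular:
  assumes T: "\<And>i l l'. i < k \<Longrightarrow> l < l' \<Longrightarrow> l' < s \<Longrightarrow> T i l < T i l'"
    and w0: "arranges k s T (id_tuple k) w0" and \<sigma>: "\<sigma> \<in> tuples k s" "arranges k s T \<sigma> w"
  shows "total_pos w = total_pos w0" "energy w0 \<le> energy w" "energy w = energy w0 \<Longrightarrow> \<sigma> = id_tuple k"
proof -
  have perm: "(\<Sum>l<s. T i (\<sigma> i l)) = (\<Sum>l<s. T i l)" if "i < k" for i
    using sum.permute[OF tuples_permutes[OF \<sigma>(1) that], of "T i"] by (simp add: comp_def)
  have r: "(\<Sum>l<s. int l * T i (\<sigma> i l)) \<le> (\<Sum>l<s. int l * T i l)"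
    "(\<Sum>l<s. int l * T i (\<sigma> i l)) = (\<Sum>l<s. int l * T i l) \<Longrightarrow> \<sigma> i = id" if "i < k" for i
    using rearrangement[OF tuples_permutes[OF \<sigma>(1) that], of "T i"] T[OF that] by auto
  show "total_pos w = total_pos w0"
    unfolding arranges_energy(2)[OF w0] arranges_energy(2)[OF \<sigma>(2)] by (simp add: perm id_tuple_def)
  have diff: "energy w - energy w0 = (\<Sum>i<k. (\<Sum>l<s. int l * T i l) - (\<Sum>l<s. int l * T i (\<sigma> i l)))"
    unfolding arranges_energy(1)[OF w0] arranges_energy(1)[OF \<sigma>(2)]
    by (simp add: perm id_tuple_def flip: sum_subtractf)
  have "0 \<le> (\<Sum>i<k. (\<Sum>l<s. int l * T i l) - (\<Sum>l<s. int l * T i (\<sigma> i l)))"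
    by (rule sum_nonneg) (use r(1) in simp)
  then show "energy w0 \<le> energy w" using diff by simp
  show "\<sigma> = id_tuple k" if "energy w = energy w0"
  proof
    fix i
    have "(\<Sum>i<k. (\<Sum>l<s. int l * T i l) - (\<Sum>l<s. int l * T i (\<sigma> i l))) = 0" using that diff by simp
    then have z: "\<forall>i\<in>{..<k}. (\<Sum>l<s. int l * T i l) - (\<Sum>l<s. int l * T i (\<sigma> i l)) = 0"
      by (subst (asm) sum_nonneg_eq_0_iff) (use r(1) in auto)
    show "\<sigma> i = id_tuple k i"
    proof (cases "i < k")
      case True
      then show ?thesis using z r(2)[of i] by (simp add: id_tuple_def)
    next
      case False
      then show ?thesis using \<sigma>(1) PiE_arb[of \<sigma> "{..<k}" _ i] by (simp add: id_tuple_def tuples_def)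
    qed
  qed
qed

lemma det_fun_triangular:
  assumes T: "\<And>i l l'. i < k \<Longrightarrow> l < l' \<Longrightarrow> l' < s \<Longrightarrow> T i l < T i l'"
    and w0: "length w0 = s" "\<And>l. l < s \<Longrightarrow> row k (\<lambda>i. T i l) = w0 ! l"
  shows "det_fun k s T w0 = 1"
    "det_fun k s T w \<noteq> 0 \<Longrightarrow> w \<noteq> w0 \<Longrightarrow> length w = s \<and> total_pos w = total_pos w0 \<and> energy w0 < energy w"
proof -
  have row_id: "row k (\<lambda>i. T i (id_tuple k i l)) = row k (\<lambda>i. T i l)" for l
    by (rule row_cong) (simp add: id_tuple_def)
  have a0: "arranges k s T (id_tuple k) w0" using w0 by (simp add: arranges_def row_id)
  have "arranges k s T \<sigma> w0 \<longleftrightarrow> \<sigma> = id_tuple k" if "\<sigma> \<in> tuples k s" for \<sigma>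
    using arranges_triangular(3)[OF T a0 that, of w0] a0 by blast
  then have "det_fun k s T w0 = (\<Sum>\<sigma>\<in>tuples k s. if \<sigma> = id_tuple k then tuple_sign k \<sigma> else 0)"
    unfolding det_fun_def by (intro sum.cong) auto
  also have "\<dots> = tuple_sign k (id_tuple k)" by (simp add: finite_tuples id_tuple_mem)
  also have "\<dots> = 1" by (simp add: tuple_sign_def id_tuple_def sign_id)
  finally show "det_fun k s T w0 = 1" .
  assume nz: "det_fun k s T w \<noteq> 0" and ne: "w \<noteq> w0"
  obtain \<sigma> where \<sigma>: "\<sigma> \<in> tuples k s" "arranges k s T \<sigma> w" by (rule det_fun_nz[OF nz])
  have "\<sigma> \<noteq> id_tuple k"
  proof
    assume "\<sigma> = id_tuple k"
    then have "w = w0" using \<sigma>(2) a0 by (intro nth_equalityI) (auto simp: arranges_def)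
    then show False using ne by simp
  qed
  then have "energy w \<noteq> energy w0" using arranges_triangular(3)[OF T a0 \<sigma>] by blast
  then show "length w = s \<and> total_pos w = total_pos w0 \<and> energy w0 < energy w"
    using arranges_triangular(1,2)[OF T a0 \<sigma>] \<sigma>(2) by (simp add: arranges_def)
qed

subsection \<open>Columns of a normal-ordered word\<close>

text \<open>In a strict step the mode stays fixed only from an odd entry to the next even one. At
  most min(a, k - b) columns can do this, all others gain at least one, and the condition on
  \<open>h_fun\<close> says that the total gain in mode suffices.\<close>

lemma next_row:
  assumes k: "k \<ge> 1" and xy: "(row k r, y) \<in> normal_pairs k"
  obtains r' where "row k r' = y" "\<And>i. i < k \<Longrightarrow> r i < r' i"
proof -
  define a where "a = fst (row k r)"
  define Od where "Od = {i \<in> {..<k}. odd (r i)}"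
  have fin_Od: "finite Od" by (simp add: Od_def)
  have card_Od: "card Od = a"
  proof -
    have "a = (\<Sum>i<k. if odd (r i) then 1 else 0)"
      unfolding a_def row_def fst_conv
      by (intro sum.cong) (auto simp: even_iff_mod_2_eq_zero odd_iff_mod_2_eq_one)
    then show ?thesis by (simp add: Od_def sum.If_cases Int_def)
  qed
  obtain b n where y: "y = (b, n)" by fastforce
  have b: "b \<le> k" using xy y by (auto simp: normal_pairs_def gens_iff)
  define z where "z = min a (k - b)"
  have h: "int z - snd (row k r) + n \<ge> int k"
    using xy unfolding normal_pairs_def y z_def a_def by (cases "row k r") auto
  obtain Z where Z: "Z \<subseteq> Od" "card Z = z"
    using obtain_subset_with_card_n[of z Od] card_Od by (auto simp: z_def)
  have Zk: "Z \<subseteq> {..<k}" "finite Z" using Z fin_Od by (auto simp: Od_def intro: finite_subset)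
  have "b \<le> card ({..<k} - Z)" using Zk Z b by (simp add: card_Diff_subset z_def)
  then obtain W where W: "W \<subseteq> {..<k} - Z" "card W = b" using obtain_subset_with_card_n by metis
  define ex where "ex = int z - snd (row k r) + n - int k"
  have ex: "ex \<ge> 0" using h by (simp add: ex_def)
  \<comment> \<open>The cheapest increasing choice: Z keeps its modes and becomes even, W becomes
    odd and the rest even, both gaining one mode. The surplus \<open>ex\<close> goes to column 0,
    where adding 2 raises the mode by one without changing the parity.\<close>
  define r0 where "r0 = (\<lambda>i. if i \<in> Z then r i + 1 else if i \<in> W then 2 * ((r i + 1) div 2) + 1 else 2 * ((r i + 1) div 2) + 2)"
  define r' where "r' = (\<lambda>i. r0 i + (if i = 0 then 2 * ex else 0))"
  have oddZ: "odd (r i)" if "i \<in> Z" for i using that Z by (auto simp: Od_def)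
  have "r i < r' i" for i
  proof -
    have "r i < 2 * ((r i + 1) div 2) + 1" by linarith
    then have "r i < r0 i" by (simp add: r0_def)
    then show ?thesis using ex by (cases "i = 0") (auto simp: r'_def)
  qed
  moreover have "row k r' = y"
  proof -
    have m: "nat (r' i mod 2) = (if i \<in> W then 1 else 0)" for i
    proof -
      have "r' i mod 2 = r0 i mod 2" by (simp add: r'_def)
      also have "\<dots> = (if i \<in> W then 1 else 0)"
        using oddZ[of i] W by (auto simp: r0_def mod_2_eq_odd)
      finally show ?thesis by simp
    qed
    have "(\<Sum>i<k. nat (r' i mod 2)) = b"
    proof -
      have "{..<k} \<inter> W = W" using W(1) by blast
      then show ?thesis using W(2) by (simp add: m sum.If_cases)
    qed
    moreover have "(\<Sum>i<k. (r' i + 1) div 2) = n"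
    proof -
      have d: "(r' i + 1) div 2 = (r i + 1) div 2 + 1 - (if i \<in> Z then 1 else 0) + (if i = 0 then ex else 0)" for i
      proof -
        have "(p + 2 * q + 1) div 2 = (p + 1) div 2 + q" for p q :: int by presburger
        then have "(r' i + 1) div 2 = (r0 i + 1) div 2 + (if i = 0 then ex else 0)" by (simp add: r'_def)
        moreover have "(r0 i + 1) div 2 = (r i + 1) div 2 + 1 - (if i \<in> Z then 1 else 0)"
          using oddZ[of i] by (auto simp: r0_def elim!: oddE)
        ultimately show ?thesis by simp
      qed
      have "(\<Sum>i<k. if i \<in> Z then 1 else 0 :: int) = int z"
        using Zk Z(2) by (simp add: sum.If_cases Int_absorb1)
      moreover have "(\<Sum>i<k. if i = 0 then ex else 0) = ex" using k by (simp add: sum.delta)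
      moreover have "(\<Sum>i<k. (r i + 1) div 2) = snd (row k r)" by (simp add: row_def)
      ultimately show ?thesis
        by (simp add: d sum.distrib sum_subtractf ex_def)
    qed
    ultimately show ?thesis by (simp add: row_def y)
  qed
  ultimately show ?thesis using that by blast
qed

lemma first_row:
  assumes k: "k \<ge> 1" and y: "y \<in> gens k"
  obtains r where "row k r = y"
proof -
  \<comment> \<open>Large enough for the constant row -2 * K to precede y, so that
    \<open>next_row\<close> yields a row for y itself.\<close>
  define K where "K = int k + \<bar>snd y\<bar>"
  have r: "row k (\<lambda>i. - 2 * K) = (0, - (int k * K))"
  proof -
    have "(- 2 * K + 1) div 2 = - K" by simp
    then show ?thesis by (simp add: row_def)
  qed
  have "K \<le> int k * K" using k mult_right_mono[of 1 "int k" K] by (simp add: K_def)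
  then have "(row k (\<lambda>i. - 2 * K), y) \<in> normal_pairs k"
    using y unfolding r by (cases y) (auto simp: normal_pairs_def gens_iff K_def)
  then show ?thesis using next_row[OF k] that by metis
qed

lemma normal_ordered_columns:
  assumes k: "k \<ge> 1" and w: "normal_ordered k w"
  obtains T where "\<And>l. l < length w \<Longrightarrow> row k (\<lambda>i. T i l) = w ! l"
    "\<And>i l l'. i < k \<Longrightarrow> l < l' \<Longrightarrow> l' < length w \<Longrightarrow> T i l < T i l'"
proof -
  have "\<exists>T. (\<forall>l<length w. row k (\<lambda>i. T i l) = w ! l) \<and> (\<forall>i<k. \<forall>l'<length w. \<forall>l<l'. T i l < T i l')"
    using w
  proof (induction w rule: rev_induct)
    case (snoc y w)
    have gy: "y \<in> gens k" using snoc.prems by (simp add: normal_ordered_def)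
    have nw: "normal_ordered k w"
    proof -
      have "(w ! i, w ! (i + 1)) \<in> normal_pairs k" if "i + 1 < length w" for i
        using snoc.prems that unfolding normal_ordered_def
        by (metis Suc_eq_plus1 Suc_lessD length_append_singleton less_Suc_eq nth_append)
      then show ?thesis using snoc.prems by (simp add: normal_ordered_def)
    qed
    then obtain T where T: "\<And>l. l < length w \<Longrightarrow> row k (\<lambda>i. T i l) = w ! l"
      "\<And>i l l'. i < k \<Longrightarrow> l' < length w \<Longrightarrow> l < l' \<Longrightarrow> T i l < T i l'" using snoc.IH by blast
    obtain r where r: "row k r = y" "\<And>i. i < k \<Longrightarrow> w \<noteq> [] \<Longrightarrow> T i (length w - 1) < r i"
    proof (cases "w = []")
      case True
      then show ?thesis using first_row[OF k gy] that by metis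
    next
      case False
      then have "length w - 1 + 1 < length (w @ [y])" by (cases w) auto
      then have "((w @ [y]) ! (length w - 1), (w @ [y]) ! (length w - 1 + 1)) \<in> normal_pairs k"
        using snoc.prems unfolding normal_ordered_def by blast
      then have "(row k (\<lambda>i. T i (length w - 1)), y) \<in> normal_pairs k"
        using False T(1)[of "length w - 1"] by (simp add: nth_append)
      then show ?thesis using next_row[OF k] that by metis
    qed
    define T' where "T' = (\<lambda>i l. if l < length w then T i l else r i)"
    have "row k (\<lambda>i. T' i l) = (w @ [y]) ! l" if "l < length (w @ [y])" for l
      using that T(1)[of l] r(1) by (auto simp: T'_def nth_append less_Suc_eq)
    moreover have "T' i l < T' i l'" if "i < k" "l' < length (w @ [y])" "l < l'" for i l l'
    proof (cases "l' < length w")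
      case True
      then show ?thesis using that T(2) by (simp add: T'_def)
    next
      case False
      then have l: "l < length w" "w \<noteq> []" using that by auto
      have "T i l \<le> T i (length w - 1)"
      proof (cases "l = length w - 1")
        case False
        then have "l < length w - 1" using l by linarith
        then show ?thesis using T(2)[OF that(1), of "length w - 1" l] l(2) by simp
      qed simp
      then show ?thesis using r(2)[OF that(1) l(2)] False l by (simp add: T'_def)
    qed
    ultimately show ?case by blast
  qed simp
  then show ?thesis using that by blast
qed

text \<open>Positions increase weakly along a normal-ordered word while the weights in the energy
  decrease, so Chebyshev's sum inequality applies. This bound provides a word of maximal energy in
  an infinite series.\<close>

lemma normal_ordered_energy_bound:
  assumes w: "normal_ordered k w"
  shows "energy w \<le> \<bar>total_pos w * (\<Sum>l<length w. int (length w) - int l)\<bar>"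
proof (cases "w = []")
  case False
  have step: "pos (w ! l) \<le> pos (w ! Suc l)" if "Suc l < length w" for l
  proof -
    have n: "(w ! l, w ! Suc l) \<in> normal_pairs k" using w that by (simp add: normal_ordered_def)
    then have g: "w ! l \<in> gens k" "w ! Suc l \<in> gens k" by (auto simp: normal_pairs_def)
    then show ?thesis using n unfolding normal_pairs_pos[OF g] by (auto simp: pos_def gens_iff)
  qed
  have mono: "pos (w ! i) \<le> pos (w ! j)" if "i \<le> j" "j < length w" for i j
    using that
  proof (induction j rule: dec_induct)
    case (step j)
    then show ?case using \<open>\<And>l. Suc l < length w \<Longrightarrow> pos (w ! l) \<le> pos (w ! Suc l)\<close>[of j] by simp
  qed simp
  have "int (length w) * (\<Sum>l=0..<length w. pos (w ! l) * (int (length w) - int l))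
      \<le> (\<Sum>l=0..<length w. pos (w ! l)) * (\<Sum>l=0..<length w. int (length w) - int l)"
    by (rule Chebyshev_sum_upper) (use mono in auto)
  then have "int (length w) * energy w \<le> total_pos w * (\<Sum>l<length w. int (length w) - int l)"
    by (simp add: energy_sum total_pos_def atLeast0LessThan mult.commute)
  moreover have "energy w \<le> int (length w) * energy w" if "energy w \<ge> 0"
    using False that by (simp add: mult_le_cancel_right1 Suc_leI)
  ultimately show ?thesis by linarith
qed simp

section \<open>Linear independence\<close>

text \<open>The functional built from the columns of a word w0 of maximal energy is 1 at w0 and
  otherwise sees only words of the same length and total position but larger energy, which do not
  occur in G. Its value is the coefficient of w0.\<close>

lemma normal_series_independent:
  assumes k: "k \<ge> 2" and G: "G \<in> normal_series k"
    and z: "R_class k (series_sum k G) = \<zero>\<^bsub>R_alg k\<^esub>"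
  shows "G w = 0"
proof (rule ccontr)
  assume nz: "G w \<noteq> 0"
  define A where "A = (\<lambda>v. G v \<noteq> 0 \<and> length v = length w \<and> total_pos v = total_pos w)"
  define b where "b = \<bar>total_pos w * (\<Sum>l<length w. int (length w) - int l)\<bar>"
  have norm: "normal_ordered k v" if "G v \<noteq> 0" for v using G that by (auto simp: normal_series_def)
  have bound: "energy v \<le> b" if "A v" for v
    using normal_ordered_energy_bound[OF norm[of v]] that by (auto simp: A_def b_def)
  obtain w0 where w0: "A w0" "\<And>v. A v \<Longrightarrow> nat (b - energy w0) \<le> nat (b - energy v)"
    using ex_has_least_nat[of A w "\<lambda>v. nat (b - energy v)"] nz by (auto simp: A_def)
  have max: "energy v \<le> energy w0" if "A v" for v
    using w0(2)[OF that] bound[OF that] bound[OF w0(1)] by simp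
  have G0: "G w0 \<noteq> 0" using w0(1) by (simp add: A_def)
  define s where "s = length w0"
  obtain T where T: "\<And>l. l < s \<Longrightarrow> row k (\<lambda>i. T i l) = w0 ! l"
    "\<And>i l l'. i < k \<Longrightarrow> l < l' \<Longrightarrow> l' < s \<Longrightarrow> T i l < T i l'"
    using normal_ordered_columns[of k w0] norm[OF G0] k unfolding s_def by auto
  let ?f = "det_fun k s T"
  have f0: "?f w0 = 1"
    by (rule det_fun_triangular(1)[OF T(2) _ T(1)]) (simp_all add: s_def)
  have tri: "length v = s \<and> total_pos v = total_pos w0 \<and> energy w0 < energy v"
    if "?f v \<noteq> 0" "v \<noteq> w0" for v
    by (rule det_fun_triangular(2)[OF T(2) _ T(1) that]) (simp_all add: s_def)
  have fin: "finite {v. ?f v \<noteq> 0}" using finite_det_fun_embed[of k s T "[]" "[]"] by simp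
  have zero: "G v = 0" if "?f v \<noteq> 0" "v \<noteq> w0" for v
  proof (rule ccontr)
    assume "G v \<noteq> 0"
    then have "A v" using tri[OF that] w0(1) by (simp add: A_def s_def)
    then show False using max[of v] tri[OF that] by simp
  qed
  have "fpair ?f (series_sum k G) = (\<Sum>v | ?f v \<noteq> 0. G v * ?f v)"
    using G by (intro fpair_series skew_det_fun fin) (auto simp: normal_series_def word_series_def)
  also have "\<dots> = (\<Sum>v\<in>{w0}. G v * ?f v)"
    by (rule sum.mono_neutral_right) (use fin f0 zero in auto)
  also have "\<dots> = G w0" using f0 by simp
  finally show False
    using det_fun_kills_rel_ideal[OF k R_class_zero[OF z], of s T] G0 by simp
qed

theorem proposition9:
  fixes k :: nat
  assumes "k \<ge> 2"
  shows "(\<forall>w. set w \<subseteq> gens k \<longrightarrow>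
            (\<exists>G\<in>normal_series k. rewrites_to k (single_word w) G \<and>
               R_class k (word_prod k w) = R_class k (series_sum k G))) \<and>
         (\<forall>G\<in>normal_series k.
            R_class k (series_sum k G) = \<zero>\<^bsub>R_alg k\<^esub> \<longrightarrow> (\<forall>w. G w = 0))"
  using word_rewrites[OF assms] normal_series_independent[OF assms] by blast

end
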